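(* Let $\Sigma=\Sigma_{g,n}$ with $n\ge1$ and $F=\pi_1(\Sigma,* )$. For any $q$, $\tilde\mu_q$ is a homology cobordism invariant: if $M$ and $M'$ are homology cobordant homology cylinders over $\Sigma$, then $\tilde\mu_q(M)=\tilde\mu_q(M')$. In other words, there is an induced map $$\tilde\mu_q\colon\mathcal H_{g,n}\to(F/F_q)^{2g+n-1}.$$
   Context: For a group $G$: $G_1=G$, $G_{k+1}=[G,G_k]$. Manifolds are compact and oriented; the result is meant in either the topological or the smooth category. $\Sigma=\Sigma_{g,n}$ is a connected surface of genus $g$ with $n\ge1$ boundary components $\partial_1,\dots,\partial_n$. Homology cylinders. A homology cylinder over $\Sigma$ is a 3-manifold $M$ with two embeddings $i_+,i_-\colon\Sigma\hookrightarrow\partial M$ (markings) such that $i_+|_{\partial\Sigma}=i_-|_{\partial\Sigma}$; $i_+\cup i_-\colon\Sigma\cup_\partial(-\Sigma)\to\partial M$ is an orientation-preserving homeomorphism; and $i_\pm$ induce isomorphisms $H_*(\Sigma;\mathbb Z)\to H_*(M;\mathbb Z)$. Two homology cylinders $(M,i_\pm),(N,j_\pm)$ are homology cobordant if there is a 4-manifold $W$ with $\partial W=M\cup(-N)/\!\sim$, where $\sim$ identifies $i_+(x)$ with $j_+(x)$ and $i_-(x)$ with $j_-(x)$ for $x\in\Sigma$, such that $M\hookrightarrow W$, $N\hookrightarrow W$ induce isomorphisms on integral homology. $\mathcal H_{g,n}$ is the set (in fact group) of homology cobordism classes. Extended Milnor invariants. Fix a base point $*\in\partial_n$ and the standard free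 generating set $x_1,\dots,x_{n-1},m_1,\dots,m_g,l_1,\dots,l_g$ of $F=\pi_1(\Sigma,* )$, where $x_i$ is freely homotopic to $\partial_i$, $m_j,l_j$ are a meridian and longitude of the $j$th handle, and $[\partial_n]=\prod_i x_i\prod_j[m_j,l_j]$. Write $x_i=[\alpha_i\cdot\beta_i\cdot\alpha_i^{-1}]$ with $\beta_i$ a closed path parametrizing $\partial_i$ (homeomorphically on $I/\partial I$) and $\alpha_i$ a path from $*$ to $\beta_i(0)$. For a homology cylinder $M$ define in $\pi_1(M,i_+( * ))$: $\lambda_i=[(i_+\circ\alpha_i)\cdot(i_-\circ\alpha_i^{-1})]$ ($1\le i\le n-1$), $\lambda'_j=(i_+)_*(m_j)(i_-)_*(m_j^{-1})$, $\lambda''_j=(i_+)_*(l_j)(i_-)_*(l_j^{-1})$ ($1\le j\le g$). By Stallings' theorem $i_+$ induces an isomorphism $(i_+)_{*q}\colon F/F_q\to\pi_1(M)/\pi_1(M)_q$. $\tilde\mu_q(M)\in(F/F_q)^{2g+n-1}$ is the tuple of preimages under $(i_+)_{*q}$ of the classes of the $\lambda_i,\lambda_j',\lambda_j''$. *)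

theory Defs
  imports "HOL-Analysis.Analysis" "HOL-Homology.Homology" "HOL-Algebra.Coset" "HOL-Algebra.Generated_Groups"
    "HOL-Library.FuncSet"
begin

section \<open>Compact oriented topological manifolds with boundary\<close>

definition half_space :: "nat \<Rightarrow> (nat \<Rightarrow> real) topology" where
  "half_space d = subtopology (Euclidean_space d) {x. x 0 \<ge> 0}"

definition locally_like :: "(nat \<Rightarrow> real) topology \<Rightarrow> 'a topology \<Rightarrow> 'a \<Rightarrow> bool" where
  "locally_like E X x \<longleftrightarrow>
     (\<exists>U V. openin X U \<and> x \<in> U \<and> openin E V \<and>
        subtopology X U homeomorphic_space subtopology E V)"

definition manifold_with_boundary :: "nat \<Rightarrow> 'a topology \<Rightarrow> bool" where
  "manifold_with_boundary d X \<longleftrightarrow>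
     Hausdorff_space X \<and> second_countable X \<and> (\<forall>x\<in>topspace X. locally_like (half_space d) X x)"

definition mfd_interior :: "nat \<Rightarrow> 'a topology \<Rightarrow> 'a set" where
  "mfd_interior d X = {x \<in> topspace X. locally_like (Euclidean_space d) X x}"

definition mfd_boundary :: "nat \<Rightarrow> 'a topology \<Rightarrow> 'a set" where
  "mfd_boundary d X = topspace X - mfd_interior d X"

abbreviation boundary_space :: "nat \<Rightarrow> 'a topology \<Rightarrow> 'a topology" where
  "boundary_space d X \<equiv> subtopology X (mfd_boundary d X)"

text \<open>An orientation of a compact manifold is given by its fundamental class in
  \<open>H\<^sub>d(X, \<partial>X; \<int>)\<close>, i.e. a class that restricts to a generator of the local
  homology group at every interior point.\<close>

record 'a oriented_space =
  space_of :: "'a topology"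
  orient :: "'a chain set"

definition fundamental_class :: "nat \<Rightarrow> 'a topology \<Rightarrow> 'a chain set \<Rightarrow> bool" where
  "fundamental_class d X c \<longleftrightarrow>
     c \<in> carrier (relative_homology_group (int d) X (mfd_boundary d X)) \<and>
     (\<forall>x\<in>mfd_interior d X.
        generate (relative_homology_group (int d) X (topspace X - {x}))
          {hom_induced (int d) X (mfd_boundary d X) X (topspace X - {x}) id c}
        = carrier (relative_homology_group (int d) X (topspace X - {x})))"

definition compact_oriented_manifold :: "nat \<Rightarrow> 'a oriented_space \<Rightarrow> bool" where
  "compact_oriented_manifold d A \<longleftrightarrow>
     compact_space (space_of A) \<and> manifold_with_boundary d (space_of A) \<and>
     fundamental_class d (space_of A) (orient A)"

definition homology_iso :: "'a topology \<Rightarrow> 'b topology \<Rightarrow> ('a \<Rightarrow> 'b) \<Rightarrow> bool" where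
  "homology_iso X Y f \<longleftrightarrow> continuous_map X Y f \<and>
     (\<forall>p. hom_induced p X {} Y {} f \<in> iso (homology_group p X) (homology_group p Y))"


section \<open>Gluing\<close>

text \<open>The space obtained from the disjoint union of \<open>X\<close> and \<open>Y\<close> by identifying
  \<open>x\<close> with \<open>y\<close> for all \<open>(x, y) \<in> E\<close>; its points are the classes of the equivalence
  relation generated by \<open>E\<close>, and it carries the quotient topology.\<close>

definition glue_point :: "('a \<times> 'b) set \<Rightarrow> 'a + 'b \<Rightarrow> ('a + 'b) set" where
  "glue_point E z = {w. equivclp (\<lambda>u v. \<exists>(x, y)\<in>E. u = Inl x \<and> v = Inr y) z w}"

definition glue_openin ::
  "'a topology \<Rightarrow> 'b topology \<Rightarrow> ('a \<times> 'b) set \<Rightarrow> ('a + 'b) set set \<Rightarrow> bool" where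
  "glue_openin X Y E U \<longleftrightarrow>
     U \<subseteq> glue_point E ` (topspace X <+> topspace Y) \<and>
     openin X {x \<in> topspace X. glue_point E (Inl x) \<in> U} \<and>
     openin Y {y \<in> topspace Y. glue_point E (Inr y) \<in> U}"

definition glue :: "'a topology \<Rightarrow> 'b topology \<Rightarrow> ('a \<times> 'b) set \<Rightarrow> ('a + 'b) set topology" where
  "glue X Y E = topology (glue_openin X Y E)"

lemma istopology_glue_openin: "istopology (glue_openin X Y E)"
  unfolding istopology_def
proof (intro conjI allI impI)
  fix U V assume U: "glue_openin X Y E U" and V: "glue_openin X Y E V"
  have "{x \<in> topspace X. glue_point E (Inl x) \<in> U \<inter> V} =
      {x \<in> topspace X. glue_point E (Inl x) \<in> U} \<inter> {x \<in> topspace X. glue_point E (Inl x) \<in> V}"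
    "{x \<in> topspace Y. glue_point E (Inr x) \<in> U \<inter> V} =
      {x \<in> topspace Y. glue_point E (Inr x) \<in> U} \<inter> {x \<in> topspace Y. glue_point E (Inr x) \<in> V}"
    by auto
  with U V show "glue_openin X Y E (U \<inter> V)"
    unfolding glue_openin_def by (metis (no_types, lifting) le_infI1 openin_Int)
next
  fix \<K> assume K: "\<forall>K\<in>\<K>. glue_openin X Y E K"
  have "{x \<in> topspace X. glue_point E (Inl x) \<in> \<Union>\<K>} =
      (\<Union>K\<in>\<K>. {x \<in> topspace X. glue_point E (Inl x) \<in> K})"
    "{x \<in> topspace Y. glue_point E (Inr x) \<in> \<Union>\<K>} =
      (\<Union>K\<in>\<K>. {x \<in> topspace Y. glue_point E (Inr x) \<in> K})"
    by auto
  moreover have "openin X (\<Union>K\<in>\<K>. {x \<in> topspace X. glue_point E (Inl x) \<in> K})"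
    "openin Y (\<Union>K\<in>\<K>. {x \<in> topspace Y. glue_point E (Inr x) \<in> K})"
    using K by (auto simp: glue_openin_def intro!: openin_Union)
  moreover have "\<Union>\<K> \<subseteq> glue_point E ` (topspace X <+> topspace Y)"
    using K unfolding glue_openin_def by blast
  ultimately show "glue_openin X Y E (\<Union>\<K>)"
    unfolding glue_openin_def by simp
qed

lemma openin_glue: "openin (glue X Y E) = glue_openin X Y E"
  by (simp add: glue_def istopology_glue_openin)

lemma topspace_glue: "topspace (glue X Y E) = glue_point E ` (topspace X <+> topspace Y)"
proof -
  have "{x \<in> topspace X. glue_point E (Inl x) \<in> glue_point E ` (topspace X <+> topspace Y)} = topspace X"
    "{x \<in> topspace Y. glue_point E (Inr x) \<in> glue_point E ` (topspace X <+> topspace Y)} = topspace Y"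
    by auto
  then have "openin (glue X Y E) (glue_point E ` (topspace X <+> topspace Y))"
    by (simp add: openin_glue glue_openin_def)
  moreover have "topspace (glue X Y E) \<subseteq> glue_point E ` (topspace X <+> topspace Y)"
    by (metis openin_glue glue_openin_def openin_topspace)
  ultimately show ?thesis
    by (simp add: openin_subset subset_antisym)
qed

abbreviation glue_left :: "('a \<times> 'b) set \<Rightarrow> 'a \<Rightarrow> ('a + 'b) set" where
  "glue_left E \<equiv> glue_point E \<circ> Inl"

abbreviation glue_right :: "('a \<times> 'b) set \<Rightarrow> 'b \<Rightarrow> ('a + 'b) set" where
  "glue_right E \<equiv> glue_point E \<circ> Inr"

text \<open>The map on the glued space induced by maps \<open>f\<close> and \<open>k\<close> that agree along \<open>E\<close>.\<close>

definition glue_map :: "('a \<Rightarrow> 'c) \<Rightarrow> ('b \<Rightarrow> 'c) \<Rightarrow> ('a + 'b) set \<Rightarrow> 'c" where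
  "glue_map f k C = the_elem (case_sum f k ` C)"

text \<open>Let \<open>E\<close> be the graph of a homeomorphism between the boundaries of the \<open>d\<close>-manifolds \<open>A\<close>
  and \<open>B\<close>. The orientation of the closed manifold \<open>A \<union> (-B)\<close> is the class in degree \<open>d\<close> whose
  restriction to \<open>A\<close> is the fundamental class of \<open>A\<close> and whose restriction to \<open>B\<close> is minus the
  fundamental class of \<open>B\<close>. Restriction to one piece means passing to the homology relative to the
  other piece; homology groups are written multiplicatively, so minus is the group inverse.\<close>

definition glued_class ::
  "nat \<Rightarrow> 'a oriented_space \<Rightarrow> 'b oriented_space \<Rightarrow> ('a \<times> 'b) set \<Rightarrow> ('a + 'b) set chain set \<Rightarrow> bool" where
  "glued_class d A B E c \<longleftrightarrow>
    (let X = space_of A; Y = space_of B; G = glue X Y E;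
         X' = glue_left E ` topspace X; Y' = glue_right E ` topspace Y
     in c \<in> carrier (homology_group (int d) G) \<and>
        hom_induced (int d) G {} G Y' id c =
          hom_induced (int d) X (mfd_boundary d X) G Y' (glue_left E) (orient A) \<and>
        hom_induced (int d) G {} G X' id c =
          inv\<^bsub>relative_homology_group (int d) G X'\<^esub>
            (hom_induced (int d) Y (mfd_boundary d Y) G X' (glue_right E) (orient B)))"

text \<open>\<open>h\<close> is an orientation-preserving homeomorphism from \<open>A \<union> (-B)\<close> onto \<open>\<partial>W\<close>, where
  \<open>\<partial>W\<close> carries the boundary orientation \<open>\<partial>[W]\<close>.\<close>

definition oriented_boundary_homeo ::
  "nat \<Rightarrow> 'a oriented_space \<Rightarrow> 'b oriented_space \<Rightarrow> ('a \<times> 'b) set \<Rightarrow> 'w oriented_space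
     \<Rightarrow> (('a + 'b) set \<Rightarrow> 'w) \<Rightarrow> bool" where
  "oriented_boundary_homeo d A B E W h \<longleftrightarrow>
    (let G = glue (space_of A) (space_of B) E;
         D = boundary_space (Suc d) (space_of W)
     in homeomorphic_map G D h \<and>
        (\<exists>c. glued_class d A B E c \<and>
             hom_induced (int d) G {} D {} h c =
             hom_boundary (int (Suc d)) (space_of W) (mfd_boundary (Suc d) (space_of W)) (orient W)))"


section \<open>Groups\<close>

definition commutator :: "('a, 'b) monoid_scheme \<Rightarrow> 'a \<Rightarrow> 'a \<Rightarrow> 'a" where
  "commutator G a b = a \<otimes>\<^bsub>G\<^esub> b \<otimes>\<^bsub>G\<^esub> inv\<^bsub>G\<^esub> a \<otimes>\<^bsub>G\<^esub> inv\<^bsub>G\<^esub> b"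

text \<open>Indexed so that the first term is the whole group; the value at \<open>0\<close> is a dummy.\<close>

fun lower_central :: "('a, 'b) monoid_scheme \<Rightarrow> nat \<Rightarrow> 'a set" where
  "lower_central G 0 = carrier G"
| "lower_central G (Suc 0) = carrier G"
| "lower_central G (Suc (Suc k)) =
     generate G {commutator G a b | a b. a \<in> carrier G \<and> b \<in> lower_central G (Suc k)}"

text \<open>The map \<open>G/G\<^sub>q \<rightarrow> H/H\<^sub>q\<close> induced by a homomorphism \<open>f\<close>: the set
  \<open>H\<^sub>q f(A)\<close> is the coset of \<open>f a\<close> for any \<open>a \<in> A\<close>.\<close>

definition nilquot_map ::
  "('b, 'c) monoid_scheme \<Rightarrow> nat \<Rightarrow> ('a \<Rightarrow> 'b) \<Rightarrow> 'a set \<Rightarrow> 'b set" where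
  "nilquot_map H q f A = lower_central H q <#>\<^bsub>H\<^esub> (f ` A)"

definition list_prod :: "('a, 'b) monoid_scheme \<Rightarrow> 'a list \<Rightarrow> 'a" where
  "list_prod G as = foldr (\<lambda>a b. a \<otimes>\<^bsub>G\<^esub> b) as \<one>\<^bsub>G\<^esub>"

text \<open>Words in letters \<open>b\<^sub>i\<close>, coded as \<open>(i, True)\<close>, and their inverses, coded as \<open>(i, False)\<close>.\<close>

definition reduced_word :: "(nat \<times> bool) list \<Rightarrow> bool" where
  "reduced_word w \<longleftrightarrow>
     (\<forall>k. Suc k < length w \<longrightarrow> \<not> (fst (w ! k) = fst (w ! Suc k) \<and> snd (w ! k) \<noteq> snd (w ! Suc k)))"

definition word_value :: "('a, 'b) monoid_scheme \<Rightarrow> 'a list \<Rightarrow> (nat \<times> bool) list \<Rightarrow> 'a" where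
  "word_value G bs w = list_prod G (map (\<lambda>(i, e). if e then bs ! i else inv\<^bsub>G\<^esub> (bs ! i)) w)"

definition free_generators :: "('a, 'b) monoid_scheme \<Rightarrow> 'a list \<Rightarrow> bool" where
  "free_generators G bs \<longleftrightarrow>
     set bs \<subseteq> carrier G \<and> generate G (set bs) = carrier G \<and>
     (\<forall>w. w \<noteq> [] \<and> reduced_word w \<and> (\<forall>(i, e)\<in>set w. i < length bs) \<longrightarrow>
          word_value G bs w \<noteq> \<one>\<^bsub>G\<^esub>)"


section \<open>The fundamental group\<close>

text \<open>The library operations on paths require a topological space type; these are their
  counterparts for abstract topologies.\<close>

definition join_path :: "(real \<Rightarrow> 'a) \<Rightarrow> (real \<Rightarrow> 'a) \<Rightarrow> real \<Rightarrow> 'a" (infixr \<open>\<cdot>\<cdot>\<close> 75) where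
  "p \<cdot>\<cdot> q = (\<lambda>t. if t \<le> 1/2 then p (2 * t) else q (2 * t - 1))"

definition rev_path :: "(real \<Rightarrow> 'a) \<Rightarrow> real \<Rightarrow> 'a" where
  "rev_path p = (\<lambda>t. p (1 - t))"

definition path_class :: "'a topology \<Rightarrow> (real \<Rightarrow> 'a) \<Rightarrow> (real \<Rightarrow> 'a) set" where
  "path_class X p =
     {r. homotopic_with (\<lambda>h. h 0 = p 0 \<and> h 1 = p 1) (top_of_set {0..1}) X p r}"

definition pi1 :: "'a topology \<Rightarrow> 'a \<Rightarrow> (real \<Rightarrow> 'a) set monoid" where
  "pi1 X a =
     \<lparr>carrier = {path_class X p | p. pathin X p \<and> p 0 = a \<and> p 1 = a},
      mult = (\<lambda>A B. \<Union>p\<in>A. \<Union>r\<in>B. path_class X (p \<cdot>\<cdot> r)),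
      one = path_class X (\<lambda>_. a)\<rparr>"

definition pi1_map :: "'b topology \<Rightarrow> ('a \<Rightarrow> 'b) \<Rightarrow> (real \<Rightarrow> 'a) set \<Rightarrow> (real \<Rightarrow> 'b) set" where
  "pi1_map Y f A = (\<Union>p\<in>A. path_class Y (f \<circ> p))"


section \<open>Surfaces and standard generators\<close>

definition simple_closed_path :: "'a topology \<Rightarrow> (real \<Rightarrow> 'a) \<Rightarrow> bool" where
  "simple_closed_path X p \<longleftrightarrow> pathin X p \<and> p 0 = p 1 \<and> inj_on p {0..<1}"

definition path_track :: "(real \<Rightarrow> 'a) \<Rightarrow> 'a set" where
  "path_track p = p ` {0..1}"

text \<open>The genus is the maximal number of disjoint simple closed curves in the interior that
  together do not separate the surface.\<close>

definition nonseparating_curves :: "'a topology \<Rightarrow> 'a set set \<Rightarrow> bool" where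
  "nonseparating_curves X \<C> \<longleftrightarrow>
     finite \<C> \<and> pairwise disjnt \<C> \<and>
     (\<forall>C\<in>\<C>. C \<subseteq> mfd_interior 2 X \<and> (\<exists>p. simple_closed_path X p \<and> C = path_track p)) \<and>
     connected_space (subtopology X (topspace X - \<Union>\<C>))"

definition has_genus :: "'a topology \<Rightarrow> nat \<Rightarrow> bool" where
  "has_genus X g \<longleftrightarrow>
     (\<exists>\<C>. nonseparating_curves X \<C> \<and> card \<C> = g) \<and>
     (\<forall>\<C>. nonseparating_curves X \<C> \<longrightarrow> card \<C> \<le> g)"

definition surface :: "nat \<Rightarrow> nat \<Rightarrow> 'a oriented_space \<Rightarrow> bool" where
  "surface g n S \<longleftrightarrow>
     compact_oriented_manifold 2 S \<and> topspace (space_of S) \<noteq> {} \<and>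
     connected_space (space_of S) \<and> has_genus (space_of S) g \<and>
     finite (connected_components_of (boundary_space 2 (space_of S))) \<and>
     card (connected_components_of (boundary_space 2 (space_of S))) = n"

text \<open>The base point, the labelled boundary components \<open>\<partial>\<^sub>i\<close>, the paths \<open>\<alpha>\<^sub>i\<close> and \<open>\<beta>\<^sub>i\<close>,
  and the homotopy classes \<open>m\<^sub>j\<close> and \<open>l\<^sub>j\<close>.\<close>

record 's surface_system =
  base :: 's
  bcomp :: "nat \<Rightarrow> 's set"
  tail :: "nat \<Rightarrow> real \<Rightarrow> 's"
  bpath :: "nat \<Rightarrow> real \<Rightarrow> 's"
  mer :: "nat \<Rightarrow> (real \<Rightarrow> 's) set"
  lon :: "nat \<Rightarrow> (real \<Rightarrow> 's) set"

abbreviation surface_group :: "'s oriented_space \<Rightarrow> 's surface_system \<Rightarrow> (real \<Rightarrow> 's) set monoid" where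
  "surface_group S P \<equiv> pi1 (space_of S) (base P)"

definition bgen :: "'s oriented_space \<Rightarrow> 's surface_system \<Rightarrow> nat \<Rightarrow> (real \<Rightarrow> 's) set" where
  "bgen S P i = path_class (space_of S) (tail P i \<cdot>\<cdot> bpath P i \<cdot>\<cdot> rev_path (tail P i))"

definition boundary_param :: "'a topology \<Rightarrow> 'a set \<Rightarrow> (real \<Rightarrow> 'a) \<Rightarrow> bool" where
  "boundary_param X B p \<longleftrightarrow> simple_closed_path X p \<and> path_track p = B"

text \<open>Meridian and longitude of a handle: two simple closed curves that meet in exactly one point,
  carried to the base point along a common path; curves of different handles are disjoint.
  That the two curves cross (rather than touch) need not be required separately: it follows from
  the remaining conditions on standard generators, as their boundary relation forces the
  intersection number of \<open>m\<^sub>j\<close> and \<open>l\<^sub>j\<close> to be \<open>\<plusminus>1\<close>.\<close>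

definition handle_curves :: "nat \<Rightarrow> 's oriented_space \<Rightarrow> 's surface_system \<Rightarrow> bool" where
  "handle_curves g S P \<longleftrightarrow>
    (\<exists>c a b. 
      (\<forall>j\<in>{1..g}. pathin (space_of S) (c j) \<and> c j 0 = base P \<and>
         simple_closed_path (space_of S) (a j) \<and> simple_closed_path (space_of S) (b j) \<and>
         c j 1 = a j 0 \<and> c j 1 = b j 0 \<and>
         path_track (a j) \<inter> path_track (b j) = {c j 1} \<and>
         mer P j = path_class (space_of S) (c j \<cdot>\<cdot> a j \<cdot>\<cdot> rev_path (c j)) \<and>
         lon P j = path_class (space_of S) (c j \<cdot>\<cdot> b j \<cdot>\<cdot> rev_path (c j))) \<and>
      (\<forall>j\<in>{1..g}. \<forall>k\<in>{1..g}. j \<noteq> k \<longrightarrow>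
         (path_track (a j) \<union> path_track (b j)) \<inter> (path_track (a k) \<union> path_track (b k)) = {}))"

definition standard_system :: "nat \<Rightarrow> nat \<Rightarrow> 's oriented_space \<Rightarrow> 's surface_system \<Rightarrow> bool" where
  "standard_system g n S P \<longleftrightarrow>
     bij_betw (bcomp P) {1..n} (connected_components_of (boundary_space 2 (space_of S))) \<and>
     base P \<in> bcomp P n \<and>
     (\<forall>i\<in>{1..<n}. boundary_param (space_of S) (bcomp P i) (bpath P i) \<and>
        pathin (space_of S) (tail P i) \<and> tail P i 0 = base P \<and> tail P i 1 = bpath P i 0) \<and>
     handle_curves g S P \<and>
     free_generators (surface_group S P)
       (map (bgen S P) [1..<n] @ map (mer P) [1..<Suc g] @ map (lon P) [1..<Suc g]) \<and>
     (\<exists>p. boundary_param (space_of S) (bcomp P n) p \<and> p 0 = base P \<and>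
        path_class (space_of S) p =
          list_prod (surface_group S P)
            (map (bgen S P) [1..<n] @
             map (\<lambda>j. commutator (surface_group S P) (mer P j) (lon P j)) [1..<Suc g]))"


section \<open>Homology cylinders and homology cobordism\<close>

record ('s, 'a) cylinder =
  body :: "'a oriented_space"
  mark_plus :: "'s \<Rightarrow> 'a"
  mark_minus :: "'s \<Rightarrow> 'a"

definition homology_cylinder :: "'s oriented_space \<Rightarrow> ('s, 'a) cylinder \<Rightarrow> bool" where
  "homology_cylinder S C \<longleftrightarrow>
     compact_oriented_manifold 3 (body C) \<and>
     embedding_map (space_of S) (boundary_space 3 (space_of (body C))) (mark_plus C) \<and>
     embedding_map (space_of S) (boundary_space 3 (space_of (body C))) (mark_minus C) \<and>
     (\<forall>x\<in>mfd_boundary 2 (space_of S). mark_plus C x = mark_minus C x) \<and>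
     oriented_boundary_homeo 2 S S {(x, x) | x. x \<in> mfd_boundary 2 (space_of S)} (body C)
       (glue_map (mark_plus C) (mark_minus C)) \<and>
     homology_iso (space_of S) (space_of (body C)) (mark_plus C) \<and>
     homology_iso (space_of S) (space_of (body C)) (mark_minus C)"

definition marking_identification ::
  "'s oriented_space \<Rightarrow> ('s, 'a) cylinder \<Rightarrow> ('s, 'b) cylinder \<Rightarrow> ('a \<times> 'b) set" where
  "marking_identification S C D =
     (\<lambda>x. (mark_plus C x, mark_plus D x)) ` topspace (space_of S) \<union>
     (\<lambda>x. (mark_minus C x, mark_minus D x)) ` topspace (space_of S)"

text \<open>The type argument is the type of the points of the 4-manifold. Every compact manifold embeds
  into a Euclidean space, so that for instance \<^typ>\<open>nat \<Rightarrow> real\<close> covers all of them up to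
  homeomorphism; the same applies to the types of the points of the cylinders.\<close>

definition homology_cobordant ::
  "'w itself \<Rightarrow> 's oriented_space \<Rightarrow> ('s, 'a) cylinder \<Rightarrow> ('s, 'b) cylinder \<Rightarrow> bool" where
  "homology_cobordant T S C D \<longleftrightarrow>
    (\<exists>(W :: 'w oriented_space) h.
       let E = marking_identification S C D in
       compact_oriented_manifold 4 W \<and>
       oriented_boundary_homeo 3 (body C) (body D) E W h \<and>
       homology_iso (space_of (body C)) (space_of W) (h \<circ> glue_left E) \<and>
       homology_iso (space_of (body D)) (space_of W) (h \<circ> glue_right E))"

definition cylinders :: "'s oriented_space \<Rightarrow> ('s, 'a) cylinder set" where
  "cylinders S = {C. homology_cylinder S C}"

text \<open>Homology cobordism is an equivalence relation, so it coincides with the equivalence relation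
  it generates. The latter is used to form the classes, so that they partition the cylinders
  by construction (and for every choice of the type \<open>'w\<close>).\<close>

definition cobordism_rel ::
  "'w itself \<Rightarrow> 's oriented_space \<Rightarrow> (('s, 'a) cylinder \<times> ('s, 'a) cylinder) set" where
  "cobordism_rel T S =
     {(C, D). C \<in> cylinders S \<and> D \<in> cylinders S \<and>
        equivclp (\<lambda>C D. C \<in> cylinders S \<and> D \<in> cylinders S \<and> homology_cobordant T S C D) C D}"

definition cobordism_classes ::
  "'w itself \<Rightarrow> 's oriented_space \<Rightarrow> ('s, 'a) cylinder set set" where
  "cobordism_classes T S = cylinders S // cobordism_rel T S"


section \<open>Extended Milnor invariants\<close>

abbreviation cylinder_group ::
  "'s surface_system \<Rightarrow> ('s, 'a) cylinder \<Rightarrow> (real \<Rightarrow> 'a) set monoid" where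
  "cylinder_group P C \<equiv> pi1 (space_of (body C)) (mark_plus C (base P))"

definition longitude :: "'s surface_system \<Rightarrow> ('s, 'a) cylinder \<Rightarrow> nat \<Rightarrow> (real \<Rightarrow> 'a) set" where
  "longitude P C i =
     path_class (space_of (body C))
       ((mark_plus C \<circ> tail P i) \<cdot>\<cdot> (mark_minus C \<circ> rev_path (tail P i)))"

definition difference_loop ::
  "'s oriented_space \<Rightarrow> 's surface_system \<Rightarrow> ('s, 'a) cylinder \<Rightarrow> (real \<Rightarrow> 's) set \<Rightarrow> (real \<Rightarrow> 'a) set" where
  "difference_loop S P C u =
     pi1_map (space_of (body C)) (mark_plus C) u \<otimes>\<^bsub>cylinder_group P C\<^esub>
     pi1_map (space_of (body C)) (mark_minus C) (inv\<^bsub>surface_group S P\<^esub> u)"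

definition milnor_mu ::
  "nat \<Rightarrow> nat \<Rightarrow> 's oriented_space \<Rightarrow> 's surface_system \<Rightarrow> nat \<Rightarrow> ('s, 'a) cylinder
     \<Rightarrow> (real \<Rightarrow> 's) set set list" where
  "milnor_mu g n S P q C =
     map (\<lambda>u. inv_into (carrier (surface_group S P Mod lower_central (surface_group S P) q))
            (nilquot_map (cylinder_group P C) q (pi1_map (space_of (body C)) (mark_plus C)))
            (lower_central (cylinder_group P C) q #>\<^bsub>cylinder_group P C\<^esub> u))
       (map (longitude P C) [1..<n] @
        map (\<lambda>j. difference_loop S P C (mer P j)) [1..<Suc g] @
        map (\<lambda>j. difference_loop S P C (lon P j)) [1..<Suc g])"

definition milnor_target ::
  "nat \<Rightarrow> nat \<Rightarrow> 's oriented_space \<Rightarrow> 's surface_system \<Rightarrow> nat \<Rightarrow> (real \<Rightarrow> 's) set set list set" where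
  "milnor_target g n S P q =
     {v. length v = 2 * g + n - 1 \<and>
         set v \<subseteq> carrier (surface_group S P Mod lower_central (surface_group S P) q)}"

end

(* Stallings' theorem by obstruction theory on singular chains. If the canonical map F -> F/F_q has been
   extended over pi_1(W), lifting the extension to F/F_(q+1) is obstructed by a singular 2-cocycle of W
   with values in the central subgroup F_q/F_(q+1). Because H_1(Sigma) -> H_1(W) is bijective and
   H_2(Sigma) -> H_2(W) is onto, this cocycle is the coboundary of a cochain with prescribed pull-back to
   Sigma, so the extension lifts; hence F/F_q -> pi_1(W)/pi_1(W)_q is injective. A similar cochain
   argument shows that H_1(Sigma) -> H_1(M) being onto makes F/F_q -> pi_1(M)/pi_1(M)_q onto. For a
   cobordism W between M and M', the longitudes of M and M' have the same images in pi_1(W), and so the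
   same preimages in F/F_q. *)

theory Submission
  imports Defs
begin

section \<open>Homotopies of paths\<close>

text \<open>Maps on singular 1-simplices, instead of homomorphisms on fundamental groups, let the
  homology of the spaces enter directly. Such a map may violate the relations coming from the
  2-simplices by elements of a normal subgroup; so a lift chosen simplex by simplex, without any
  coherence, is still an admissible object, and its defect is an honest singular 2-cochain. Two
  obstacles shape the construction. The homological data determine the correcting cochain on
  1-cycles only; to obtain values on simplices, each simplex is closed up to a cycle along chosen
  paths. These paths are not compatible with maps of spaces, so the corrected lift is controlled on
  loops only, whereas the next lifting step has to compare values on all simplices. Multiplying by
  the values on paths from the base point, a change of gauge, bridges this gap.\<close>

definition path_homotopic :: "'a topology \<Rightarrow> (real \<Rightarrow> 'a) \<Rightarrow> (real \<Rightarrow> 'a) \<Rightarrow> bool" where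
  "path_homotopic X p r \<longleftrightarrow>
     homotopic_with (\<lambda>h. h 0 = p 0 \<and> h 1 = p 1) (top_of_set {0..1}) X p r"

lemma path_class_eq_Collect: "path_class X p = Collect (path_homotopic X p)"
  by (auto simp: path_class_def path_homotopic_def)

text \<open>\<open>homotopic_with\<close> matches the two ends on the whole real line; since the
  condition on the intermediate maps reads them at 0 and 1 only, agreement on the unit interval is
  enough. The variable \<open>x\<close> is the path parameter in the first two equations and the
  time of the homotopy in the last two.\<close>

lemma path_homotopic_iff:
  "path_homotopic X p r \<longleftrightarrow>
     (\<exists>h. continuous_map (top_of_set ({0..1} \<times> {0..1})) X h \<and>
          (\<forall>x\<in>{0..1}. h (0, x) = p x \<and> h (1, x) = r x \<and> h (x, 0) = p 0 \<and> h (x, 1) = p 1))"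
proof -
  have "prod_topology (top_of_set {0..1::real}) (top_of_set {0..1::real}) = top_of_set ({0..1} \<times> {0..1})"
    by (simp add: subtopology_Times)
  then show ?thesis
    unfolding path_homotopic_def by (subst homotopic_with) auto
qed

lemma path_homotopic_imp:
  assumes "path_homotopic X p r"
  shows "pathin X p" "pathin X r" "p 0 = r 0" "p 1 = r 1"
  using homotopic_with_imp_continuous_maps[OF assms[unfolded path_homotopic_def]]
    homotopic_with_imp_property[OF assms[unfolded path_homotopic_def]]
  by (auto simp: pathin_def)

lemma path_homotopic_refl: "pathin X p \<Longrightarrow> path_homotopic X p p"
  by (simp add: path_homotopic_def pathin_def)

lemma path_homotopic_sym: "path_homotopic X p r \<Longrightarrow> path_homotopic X r p"
  using path_homotopic_imp[of X p r] unfolding path_homotopic_def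
  by (simp add: homotopic_with_sym)

lemma path_homotopic_trans [trans]:
  assumes "path_homotopic X p r" "path_homotopic X r s"
  shows "path_homotopic X p s"
proof -
  have "p 0 = r 0" "p 1 = r 1"
    using path_homotopic_imp[OF assms(1)] by auto
  then show ?thesis
    using assms unfolding path_homotopic_def by (auto intro: homotopic_with_trans)
qed

lemma path_homotopic_eq:
  assumes "pathin X p" "\<And>t. t \<in> {0..1} \<Longrightarrow> p t = r t"
  shows "path_homotopic X p r"
  unfolding path_homotopic_def using assms
  by (intro homotopic_with_equal) (auto simp: pathin_def)

lemma path_homotopic_compose:
  "path_homotopic X p r \<Longrightarrow> continuous_map X Y f \<Longrightarrow> path_homotopic Y (f \<circ> p) (f \<circ> r)"
  unfolding path_homotopic_def
  by (erule homotopic_with_compose_continuous_map_left) auto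

lemma pathin_rev_path: "pathin X p \<Longrightarrow> pathin X (rev_path p)"
  unfolding pathin_def rev_path_def
  by (rule continuous_map_compose[of _ "top_of_set {0..1}" "\<lambda>t. 1 - t", unfolded o_def])
     (auto simp: continuous_map_in_subtopology intro!: continuous_intros)

lemma rev_path_ends [simp]: "rev_path p 0 = p 1" "rev_path p 1 = p 0"
  by (simp_all add: rev_path_def)

lemma join_path_ends [simp]: "(p \<cdot>\<cdot> q) 0 = p 0" "(p \<cdot>\<cdot> q) 1 = q 1"
  by (simp_all add: join_path_def)

lemma compose_join_path: "f \<circ> (p \<cdot>\<cdot> q) = (f \<circ> p) \<cdot>\<cdot> (f \<circ> q)"
  by (auto simp: join_path_def)

lemma path_homotopic_join:
  assumes "path_homotopic X p p'" "path_homotopic X q q'" "p 1 = q 0"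
  shows "path_homotopic X (p \<cdot>\<cdot> q) (p' \<cdot>\<cdot> q')"
proof -
  let ?S = "{0..1} \<times> {0..1} :: (real \<times> real) set"
  obtain h where h: "continuous_map (top_of_set ?S) X h"
     "\<And>x. x\<in>{0..1} \<Longrightarrow> h (0, x) = p x \<and> h (1, x) = p' x \<and> h (x, 0) = p 0 \<and> h (x, 1) = p 1"
    using assms(1) by (auto simp: path_homotopic_iff)
  obtain k where k: "continuous_map (top_of_set ?S) X k"
     "\<And>x. x\<in>{0..1} \<Longrightarrow> k (0, x) = q x \<and> k (1, x) = q' x \<and> k (x, 0) = q 0 \<and> k (x, 1) = q 1"
    using assms(2) by (auto simp: path_homotopic_iff)
  let ?a = "\<lambda>z::real\<times>real. (fst z, 2 * snd z)" and ?b = "\<lambda>z::real\<times>real. (fst z, 2 * snd z - 1)"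
  let ?H = "\<lambda>z. if snd z \<le> 1/2 then (h \<circ> ?a) z else (k \<circ> ?b) z"
  have "continuous_map (top_of_set ?S) X ?H"
  proof (intro continuous_map_cases_le)
    show "continuous_map (top_of_set ?S) euclideanreal snd" "continuous_map (top_of_set ?S) euclideanreal (\<lambda>x. 1/2)"
      by (auto intro: continuous_intros)
    have "continuous_map (subtopology (top_of_set ?S) {x \<in> topspace (top_of_set ?S). snd x \<le> 1/2}) (top_of_set ?S) ?a"
      by (auto simp: subtopology_subtopology continuous_map_in_subtopology intro!: continuous_intros)
    then show "continuous_map (subtopology (top_of_set ?S) {x \<in> topspace (top_of_set ?S). snd x \<le> 1/2}) X (h \<circ> ?a)"
      using h(1) continuous_map_compose by blast
    have "continuous_map (subtopology (top_of_set ?S) {x \<in> topspace (top_of_set ?S). 1/2 \<le> snd x}) (top_of_set ?S) ?b"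
      by (auto simp: subtopology_subtopology continuous_map_in_subtopology intro!: continuous_intros)
    then show "continuous_map (subtopology (top_of_set ?S) {x \<in> topspace (top_of_set ?S). 1/2 \<le> snd x}) X (k \<circ> ?b)"
      using k(1) continuous_map_compose by blast
    show "(h \<circ> ?a) z = (k \<circ> ?b) z" if "z \<in> topspace (top_of_set ?S)" "snd z = 1/2" for z
    proof -
      have "z = (fst z, 1/2)"
        using that(2) by (metis prod.collapse)
      then obtain x where "z = (x, 1/2)" ..
      then show ?thesis
        using that(1) h(2)[of x] k(2)[of x] assms(3) by simp
    qed
  qed
  moreover have "?H (0, x) = (p \<cdot>\<cdot> q) x \<and> ?H (1, x) = (p' \<cdot>\<cdot> q') x \<and> ?H (x, 0) = (p \<cdot>\<cdot> q) 0 \<and> ?H (x, 1) = (p \<cdot>\<cdot> q) 1"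
    if "x \<in> {0..1}" for x
    using that h(2)[of x] h(2)[of "2*x"] k(2)[of x] k(2)[of "2*x-1"] by (auto simp: join_path_def)
  ultimately show ?thesis
    unfolding path_homotopic_iff by blast
qed

lemma pathin_join_path:
  assumes "pathin X p" "pathin X q" "p 1 = q 0"
  shows "pathin X (p \<cdot>\<cdot> q)"
  using path_homotopic_imp(1)[OF path_homotopic_join] path_homotopic_refl assms by metis

text \<open>The standard simplex is convex, so \<open>u\<close> and \<open>v\<close> are joined by
  the straight-line homotopy, which stays fixed wherever they agree; \<open>w\<close> carries it to
  \<open>X\<close>. Reparametrizations and triangles are both reduced to this.\<close>

lemma path_homotopic_in_simplex:
  assumes w: "continuous_map (subtopology (powertop_real UNIV) (standard_simplex n)) X w"
    and u: "continuous_map (top_of_set {0..1}) (subtopology (powertop_real UNIV) (standard_simplex n)) u"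
    and v: "continuous_map (top_of_set {0..1}) (subtopology (powertop_real UNIV) (standard_simplex n)) v"
    and ends: "u 0 = v 0" "u 1 = v 1"
  shows "path_homotopic X (w \<circ> u) (w \<circ> v)"
proof -
  let ?S = "{0..1} \<times> {0..1} :: (real \<times> real) set"
  let ?D = "subtopology (powertop_real UNIV) (standard_simplex n)"
  let ?h = "\<lambda>z::real\<times>real. \<lambda>i. (1 - fst z) * u (snd z) i + fst z * v (snd z) i"
  have su: "u t \<in> standard_simplex n" "v t \<in> standard_simplex n" if "t \<in> {0..1}" for t
    using u v that by (auto simp: continuous_map_in_subtopology)
  have co: "continuous_on {0..1} (\<lambda>t. u t i)" "continuous_on {0..1} (\<lambda>t. v t i)" for i
    using u v by (auto simp: continuous_map_in_subtopology continuous_map_componentwise_UNIV)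
  have "continuous_on ?S (\<lambda>z. u (snd z) i)" "continuous_on ?S (\<lambda>z. v (snd z) i)" for i
    by (rule continuous_on_compose2[OF co(1)] continuous_on_compose2[OF co(2)]; auto intro: continuous_intros)+
  then have "continuous_map (top_of_set ?S) (powertop_real UNIV) ?h"
    by (auto simp: continuous_map_componentwise_UNIV intro!: continuous_intros)
  moreover have "?h z \<in> standard_simplex n" if "z \<in> ?S" for z
    using that su convex_standard_simplex[of "u (snd z)" n "v (snd z)" "fst z"] by auto
  ultimately have "continuous_map (top_of_set ?S) ?D ?h"
    by (auto simp: continuous_map_in_subtopology)
  then have "continuous_map (top_of_set ?S) X (w \<circ> ?h)"
    using w continuous_map_compose by blast
  then show ?thesis
    unfolding path_homotopic_iff using ends
    by (intro exI[of _ "w \<circ> ?h"]) (auto simp: algebra_simps)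
qed

definition segment_simplex :: "real \<Rightarrow> nat \<Rightarrow> real" where
  "segment_simplex t = (\<lambda>i. if i = 0 then 1 - t else if i = 1 then t else 0)"

lemma segment_simplex_in: "t \<in> {0..1} \<Longrightarrow> segment_simplex t \<in> standard_simplex 1"
  by (auto simp: segment_simplex_def standard_simplex_def)

lemma continuous_segment_simplex:
  assumes "continuous_on {0..1} u" "u \<in> {0..1} \<rightarrow> {0..1}"
  shows "continuous_map (top_of_set {0..1}) (subtopology (powertop_real UNIV) (standard_simplex 1)) (\<lambda>t. segment_simplex (u t))"
proof -
  have "continuous_on {0..1} (\<lambda>t. segment_simplex (u t) i)" for i
    using assms by (cases "i = 0"; cases "i = 1") (auto simp: segment_simplex_def intro!: continuous_intros)
  moreover have "segment_simplex (u t) \<in> standard_simplex 1" if "t \<in> {0..1}" for t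
    using that assms(2) by (intro segment_simplex_in) auto
  ultimately show ?thesis
    by (auto simp: continuous_map_in_subtopology continuous_map_componentwise_UNIV)
qed

lemma continuous_simplex_coord:
  "continuous_map (subtopology (powertop_real UNIV) (standard_simplex n)) euclideanreal (\<lambda>x. x i)"
  by (rule continuous_map_from_subtopology[OF continuous_map_product_projection]) simp

text \<open>The coordinate \<open>x 1\<close> identifies the standard 1-simplex with the unit
  interval, so two reparametrizations with common ends are two paths in a convex set.\<close>

lemma path_homotopic_reparam:
  assumes p: "pathin X p"
    and u: "continuous_on {0..1} u" "u \<in> {0..1} \<rightarrow> {0..1}"
    and v: "continuous_on {0..1} v" "v \<in> {0..1} \<rightarrow> {0..1}"
    and ends: "u 0 = v 0" "u 1 = v 1"
  shows "path_homotopic X (p \<circ> u) (p \<circ> v)"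
proof -
  let ?w = "p \<circ> (\<lambda>x. x (1::nat))"
  have "continuous_map (subtopology (powertop_real UNIV) (standard_simplex 1)) (top_of_set {0..1}) (\<lambda>x. x 1)"
    unfolding continuous_map_in_subtopology
    by (intro conjI continuous_simplex_coord) (auto simp: standard_simplex_def)
  then have w: "continuous_map (subtopology (powertop_real UNIV) (standard_simplex 1)) X ?w"
    using p continuous_map_compose unfolding pathin_def by blast
  have "path_homotopic X (?w \<circ> (\<lambda>t. segment_simplex (u t))) (?w \<circ> (\<lambda>t. segment_simplex (v t)))"
    by (rule path_homotopic_in_simplex[OF w]) (use continuous_segment_simplex u v ends in auto)
  then show ?thesis by (simp add: o_def segment_simplex_def)
qed

lemma path_homotopic_reparam_id:
  assumes "pathin X p" "continuous_on {0..1} u" "u \<in> {0..1} \<rightarrow> {0..1}" "u 0 = 0" "u 1 = 1"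
  shows "path_homotopic X (p \<circ> u) p"
  using path_homotopic_reparam[of X p u "\<lambda>t. t"] assms by (auto simp: o_def)

section \<open>Group laws for the composition of paths, up to homotopy\<close>

lemma path_homotopic_assoc:
  assumes "pathin X p" "pathin X q" "pathin X r" "p 1 = q 0" "q 1 = r 0"
  shows "path_homotopic X ((p \<cdot>\<cdot> q) \<cdot>\<cdot> r) (p \<cdot>\<cdot> q \<cdot>\<cdot> r)"
proof -
  \<comment> \<open>This change of parameter has slopes 2, 1 and 1/2 on the intervals cut at 1/4 and
    1/2. It is concave, hence the minimum of its three linear pieces, which makes its continuity
    immediate.\<close>
  let ?u = "\<lambda>t::real. min (2 * t) (min (t + 1/4) ((t + 1) / 2))"
  have "(p \<cdot>\<cdot> q) \<cdot>\<cdot> r = (p \<cdot>\<cdot> q \<cdot>\<cdot> r) \<circ> ?u"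
  proof
    fix t :: real
    consider "t \<le> 1/4" | "1/4 < t" "t \<le> 1/2" | "t > 1/2" by linarith
    then show "((p \<cdot>\<cdot> q) \<cdot>\<cdot> r) t = ((p \<cdot>\<cdot> q \<cdot>\<cdot> r) \<circ> ?u) t"
    proof cases
      case 1 then have "?u t = 2 * t" by auto
      with 1 show ?thesis by (simp add: join_path_def)
    next
      case 2 then have "?u t = t + 1/4" by auto
      with 2 show ?thesis by (simp add: join_path_def algebra_simps)
    next
      case 3 then have "?u t = (t + 1) / 2" by auto
      with 3 show ?thesis by (simp add: join_path_def add_divide_distrib)
    qed
  qed
  then show ?thesis
    by (simp only:, intro path_homotopic_reparam_id pathin_join_path)
       (use assms in \<open>auto intro!: continuous_intros simp: min_le_iff_disj\<close>)
qed

lemma path_homotopic_const_left: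
  assumes "pathin X p" "p 0 = a"
  shows "path_homotopic X ((\<lambda>_. a) \<cdot>\<cdot> p) p"
proof -
  have "((\<lambda>_. a) \<cdot>\<cdot> p) t = (p \<circ> (\<lambda>t. max 0 (2 * t - 1))) t" for t
    using assms by (cases "2 * t" "1::real" rule: linorder_cases) (auto simp: join_path_def max_def)
  then have "(\<lambda>_. a) \<cdot>\<cdot> p = p \<circ> (\<lambda>t. max 0 (2 * t - 1))"
    by blast
  then show ?thesis
    by (simp only:, intro path_homotopic_reparam_id) (use assms in \<open>auto intro!: continuous_intros\<close>)
qed

lemma path_homotopic_const_right:
  assumes "pathin X p" "p 1 = a"
  shows "path_homotopic X (p \<cdot>\<cdot> (\<lambda>_. a)) p"
proof -
  have "(p \<cdot>\<cdot> (\<lambda>_. a)) t = (p \<circ> (\<lambda>t. min 1 (2 * t))) t" for t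
    using assms by (cases "2 * t" "1::real" rule: linorder_cases) (auto simp: join_path_def min_def)
  then have "p \<cdot>\<cdot> (\<lambda>_. a) = p \<circ> (\<lambda>t. min 1 (2 * t))"
    by blast
  then show ?thesis
    by (simp only:, intro path_homotopic_reparam_id) (use assms in \<open>auto intro!: continuous_intros\<close>)
qed

text \<open>The composite runs along \<open>p\<close> with a tent function as parameter; the tent
  starts and ends at 0 and so contracts to the constant 0.\<close>

lemma path_homotopic_rev_right:
  assumes "pathin X p"
  shows "path_homotopic X (p \<cdot>\<cdot> rev_path p) (\<lambda>_. p 0)"
proof -
  have "p \<cdot>\<cdot> rev_path p = p \<circ> (\<lambda>t. min (2 * t) (2 - 2 * t))"
    by (auto simp: join_path_def rev_path_def min_def)
  then show ?thesis
    using path_homotopic_reparam[of X p "\<lambda>t. min (2 * t) (2 - 2 * t)" "\<lambda>_. 0"] assms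
    by (force intro!: continuous_intros simp: o_def min_le_iff_disj)
qed

lemma rev_path_rev_path [simp]: "rev_path (rev_path p) = p"
  by (simp add: rev_path_def)

lemma path_homotopic_rev_left:
  "pathin X p \<Longrightarrow> path_homotopic X (rev_path p \<cdot>\<cdot> p) (\<lambda>_. p 1)"
  using path_homotopic_rev_right[of X "rev_path p"] pathin_rev_path by auto

lemma path_class_eq_iff:
  "pathin X p \<Longrightarrow> path_class X p = path_class X r \<longleftrightarrow> path_homotopic X p r"
  unfolding path_class_eq_Collect
  using path_homotopic_refl[of X p] path_homotopic_sym path_homotopic_trans by blast

lemma path_in_path_class: "pathin X p \<Longrightarrow> p \<in> path_class X p"
  by (simp add: path_class_eq_Collect path_homotopic_refl)

section \<open>The fundamental group is a group\<close>

lemma pi1_carrierI: "pathin X p \<Longrightarrow> p 0 = a \<Longrightarrow> p 1 = a \<Longrightarrow> path_class X p \<in> carrier (pi1 X a)"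
  by (auto simp: pi1_def)

lemma pi1_carrierE:
  assumes "u \<in> carrier (pi1 X a)"
  obtains p where "pathin X p" "p 0 = a" "p 1 = a" "u = path_class X p"
  using assms by (auto simp: pi1_def)

text \<open>The product in \<open>pi1\<close> is a union over all representatives. Composition
  respects homotopy, so every member of the union is the same class, and the index sets are nonempty
  because \<open>p\<close> and \<open>q\<close> are paths.\<close>

lemma pi1_mult:
  assumes "pathin X p" "pathin X q" "p 1 = q 0"
  shows "path_class X p \<otimes>\<^bsub>pi1 X a\<^esub> path_class X q = path_class X (p \<cdot>\<cdot> q)"
proof -
  have "path_class X (p' \<cdot>\<cdot> q') = path_class X (p \<cdot>\<cdot> q)"
    if "p' \<in> path_class X p" "q' \<in> path_class X q" for p' q'
  proof -
    have "path_homotopic X (p \<cdot>\<cdot> q) (p' \<cdot>\<cdot> q')"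
      using that assms by (intro path_homotopic_join) (auto simp: path_class_eq_Collect)
    then show ?thesis
      using path_class_eq_iff[OF pathin_join_path[OF assms]] by metis
  qed
  then have "(\<Union>p'\<in>path_class X p. \<Union>q'\<in>path_class X q. path_class X (p' \<cdot>\<cdot> q'))
      = (\<Union>p'\<in>path_class X p. \<Union>q'\<in>path_class X q. path_class X (p \<cdot>\<cdot> q))"
    by (intro SUP_cong refl)
  also have "\<dots> = path_class X (p \<cdot>\<cdot> q)"
    using path_in_path_class[OF assms(1)] path_in_path_class[OF assms(2)]
    by (metis (no_types) UN_constant empty_iff)
  finally show ?thesis
    by (simp add: pi1_def)
qed

lemma pi1_one: "\<one>\<^bsub>pi1 X a\<^esub> = path_class X (\<lambda>_. a)"
  by (simp add: pi1_def)

lemma group_pi1: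
  assumes "a \<in> topspace X"
  shows "group (pi1 X a)"
proof (rule groupI)
  fix x y z assume "x \<in> carrier (pi1 X a)" "y \<in> carrier (pi1 X a)" "z \<in> carrier (pi1 X a)"
  then obtain p q r where p: "pathin X p" "p 0 = a" "p 1 = a" "x = path_class X p"
    and q: "pathin X q" "q 0 = a" "q 1 = a" "y = path_class X q"
    and r: "pathin X r" "r 0 = a" "r 1 = a" "z = path_class X r"
    by (auto elim!: pi1_carrierE)
  then show "x \<otimes>\<^bsub>pi1 X a\<^esub> y \<otimes>\<^bsub>pi1 X a\<^esub> z = x \<otimes>\<^bsub>pi1 X a\<^esub> (y \<otimes>\<^bsub>pi1 X a\<^esub> z)"
    by (simp add: pi1_mult pathin_join_path path_class_eq_iff path_homotopic_assoc)
next
  fix x y assume "x \<in> carrier (pi1 X a)" "y \<in> carrier (pi1 X a)"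
  then show "x \<otimes>\<^bsub>pi1 X a\<^esub> y \<in> carrier (pi1 X a)"
    by (auto elim!: pi1_carrierE simp: pi1_mult intro!: pi1_carrierI pathin_join_path)
next
  fix x assume "x \<in> carrier (pi1 X a)"
  then obtain p where p: "pathin X p" "p 0 = a" "p 1 = a" "x = path_class X p"
    by (auto elim!: pi1_carrierE)
  then show "\<one>\<^bsub>pi1 X a\<^esub> \<otimes>\<^bsub>pi1 X a\<^esub> x = x"
    using assms by (simp add: pi1_one pi1_mult path_class_eq_iff pathin_join_path path_homotopic_const_left)
  have "path_class X (rev_path p) \<otimes>\<^bsub>pi1 X a\<^esub> x = \<one>\<^bsub>pi1 X a\<^esub>"
    using p path_homotopic_rev_left[of X p]
    by (simp add: pi1_one pi1_mult path_class_eq_iff pathin_join_path pathin_rev_path)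
  then show "\<exists>y\<in>carrier (pi1 X a). y \<otimes>\<^bsub>pi1 X a\<^esub> x = \<one>\<^bsub>pi1 X a\<^esub>"
    using p by (intro bexI[of _ "path_class X (rev_path p)"] pi1_carrierI pathin_rev_path) auto
qed (use assms in \<open>auto simp: pi1_one intro: pi1_carrierI\<close>)

lemma pi1_inv:
  assumes "pathin X p" "p 0 = a" "p 1 = a"
  shows "inv\<^bsub>pi1 X a\<^esub> (path_class X p) = path_class X (rev_path p)"
proof -
  have "a \<in> topspace X" using assms path_start_in_topspace by fastforce
  then interpret group "pi1 X a" by (rule group_pi1)
  show ?thesis
  proof (rule inv_equality)
    show "path_class X (rev_path p) \<otimes>\<^bsub>pi1 X a\<^esub> path_class X p = \<one>\<^bsub>pi1 X a\<^esub>"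
      using assms path_homotopic_rev_left[of X p]
      by (simp add: pi1_one pi1_mult path_class_eq_iff pathin_join_path pathin_rev_path)
  qed (use assms in \<open>auto intro!: pi1_carrierI pathin_rev_path\<close>)
qed

lemma pi1_map_class:
  assumes "pathin X p" "continuous_map X Y f"
  shows "pi1_map Y f (path_class X p) = path_class Y (f \<circ> p)"
proof -
  have "path_class Y (f \<circ> p') = path_class Y (f \<circ> p)" if "p' \<in> path_class X p" for p'
  proof -
    have "path_homotopic Y (f \<circ> p) (f \<circ> p')"
      using that assms by (intro path_homotopic_compose) (auto simp: path_class_eq_Collect)
    then show ?thesis
      using path_class_eq_iff[OF pathin_compose[OF assms]] by metis
  qed
  then have "pi1_map Y f (path_class X p) = (\<Union>p'\<in>path_class X p. path_class Y (f \<circ> p))"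
    unfolding pi1_map_def by (intro SUP_cong refl)
  then show ?thesis
    using path_in_path_class[OF assms(1)] by (metis (no_types) UN_constant empty_iff)
qed

lemma pi1_map_hom:
  assumes f: "continuous_map X Y f"
  shows "pi1_map Y f \<in> hom (pi1 X a) (pi1 Y (f a))"
proof (rule homI)
  fix x assume "x \<in> carrier (pi1 X a)"
  then show "pi1_map Y f x \<in> carrier (pi1 Y (f a))"
    using f by (auto elim!: pi1_carrierE simp: pi1_map_class intro!: pi1_carrierI pathin_compose)
next
  fix x y assume "x \<in> carrier (pi1 X a)" "y \<in> carrier (pi1 X a)"
  then show "pi1_map Y f (x \<otimes>\<^bsub>pi1 X a\<^esub> y) = pi1_map Y f x \<otimes>\<^bsub>pi1 Y (f a)\<^esub> pi1_map Y f y"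
    using f by (auto elim!: pi1_carrierE simp: pi1_map_class pi1_mult pathin_join_path pathin_compose compose_join_path)
qed

lemma pi1_map_compose:
  assumes f: "continuous_map X Y f" and k: "continuous_map Y Z k" and u: "u \<in> carrier (pi1 X a)"
  shows "pi1_map Z k (pi1_map Y f u) = pi1_map Z (k \<circ> f) u"
  using u f k continuous_map_compose[OF f k]
  by (auto elim!: pi1_carrierE simp: pi1_map_class pathin_compose comp_assoc)

section \<open>Paths and singular simplices\<close>

text \<open>A singular simplex is required to be extensional, hence \<open>restrict\<close>. On the
  standard 1-simplex the coordinate \<open>x 1\<close> is the path parameter.\<close>

definition simplex_of_path :: "(real \<Rightarrow> 'a) \<Rightarrow> (nat \<Rightarrow> real) \<Rightarrow> 'a" where
  "simplex_of_path p = restrict (\<lambda>x. p (x 1)) (standard_simplex 1)"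

definition path_of_simplex :: "((nat \<Rightarrow> real) \<Rightarrow> 'a) \<Rightarrow> real \<Rightarrow> 'a" where
  "path_of_simplex s = (\<lambda>t. s (segment_simplex t))"

lemma standard_simplex_1_eq: "x \<in> standard_simplex 1 \<Longrightarrow> segment_simplex (x 1) = x"
  by (auto simp: standard_simplex_def segment_simplex_def fun_eq_iff)

lemma continuous_map_to_simplex:
  assumes "\<And>i. continuous_on S (\<lambda>t. u t i)" "\<And>t. t \<in> S \<Longrightarrow> u t \<in> standard_simplex n"
  shows "continuous_map (top_of_set S) (subtopology (powertop_real UNIV) (standard_simplex n)) u"
  using assms by (auto simp: continuous_map_in_subtopology continuous_map_componentwise_UNIV)

lemma singular_simplex_of_path:
  assumes "pathin X p"
  shows "singular_simplex 1 X (simplex_of_path p)"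
proof -
  let ?D = "subtopology (powertop_real UNIV) (standard_simplex 1)"
  have "continuous_map ?D (top_of_set {0..1}) (\<lambda>x. x 1)"
    unfolding continuous_map_in_subtopology
    by (intro conjI continuous_simplex_coord) (auto simp: standard_simplex_def)
  then have "continuous_map ?D X (p \<circ> (\<lambda>x. x 1))"
    using assms continuous_map_compose unfolding pathin_def by blast
  then have "continuous_map ?D X (restrict (\<lambda>x. p (x 1)) (standard_simplex 1))"
    by (rule continuous_map_eq) auto
  then show ?thesis
    by (simp add: singular_simplex_def simplex_of_path_def)
qed

lemma pathin_path_of_simplex:
  assumes "singular_simplex 1 X s"
  shows "pathin X (path_of_simplex s)"
  using continuous_map_compose[OF continuous_segment_simplex[of "\<lambda>t. t"]] assms
  by (auto simp: pathin_def path_of_simplex_def singular_simplex_def o_def)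

lemma simplex_of_path_of_simplex:
  assumes "singular_simplex 1 X s"
  shows "simplex_of_path (path_of_simplex s) = s"
proof
  show "simplex_of_path (path_of_simplex s) x = s x" for x
    using assms standard_simplex_1_eq[of x] unfolding singular_simplex_def extensional_def
    by (auto simp: simplex_of_path_def path_of_simplex_def restrict_def)
qed

lemma path_of_simplex_of_path:
  "t \<in> {0..1} \<Longrightarrow> path_of_simplex (simplex_of_path p) t = p t"
  using segment_simplex_in[of t] by (simp add: path_of_simplex_def simplex_of_path_def) (simp add: segment_simplex_def)

lemma simplex_of_path_cong:
  "(\<And>t. t \<in> {0..1} \<Longrightarrow> p t = r t) \<Longrightarrow> simplex_of_path p = simplex_of_path r"
  by (auto simp: simplex_of_path_def fun_eq_iff restrict_def standard_simplex_def)

lemma simplex_map_of_path: "simplex_map 1 f (simplex_of_path p) = simplex_of_path (f \<circ> p)"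
  by (auto simp: simplex_map_def simplex_of_path_def)

lemma path_of_simplex_map:
  "t \<in> {0..1} \<Longrightarrow> path_of_simplex (simplex_map 1 f s) t = f (path_of_simplex s t)"
  using segment_simplex_in[of t] by (simp add: path_of_simplex_def simplex_map_def)

lemma simplex_of_path_eqI:
  assumes "singular_simplex 1 X s" "\<And>t. t \<in> {0..1} \<Longrightarrow> path_of_simplex s t = p t"
  shows "s = simplex_of_path p"
  using simplex_of_path_of_simplex[OF assms(1)] simplex_of_path_cong[of "path_of_simplex s" p] assms(2)
  by simp

lemma standard_simplex_2D:
  assumes "x \<in> standard_simplex 2"
  shows "0 \<le> x 0" "0 \<le> x 1" "0 \<le> x 2" "x 0 + x 1 + x 2 = 1"
  using assms by (auto simp: standard_simplex_def numeral_2_eq_2)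

text \<open>Dropping vertex 0, 1 or 2 of the triangle leaves the edge 12, 02 or 01, each run from
  its smaller to its larger vertex.\<close>

lemma path_of_face:
  assumes "t \<in> {0..1}"
  shows "path_of_simplex (singular_face 2 0 w) t = w (\<lambda>i. if i = 1 then 1 - t else if i = 2 then t else 0)"
    "path_of_simplex (singular_face 2 1 w) t = w (\<lambda>i. if i = 0 then 1 - t else if i = 2 then t else 0)"
    "path_of_simplex (singular_face 2 2 w) t = w (\<lambda>i. if i = 0 then 1 - t else if i = 1 then t else 0)"
proof -
  have "simplical_face 0 (segment_simplex t) = (\<lambda>i. if i = 1 then 1 - t else if i = 2 then t else 0)"
    "simplical_face 1 (segment_simplex t) = (\<lambda>i. if i = 0 then 1 - t else if i = 2 then t else 0)"
    "simplical_face 2 (segment_simplex t) = (\<lambda>i. if i = 0 then 1 - t else if i = 1 then t else 0)"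
    by (auto simp: simplical_face_def segment_simplex_def fun_eq_iff)
  then show "path_of_simplex (singular_face 2 0 w) t = w (\<lambda>i. if i = 1 then 1 - t else if i = 2 then t else 0)"
    "path_of_simplex (singular_face 2 1 w) t = w (\<lambda>i. if i = 0 then 1 - t else if i = 2 then t else 0)"
    "path_of_simplex (singular_face 2 2 w) t = w (\<lambda>i. if i = 0 then 1 - t else if i = 1 then t else 0)"
    using segment_simplex_in[OF assms] by (simp_all add: path_of_simplex_def singular_face_def)
qed

lemma singular_simplex_face2:
  assumes "singular_simplex 2 X w" "k \<le> 2"
  shows "singular_simplex 1 X (singular_face 2 k w)"
  using singular_simplex_singular_face[OF assms(1) _ assms(2)] by simp

lemma path_of_face_ends:
  "path_of_simplex (singular_face 2 2 w) 0 = path_of_simplex (singular_face 2 1 w) 0"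
  "path_of_simplex (singular_face 2 2 w) 1 = path_of_simplex (singular_face 2 0 w) 0"
  "path_of_simplex (singular_face 2 0 w) 1 = path_of_simplex (singular_face 2 1 w) 1"
  by (auto simp: path_of_face path_of_face(2)[unfolded One_nat_def] intro!: arg_cong[of _ _ w])

lemma path_homotopic_triangle:
  assumes w: "singular_simplex 2 X w"
  shows "path_homotopic X (path_of_simplex (singular_face 2 2 w) \<cdot>\<cdot> path_of_simplex (singular_face 2 0 w))
           (path_of_simplex (singular_face 2 1 w))"
proof -
  \<comment> \<open>In barycentric coordinates, \<open>?u\<close> is the broken line from vertex 0
    over vertex 1 to vertex 2, and \<open>?v\<close> is the straight edge from vertex 0 to vertex
    2.\<close>
  let ?u = "\<lambda>t i. if i = (0::nat) then max 0 (1 - 2 * t) else if i = 1 then min (2 * t) (2 - 2 * t)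
     else if i = 2 then max 0 (2 * t - 1) else (0::real)"
  let ?v = "\<lambda>t i. if i = (0::nat) then 1 - t else if i = 2 then t else (0::real)"
  have hom: "path_homotopic X (w \<circ> ?u) (w \<circ> ?v)"
  proof (rule path_homotopic_in_simplex)
    show "continuous_map (subtopology (powertop_real UNIV) (standard_simplex 2)) X w"
      using w by (simp add: singular_simplex_def)
    show "continuous_map (top_of_set {0..1}) (subtopology (powertop_real UNIV) (standard_simplex 2)) ?u"
    proof (rule continuous_map_to_simplex)
      show "continuous_on {0..1} (\<lambda>t. ?u t i)" for i
        by (cases "i = 0"; cases "i = 1"; cases "i = 2") (auto intro!: continuous_intros)
      show "?u t \<in> standard_simplex 2" if "t \<in> {0..1}" for t
        using that by (auto simp: standard_simplex_def numeral_2_eq_2)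
    qed
    show "continuous_map (top_of_set {0..1}) (subtopology (powertop_real UNIV) (standard_simplex 2)) ?v"
    proof (rule continuous_map_to_simplex)
      show "continuous_on {0..1} (\<lambda>t. ?v t i)" for i
        by (cases "i = 0"; cases "i = 2") (auto intro!: continuous_intros)
      show "?v t \<in> standard_simplex 2" if "t \<in> {0..1}" for t
        using that by (auto simp: standard_simplex_def numeral_2_eq_2)
    qed
  qed auto
  have 1: "(path_of_simplex (singular_face 2 2 w) \<cdot>\<cdot> path_of_simplex (singular_face 2 0 w)) t = (w \<circ> ?u) t"
    if "t \<in> {0..1}" for t
  proof (cases "t \<le> 1/2")
    case True
    then show ?thesis using that path_of_face(3)[of "2 * t" w]
      by (auto simp: join_path_def fun_eq_iff intro!: arg_cong[of _ _ w])
  next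
    case False
    then show ?thesis using that path_of_face(1)[of "2 * t - 1" w]
      by (auto simp: join_path_def fun_eq_iff intro!: arg_cong[of _ _ w])
  qed
  have 2: "path_of_simplex (singular_face 2 1 w) t = (w \<circ> ?v) t" if "t \<in> {0..1}" for t
    using path_of_face(2)[OF that, of w] by simp
  have "pathin X (path_of_simplex (singular_face 2 2 w) \<cdot>\<cdot> path_of_simplex (singular_face 2 0 w))"
    by (intro pathin_join_path pathin_path_of_simplex singular_simplex_face2[OF w])
       (auto simp: path_of_face_ends)
  then have "path_homotopic X (path_of_simplex (singular_face 2 2 w) \<cdot>\<cdot> path_of_simplex (singular_face 2 0 w)) (w \<circ> ?u)"
    using 1 by (intro path_homotopic_eq)
  moreover have "path_homotopic X (w \<circ> ?v) (path_of_simplex (singular_face 2 1 w))"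
    using 2 by (intro path_homotopic_sym[OF path_homotopic_eq] pathin_path_of_simplex singular_simplex_face2[OF w]) auto
  ultimately show ?thesis
    using hom path_homotopic_trans by blast
qed

lemma singular_simplex_2I:
  assumes "continuous_map (subtopology (powertop_real UNIV) (standard_simplex 2)) X w"
  shows "singular_simplex 2 X (restrict w (standard_simplex 2))"
proof -
  have "continuous_map (subtopology (powertop_real UNIV) (standard_simplex 2)) X (restrict w (standard_simplex 2))"
    using assms by (rule continuous_map_eq) auto
  then show ?thesis by (simp add: singular_simplex_def)
qed

lemma face_of_restrict:
  assumes "continuous_map (subtopology (powertop_real UNIV) (standard_simplex 2)) X w" "k \<le> 2"
    and "\<And>t. t \<in> {0..1} \<Longrightarrow> path_of_simplex (singular_face 2 k w) t = p t"
  shows "singular_face 2 k (restrict w (standard_simplex 2)) = simplex_of_path p"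
  by (rule simplex_of_path_eqI[of X])
     (use assms singular_simplex_face2[OF singular_simplex_2I[OF assms(1)] assms(2)] in \<open>auto\<close>)

section \<open>Nonabelian cocycles\<close>

text \<open>The faces \<open>2\<close>, \<open>0\<close>, \<open>1\<close> of a 2-simplex are its edges \<open>01\<close>, \<open>12\<close>, \<open>02\<close>.\<close>

definition cocycle_mod ::
  "'a topology \<Rightarrow> ('g, 'm) monoid_scheme \<Rightarrow> 'g set \<Rightarrow> (((nat \<Rightarrow> real) \<Rightarrow> 'a) \<Rightarrow> 'g) \<Rightarrow> bool" where
  "cocycle_mod X G N \<Phi> \<longleftrightarrow>
     (\<forall>s. singular_simplex 1 X s \<longrightarrow> \<Phi> s \<in> carrier G) \<and>
     (\<forall>w. singular_simplex 2 X w \<longrightarrow>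
        \<Phi> (singular_face 2 2 w) \<otimes>\<^bsub>G\<^esub> \<Phi> (singular_face 2 0 w) \<otimes>\<^bsub>G\<^esub> inv\<^bsub>G\<^esub> \<Phi> (singular_face 2 1 w) \<in> N)"

text \<open>A flat labelling of the edges: by \<open>cocycle_join\<close> and
  \<open>cocycle_homotopic\<close> it respects composition and homotopy of paths, that is, it
  amounts to a homomorphism from the fundamental groupoid of \<open>X\<close> to
  \<open>G\<close>.\<close>

abbreviation cocycle :: "'a topology \<Rightarrow> ('g, 'm) monoid_scheme \<Rightarrow> (((nat \<Rightarrow> real) \<Rightarrow> 'a) \<Rightarrow> 'g) \<Rightarrow> bool" where
  "cocycle X G \<equiv> cocycle_mod X G {\<one>\<^bsub>G\<^esub>}"

lemma cocycle_mod_closed: "cocycle_mod X G N \<Phi> \<Longrightarrow> singular_simplex 1 X s \<Longrightarrow> \<Phi> s \<in> carrier G"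
  by (simp add: cocycle_mod_def)

lemma (in group) eq_iff_mult_inv: "x \<in> carrier G \<Longrightarrow> y \<in> carrier G \<Longrightarrow> x \<otimes> inv y = \<one> \<longleftrightarrow> x = y"
  by (auto dest: inv_equality[of x "inv y"])

lemma (in group) cocycle_iff:
  "cocycle X G \<Phi> \<longleftrightarrow>
     (\<forall>s. singular_simplex 1 X s \<longrightarrow> \<Phi> s \<in> carrier G) \<and>
     (\<forall>w. singular_simplex 2 X w \<longrightarrow>
        \<Phi> (singular_face 2 2 w) \<otimes> \<Phi> (singular_face 2 0 w) = \<Phi> (singular_face 2 1 w))"
  unfolding cocycle_mod_def using singular_simplex_face2[of X]
  by (auto simp: eq_iff_mult_inv)

context group
begin

lemma cocycle_eq:
  "cocycle X G \<Phi> \<Longrightarrow> singular_simplex 2 X w \<Longrightarrow>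
     \<Phi> (singular_face 2 2 w) \<otimes> \<Phi> (singular_face 2 0 w) = \<Phi> (singular_face 2 1 w)"
  by (simp add: cocycle_iff)

lemma cocycle_join:
  assumes \<Phi>: "cocycle X G \<Phi>" and p: "pathin X p" and q: "pathin X q" and pq: "p 1 = q 0"
  shows "\<Phi> (simplex_of_path (p \<cdot>\<cdot> q)) = \<Phi> (simplex_of_path p) \<otimes> \<Phi> (simplex_of_path q)"
proof -
  let ?D = "subtopology (powertop_real UNIV) (standard_simplex 2)"
  \<comment> \<open>The affine map \<open>x 1 / 2 + x 2\<close> sends the three vertices to 0, 1/2
    and 1. The edges 01 and 12 then run through the two halves of the joined path, and 02 runs
    through all of it.\<close>
  let ?w = "(p \<cdot>\<cdot> q) \<circ> (\<lambda>x. x 1 / 2 + x 2)"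
  have "continuous_map ?D (top_of_set {0..1}) (\<lambda>x. x 1 / 2 + x 2)"
    unfolding continuous_map_in_subtopology
  proof (intro conjI continuous_map_add)
    show "continuous_map ?D euclideanreal (\<lambda>x. x 1 / 2)"
      using continuous_map_real_mult_left[OF continuous_simplex_coord[of 2 1], of "1/2"] by simp
    show "(\<lambda>x. x 1 / 2 + x 2) \<in> topspace ?D \<rightarrow> {0..1}"
      using standard_simplex_2D by fastforce
  qed (rule continuous_simplex_coord)
  then have w: "continuous_map ?D X ?w"
    using pathin_join_path[OF p q pq] continuous_map_compose unfolding pathin_def by blast
  have 2: "singular_face 2 2 (restrict ?w (standard_simplex 2)) = simplex_of_path p"
    using w by (rule face_of_restrict) (auto simp: path_of_face(3) join_path_def)
  have 0: "singular_face 2 0 (restrict ?w (standard_simplex 2)) = simplex_of_path q"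
  proof (rule face_of_restrict[OF w])
    fix t :: real assume t: "t \<in> {0..1}"
    have "(p \<cdot>\<cdot> q) (1/2 + t/2) = q t"
      using t pq by (cases "t = 0") (auto simp: join_path_def)
    then show "path_of_simplex (singular_face 2 0 ?w) t = q t"
      using t by (simp add: path_of_face(1) diff_divide_distrib add.commute)
  qed simp
  have 1: "singular_face 2 1 (restrict ?w (standard_simplex 2)) = simplex_of_path (p \<cdot>\<cdot> q)"
    using w by (rule face_of_restrict) (auto simp: path_of_face(2)[unfolded One_nat_def])
  show ?thesis
    using cocycle_eq[OF \<Phi> singular_simplex_2I[OF w]] unfolding 0 1 2 by simp
qed

text \<open>A constant path equals its composite with itself, so its value is an idempotent of the
  group.\<close>

lemma cocycle_const:
  assumes \<Phi>: "cocycle X G \<Phi>" and a: "a \<in> topspace X"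
  shows "\<Phi> (simplex_of_path (\<lambda>_. a)) = \<one>"
proof -
  have "(\<lambda>_. a) \<cdot>\<cdot> (\<lambda>_. a) = (\<lambda>_. a)" by (auto simp: join_path_def)
  then have "\<Phi> (simplex_of_path (\<lambda>_. a)) \<otimes> \<Phi> (simplex_of_path (\<lambda>_. a)) = \<Phi> (simplex_of_path (\<lambda>_. a))"
    using cocycle_join[OF \<Phi>, of "\<lambda>_. a" "\<lambda>_. a"] a by simp
  moreover have "\<Phi> (simplex_of_path (\<lambda>_. a)) \<in> carrier G"
    using a by (intro cocycle_mod_closed[OF \<Phi>] singular_simplex_of_path) simp
  ultimately show ?thesis
    by simp
qed

text \<open>The square of the homotopy is cut along its diagonal into two 2-simplices.\<close>

lemma cocycle_homotopic:
  assumes \<Phi>: "cocycle X G \<Phi>" and pr: "path_homotopic X p r"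
  shows "\<Phi> (simplex_of_path p) = \<Phi> (simplex_of_path r)"
proof -
  let ?D = "subtopology (powertop_real UNIV) (standard_simplex 2)"
  obtain h where h: "continuous_map (top_of_set ({0..1} \<times> {0..1})) X h"
    and hv: "\<And>x. x\<in>{0..1} \<Longrightarrow> h (0, x) = p x \<and> h (1, x) = r x \<and> h (x, 0) = p 0 \<and> h (x, 1) = p 1"
    using pr by (auto simp: path_homotopic_iff)
  have cl: "\<Phi> (simplex_of_path q) \<in> carrier G" if "pathin X q" for q
    using that cocycle_mod_closed[OF \<Phi>] singular_simplex_of_path by blast
  note pin = path_homotopic_imp[OF pr]
  have sum: "continuous_map ?D euclideanreal (\<lambda>x. x 1 + x 2)"
    by (intro continuous_map_add continuous_simplex_coord)
  have in01: "x 1 + x 2 \<in> {0..1}" "x 2 \<in> {0..1}" if "x \<in> standard_simplex 2" for x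
    using standard_simplex_2D[OF that] by auto
  \<comment> \<open>In the coordinates (time, parameter), \<open>?u\<close> sends the vertices to
    (0,0), (1,0), (1,1) and \<open>?v\<close> sends them to (0,0), (0,1), (1,1). Each triangle has
    the diagonal, one of the two paths and one constant side as its edges.\<close>
  let ?u = "\<lambda>x. (x (1::nat) + x 2, x 2 :: real)" and ?v = "\<lambda>x. (x 2 :: real, x (1::nat) + x 2)"
  have "continuous_map ?D (top_of_set ({0..1} \<times> {0..1})) ?u"
    "continuous_map ?D (top_of_set ({0..1} \<times> {0..1})) ?v"
    using sum continuous_simplex_coord[of 2 2] in01
    by (auto simp: continuous_map_in_subtopology euclidean_product_topology continuous_map_pairwise o_def
        simp flip: prod_topology_euclidean)
  then have hu: "continuous_map ?D X (h \<circ> ?u)" and hv': "continuous_map ?D X (h \<circ> ?v)"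
    using h continuous_map_compose by blast+
  let ?diag = "\<lambda>t. h (t, t)"
  have eq: "\<Phi> (singular_face 2 2 (restrict w (standard_simplex 2))) \<otimes> \<Phi> (singular_face 2 0 (restrict w (standard_simplex 2)))
      = \<Phi> (singular_face 2 1 (restrict w (standard_simplex 2)))" if "continuous_map ?D X w" for w
    by (rule cocycle_eq[OF \<Phi> singular_simplex_2I[OF that]])
  have u: "singular_face 2 2 (restrict (h \<circ> ?u) (standard_simplex 2)) = simplex_of_path (\<lambda>_. p 0)"
    "singular_face 2 0 (restrict (h \<circ> ?u) (standard_simplex 2)) = simplex_of_path r"
    "singular_face 2 1 (restrict (h \<circ> ?u) (standard_simplex 2)) = simplex_of_path ?diag"
    by (rule face_of_restrict[OF hu]; use hv in \<open>simp add: path_of_face path_of_face(2)[unfolded One_nat_def]\<close>)+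
  have v: "singular_face 2 2 (restrict (h \<circ> ?v) (standard_simplex 2)) = simplex_of_path p"
    "singular_face 2 0 (restrict (h \<circ> ?v) (standard_simplex 2)) = simplex_of_path (\<lambda>_. p 1)"
    "singular_face 2 1 (restrict (h \<circ> ?v) (standard_simplex 2)) = simplex_of_path ?diag"
    by (rule face_of_restrict[OF hv']; use hv in \<open>simp add: path_of_face path_of_face(2)[unfolded One_nat_def]\<close>)+
  have "p 0 \<in> topspace X" "p 1 \<in> topspace X"
    using pin path_start_in_topspace path_finish_in_topspace by auto
  then show ?thesis
    using eq[OF hu] eq[OF hv'] unfolding u v
    using cocycle_const[OF \<Phi>] cl pin by simp
qed

text \<open>A representative of each class is picked by \<open>SOME\<close>;
  \<open>cocycle_homotopic\<close> makes the value independent of the pick.\<close>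

lemma cocycle_imp_hom:
  assumes \<Phi>: "cocycle X G \<Phi>"
  obtains \<phi> where "\<phi> \<in> hom (pi1 X a) G"
    "\<And>p. pathin X p \<Longrightarrow> p 0 = a \<Longrightarrow> p 1 = a \<Longrightarrow> \<phi> (path_class X p) = \<Phi> (simplex_of_path p)"
proof
  let ?\<phi> = "\<lambda>u. \<Phi> (simplex_of_path (SOME p. p \<in> u))"
  show val: "?\<phi> (path_class X p) = \<Phi> (simplex_of_path p)" if "pathin X p" for p
  proof -
    have "(SOME r. r \<in> path_class X p) \<in> path_class X p"
      using someI[of "\<lambda>r. r \<in> path_class X p" p] path_in_path_class[OF that] by blast
    then show ?thesis
      using cocycle_homotopic[OF \<Phi>] by (simp add: path_class_eq_Collect)
  qed
  show "?\<phi> \<in> hom (pi1 X a) G"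
  proof (rule homI)
    fix x assume "x \<in> carrier (pi1 X a)"
    then obtain p where "pathin X p" "x = path_class X p"
      by (rule pi1_carrierE)
    then show "?\<phi> x \<in> carrier G"
      using val cocycle_mod_closed[OF \<Phi>] singular_simplex_of_path by metis
  next
    fix x y assume "x \<in> carrier (pi1 X a)" "y \<in> carrier (pi1 X a)"
    then show "?\<phi> (x \<otimes>\<^bsub>pi1 X a\<^esub> y) = ?\<phi> x \<otimes> ?\<phi> y"
      by (auto elim!: pi1_carrierE simp: val pi1_mult pathin_join_path cocycle_join[OF \<Phi>])
  qed
qed

end

section \<open>The tautological cocycle\<close>

text \<open>The path to \<open>a\<close> itself is fixed to be constant. This is what makes the
  tautological cocycle return the exact class of a loop at \<open>a\<close>, rather than a conjugate
  of it.\<close>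

definition link_path :: "'a topology \<Rightarrow> 'a \<Rightarrow> 'a \<Rightarrow> real \<Rightarrow> 'a" where
  "link_path X a x = (if x = a then (\<lambda>_. a) else (SOME p. pathin X p \<and> p 0 = a \<and> p 1 = x))"

lemma link_path:
  assumes "path_component_of X a x"
  shows "pathin X (link_path X a x)" "link_path X a x 0 = a" "link_path X a x 1 = x"
proof -
  have "pathin X (link_path X a x) \<and> link_path X a x 0 = a \<and> link_path X a x 1 = x"
  proof (cases "x = a")
    case True
    then show ?thesis using assms path_component_in_topspace[of X a x] by (auto simp: link_path_def)
  next
    case False
    then show ?thesis
      using someI_ex[OF assms[unfolded path_component_of_def]] by (simp add: link_path_def)
  qed
  then show "pathin X (link_path X a x)" "link_path X a x 0 = a" "link_path X a x 1 = x" by auto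
qed

text \<open>The ends of a simplex are joined to \<open>a\<close> by the chosen paths. Simplices
  outside the path component of \<open>a\<close> cannot be joined to it and get the neutral element,
  which is consistent because all edges of a 2-simplex lie in one component.\<close>

definition simplex_loop :: "'a topology \<Rightarrow> 'a \<Rightarrow> ((nat \<Rightarrow> real) \<Rightarrow> 'a) \<Rightarrow> (real \<Rightarrow> 'a) set" where
  "simplex_loop X a s =
     (if path_component_of X a (path_of_simplex s 0)
      then path_class X (link_path X a (path_of_simplex s 0) \<cdot>\<cdot> path_of_simplex s
              \<cdot>\<cdot> rev_path (link_path X a (path_of_simplex s 1)))
      else \<one>\<^bsub>pi1 X a\<^esub>)"

lemma path_component_of_simplex:
  assumes "singular_simplex 1 X s"
  shows "path_component_of X a (path_of_simplex s 0) \<longleftrightarrow> path_component_of X a (path_of_simplex s 1)"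
  using pathin_path_of_simplex[OF assms] path_component_of_trans path_component_of_sym
  unfolding path_component_of_def[of X "path_of_simplex s 0" "path_of_simplex s 1"]
  by (metis path_component_of_def)

text \<open>The link to the middle vertex occurs backwards in the first factor and forwards in the
  second, so it cancels; the remaining two edges contract across the 2-simplex to the third
  one.\<close>

lemma cocycle_simplex_loop:
  assumes a: "a \<in> topspace X"
  shows "cocycle X (pi1 X a) (simplex_loop X a)"
proof -
  interpret group "pi1 X a" using a by (rule group_pi1)
  show ?thesis
    unfolding cocycle_iff
  proof (intro conjI allI impI)
    fix s assume s: "singular_simplex 1 X s"
    show "simplex_loop X a s \<in> carrier (pi1 X a)"
    proof (cases "path_component_of X a (path_of_simplex s 0)")
      case True
      then have "path_component_of X a (path_of_simplex s 1)"
        using path_component_of_simplex[OF s] by blast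
      with True show ?thesis
        unfolding simplex_loop_def
        by (auto simp: link_path intro!: pi1_carrierI pathin_join_path pathin_rev_path pathin_path_of_simplex[OF s])
    qed (simp add: simplex_loop_def)
  next
    fix w assume w: "singular_simplex 2 X w"
    let ?s = "\<lambda>k. path_of_simplex (singular_face 2 k w)"
    let ?l = "link_path X a"
    note ends = path_of_face_ends[of w]
    have s: "pathin X (?s k)" if "k \<le> 2" for k
      using that by (intro pathin_path_of_simplex singular_simplex_face2[OF w])
    show "simplex_loop X a (singular_face 2 2 w) \<otimes>\<^bsub>pi1 X a\<^esub> simplex_loop X a (singular_face 2 0 w) =
        simplex_loop X a (singular_face 2 1 w)"
    proof (cases "path_component_of X a (?s 1 0)")
      case False
      then have "\<not> path_component_of X a (?s 2 0)" "\<not> path_component_of X a (?s 0 0)"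
        using ends path_component_of_simplex[OF singular_simplex_face2[OF w, of 2], of a] by auto
      with False show ?thesis by (simp add: simplex_loop_def)
    next
      case True
      have c0: "path_component_of X a (?s 2 0)" and c1: "path_component_of X a (?s 0 0)"
        and c2: "path_component_of X a (?s 1 1)"
        using True ends path_component_of_simplex[OF singular_simplex_face2[OF w, of 2], of a]
          path_component_of_simplex[OF singular_simplex_face2[OF w, of 1], of a] by auto
      define p where "p = ?l (?s 2 0)"
      define q where "q = ?l (?s 0 0)"
      define r where "r = rev_path (?l (?s 1 1))"
      have p: "pathin X p" "p 0 = a" "p 1 = ?s 2 0" unfolding p_def using link_path[OF c0] by auto
      have q: "pathin X q" "q 0 = a" "q 1 = ?s 0 0" unfolding q_def using link_path[OF c1] by auto
      have r: "pathin X r" "r 0 = ?s 1 1" "r 1 = a" unfolding r_def using link_path[OF c2]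
        by (auto intro: pathin_rev_path)
      note [simp] = p q r s ends pathin_join_path pathin_rev_path path_homotopic_refl
      have "path_homotopic X ((?s 2 \<cdot>\<cdot> rev_path q) \<cdot>\<cdot> q \<cdot>\<cdot> ?s 0 \<cdot>\<cdot> r) (?s 2 \<cdot>\<cdot> rev_path q \<cdot>\<cdot> q \<cdot>\<cdot> ?s 0 \<cdot>\<cdot> r)"
        by (rule path_homotopic_assoc) auto
      also have "path_homotopic X \<dots> (?s 2 \<cdot>\<cdot> (rev_path q \<cdot>\<cdot> q) \<cdot>\<cdot> ?s 0 \<cdot>\<cdot> r)"
        by (intro path_homotopic_join path_homotopic_sym[OF path_homotopic_assoc]) auto
      also have "path_homotopic X \<dots> (?s 2 \<cdot>\<cdot> (\<lambda>_. q 1) \<cdot>\<cdot> ?s 0 \<cdot>\<cdot> r)"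
        by (intro path_homotopic_join path_homotopic_rev_left) auto
      also have "path_homotopic X \<dots> (?s 2 \<cdot>\<cdot> ?s 0 \<cdot>\<cdot> r)"
        by (intro path_homotopic_join path_homotopic_const_left) auto
      also have "path_homotopic X \<dots> ((?s 2 \<cdot>\<cdot> ?s 0) \<cdot>\<cdot> r)"
        by (intro path_homotopic_sym[OF path_homotopic_assoc]) auto
      also have "path_homotopic X \<dots> (?s 1 \<cdot>\<cdot> r)"
        by (intro path_homotopic_join path_homotopic_triangle[OF w]) auto
      finally have *: "path_homotopic X ((?s 2 \<cdot>\<cdot> rev_path q) \<cdot>\<cdot> q \<cdot>\<cdot> ?s 0 \<cdot>\<cdot> r) (?s 1 \<cdot>\<cdot> r)" .
      have "path_homotopic X (p \<cdot>\<cdot> (?s 2 \<cdot>\<cdot> rev_path q) \<cdot>\<cdot> q \<cdot>\<cdot> ?s 0 \<cdot>\<cdot> r) (p \<cdot>\<cdot> ?s 1 \<cdot>\<cdot> r)"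
        by (rule path_homotopic_join[OF _ *]) auto
      moreover have "path_homotopic X ((p \<cdot>\<cdot> ?s 2 \<cdot>\<cdot> rev_path q) \<cdot>\<cdot> q \<cdot>\<cdot> ?s 0 \<cdot>\<cdot> r) (p \<cdot>\<cdot> (?s 2 \<cdot>\<cdot> rev_path q) \<cdot>\<cdot> q \<cdot>\<cdot> ?s 0 \<cdot>\<cdot> r)"
        by (rule path_homotopic_assoc) auto
      ultimately have "path_homotopic X ((p \<cdot>\<cdot> ?s 2 \<cdot>\<cdot> rev_path q) \<cdot>\<cdot> q \<cdot>\<cdot> ?s 0 \<cdot>\<cdot> r) (p \<cdot>\<cdot> ?s 1 \<cdot>\<cdot> r)"
        using path_homotopic_trans by blast
      then have "path_class X (p \<cdot>\<cdot> ?s 2 \<cdot>\<cdot> rev_path q) \<otimes>\<^bsub>pi1 X a\<^esub> path_class X (q \<cdot>\<cdot> ?s 0 \<cdot>\<cdot> r) = path_class X (p \<cdot>\<cdot> ?s 1 \<cdot>\<cdot> r)"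
        by (simp add: pi1_mult path_class_eq_iff)
      then show ?thesis
        using c0 c1 True ends by (simp add: simplex_loop_def p_def q_def r_def)
    qed
  qed
qed

lemma simplex_loop_of_loop:
  assumes p: "pathin X p" "p 0 = a" "p 1 = a"
  shows "simplex_loop X a (simplex_of_path p) = path_class X p"
proof -
  have a: "a \<in> topspace X" using p path_start_in_topspace by fastforce
  let ?q = "path_of_simplex (simplex_of_path p)"
  have q: "?q t = p t" if "t \<in> {0..1}" for t using that by (rule path_of_simplex_of_path)
  have pq: "path_homotopic X ?q p"
    by (intro path_homotopic_eq pathin_path_of_simplex singular_simplex_of_path p q)
  have ends: "?q 0 = a" "?q 1 = a" using q[of 0] q[of 1] p by auto
  have "path_homotopic X ((\<lambda>_. a) \<cdot>\<cdot> ?q \<cdot>\<cdot> (\<lambda>_. a)) ((\<lambda>_. a) \<cdot>\<cdot> ?q)"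
    using pq ends a
    by (intro path_homotopic_join path_homotopic_const_right path_homotopic_refl) (auto dest: path_homotopic_imp)
  also have "path_homotopic X \<dots> ?q"
    using pq ends by (intro path_homotopic_const_left) (auto dest: path_homotopic_imp)
  also note pq
  finally have "path_class X ((\<lambda>_. a) \<cdot>\<cdot> ?q \<cdot>\<cdot> (\<lambda>_. a)) = path_class X p"
    using path_class_eq_iff path_homotopic_imp(1) by blast
  moreover have "rev_path (\<lambda>_. a) = (\<lambda>_. a)" by (simp add: rev_path_def)
  ultimately show ?thesis
    using ends a by (simp add: simplex_loop_def link_path_def path_component_of_refl)
qed

section \<open>Singular chains in low degrees\<close>

lemma chain_boundary_1_of:
  "chain_boundary 1 (frag_of s) = frag_of (singular_face 1 0 s) - frag_of (singular_face 1 1 s)"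
  by (simp add: chain_boundary_of)

lemma chain_boundary_2_of:
  "chain_boundary 2 (frag_of w) =
     frag_of (singular_face 2 0 w) - frag_of (singular_face 2 1 w) + frag_of (singular_face 2 2 w)"
  by (simp add: chain_boundary_of numeral_2_eq_2)

lemma chain_boundary_3_of:
  "chain_boundary 3 (frag_of t) =
     frag_of (singular_face 3 0 t) - frag_of (singular_face 3 1 t) + frag_of (singular_face 3 2 t)
       - frag_of (singular_face 3 3 t)"
  by (simp add: chain_boundary_of numeral_3_eq_3 numeral_2_eq_2)

definition vertex_simplex :: "'a \<Rightarrow> (nat \<Rightarrow> real) \<Rightarrow> 'a" where
  "vertex_simplex x = restrict (\<lambda>_. x) (standard_simplex 0)"

lemma singular_face_1:
  "singular_face 1 0 s = vertex_simplex (path_of_simplex s 1)"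
  "singular_face 1 1 s = vertex_simplex (path_of_simplex s 0)"
proof -
  have *: "simplical_face 0 (\<lambda>j. if j = 0 then 1 else 0) = segment_simplex 1"
    "simplical_face (Suc 0) (\<lambda>j. if j = 0 then 1 else 0) = segment_simplex 0"
    by (auto simp: simplical_face_def segment_simplex_def fun_eq_iff)
  show "singular_face 1 0 s = vertex_simplex (path_of_simplex s 1)"
    "singular_face 1 1 s = vertex_simplex (path_of_simplex s 0)"
    by (rule ext, simp add: singular_face_def vertex_simplex_def path_of_simplex_def standard_simplex_0 restrict_def *)+
qed

lemma chain_boundary_simplex:
  "chain_boundary 1 (frag_of s) =
     frag_of (vertex_simplex (path_of_simplex s 1)) - frag_of (vertex_simplex (path_of_simplex s 0))"
  by (simp add: chain_boundary_1_of singular_face_1 flip: One_nat_def)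

lemma chain_boundary_path:
  "chain_boundary 1 (frag_of (simplex_of_path p)) =
     frag_of (vertex_simplex (p 1)) - frag_of (vertex_simplex (p 0))"
  by (simp add: chain_boundary_simplex path_of_simplex_of_path flip: One_nat_def)

text \<open>The simplicial identity d_i d_j = d_(j-1) d_i for i < j, in the degree that identifies
  the edges shared by the faces of a 3-simplex.\<close>

lemma singular_face_face:
  assumes "i < j" "j \<le> 3"
  shows "singular_face 2 i (singular_face 3 j t) = singular_face 2 (j - 1) (singular_face 3 i t)"
proof -
  have eq: "simplical_face j (simplical_face i x) = simplical_face i (simplical_face (j - 1) x)" for x :: "nat \<Rightarrow> real"
  proof
    fix k
    consider "k < i" | "k = i" | "i < k" "k < j" | "k = j" | "j < k"
      using assms(1) by linarith
    then show "simplical_face j (simplical_face i x) k = simplical_face i (simplical_face (j - 1) x) k"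
      using assms(1) by cases (auto simp: simplical_face_def)
  qed
  have mem: "simplical_face k x \<in> standard_simplex 2" if "x \<in> standard_simplex 1" "k \<le> 2" for k x
    using simplical_face_in_standard_simplex[of 2 k x] that by simp
  have ij: "i \<le> 2" "j - 1 \<le> 2" using assms by auto
  show ?thesis
  proof
    fix x
    show "singular_face 2 i (singular_face 3 j t) x = singular_face 2 (j - 1) (singular_face 3 i t) x"
      using mem[OF _ ij(1)] mem[OF _ ij(2)] by (simp add: singular_face_def restrict_def eq)
  qed
qed

section \<open>Cochains as homomorphisms out of the chain groups\<close>

lemma chain_hom_exists:
  assumes "comm_group A" "\<And>s. singular_simplex p X s \<Longrightarrow> f s \<in> carrier A"
  obtains h where "h \<in> hom (chain_group p X) A" "\<And>s. singular_simplex p X s \<Longrightarrow> h (frag_of s) = f s"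
proof -
  have "f ` singular_simplex_set p X \<subseteq> carrier A"
    using assms(2) by auto
  from comm_group.free_Abelian_group_universal[OF assms(1) this]
  obtain h where "h \<in> hom (chain_group p X) A" "\<And>s. s \<in> singular_simplex_set p X \<Longrightarrow> h (frag_of s) = f s"
    unfolding chain_group_def by metis
  with that show thesis by simp
qed

lemma chain_hom_add:
  "h \<in> hom (chain_group p X) A \<Longrightarrow> singular_chain p X a \<Longrightarrow> singular_chain p X b \<Longrightarrow>
     h (a + b) = h a \<otimes>\<^bsub>A\<^esub> h b"
  by (auto simp: hom_def)

lemma chain_hom_closed:
  "h \<in> hom (chain_group p X) A \<Longrightarrow> singular_chain p X a \<Longrightarrow> h a \<in> carrier A"
  by (auto simp: hom_def)

lemma chain_hom_zero:
  assumes "group A" "h \<in> hom (chain_group p X) A"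
  shows "h 0 = \<one>\<^bsub>A\<^esub>"
  using hom_one[OF assms(2) group_chain_group assms(1)] by simp

lemma chain_hom_minus:
  assumes A: "group A" and h: "h \<in> hom (chain_group p X) A" and a: "singular_chain p X a"
  shows "h (- a) = inv\<^bsub>A\<^esub> h a"
proof -
  interpret group A by fact
  have "h (- a) \<otimes>\<^bsub>A\<^esub> h a = \<one>\<^bsub>A\<^esub>"
    using chain_hom_add[OF h, of "- a" a] chain_hom_zero[OF A h] a by (simp add: singular_chain_minus)
  then show ?thesis
    using a by (intro inv_equality[symmetric] chain_hom_closed[OF h]) (auto simp: singular_chain_minus)
qed

lemma chain_hom_diff:
  assumes A: "group A" and h: "h \<in> hom (chain_group p X) A" and "singular_chain p X a" "singular_chain p X b"
  shows "h (a - b) = h a \<otimes>\<^bsub>A\<^esub> inv\<^bsub>A\<^esub> h b"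
  using chain_hom_add[OF h, of a "- b"] chain_hom_minus[OF A h, of b] assms by (simp add: singular_chain_minus)

lemma chain_hom_eqI:
  assumes A: "group A" and h: "h \<in> hom (chain_group p X) A" and k: "k \<in> hom (chain_group p X) A"
    and eq: "\<And>s. singular_simplex p X s \<Longrightarrow> h (frag_of s) = k (frag_of s)"
    and c: "singular_chain p X c"
  shows "h c = k c"
proof -
  have "singular_chain p X c \<and> h c = k c"
    using c unfolding singular_chain_def
  proof (induction c rule: frag_induction)
    case zero
    then show ?case using chain_hom_zero[OF A h] chain_hom_zero[OF A k] by simp
  next
    case (one x)
    then show ?case using eq by simp
  next
    case (diff a b)
    then show ?case
      using chain_hom_diff[OF A h, of a b] chain_hom_diff[OF A k, of a b] singular_chain_diff[of p X a b]
      by (simp add: singular_chain_def)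
  qed
  then show ?thesis ..
qed

lemma chain_boundary_hom: "chain_boundary (Suc p) \<in> hom (chain_group (Suc p) X) (chain_group p X)"
  using singular_chain_boundary_alt by (auto simp: hom_def chain_boundary_add)

lemma chain_boundary_2_hom: "chain_boundary 2 \<in> hom (chain_group 2 X) (chain_group 1 X)"
  using chain_boundary_hom[of 1 X] by (simp add: numeral_2_eq_2)

lemma chain_boundary_3_hom: "chain_boundary 3 \<in> hom (chain_group 3 X) (chain_group 2 X)"
  using chain_boundary_hom[of 2 X] by (simp add: numeral_3_eq_3 numeral_2_eq_2)

lemma singular_cycle_boundary_2:
  "singular_chain 2 X v \<Longrightarrow> singular_relcycle 1 X {} (chain_boundary 2 v)"
  using singular_chain_boundary_alt[of 1 X v] chain_boundary_boundary_alt[of 1 X v]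
  by (simp add: singular_cycle numeral_2_eq_2)

lemma chain_map_hom: "continuous_map X Y f \<Longrightarrow> chain_map p f \<in> hom (chain_group p X) (chain_group p Y)"
  by (auto simp: hom_def chain_map_add singular_chain_chain_map)

lemma trivial_hom: "group A \<Longrightarrow> (\<lambda>_. \<one>\<^bsub>A\<^esub>) \<in> hom G A"
  by (auto simp: hom_def group.is_monoid)

lemma chain_boundary_map:
  assumes "singular_chain (Suc p) X c"
  shows "chain_boundary (Suc p) (chain_map (Suc p) f c) = chain_map p f (chain_boundary (Suc p) c)"
  using chain_boundary_chain_map[OF assms, of f] by simp

section \<open>Lifting cocycles through central extensions\<close>

text \<open>Stated for cycles and boundaries instead of homology classes, because the evaluation of
  cochains needs the bounding chains themselves.\<close>

definition homology_injective :: "nat \<Rightarrow> 'a topology \<Rightarrow> 'b topology \<Rightarrow> ('a \<Rightarrow> 'b) \<Rightarrow> bool" where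
  "homology_injective p X Y f \<longleftrightarrow>
     (\<forall>z. singular_relcycle p X {} z \<longrightarrow> singular_relboundary p Y {} (chain_map p f z) \<longrightarrow>
          singular_relboundary p X {} z)"

definition homology_surjective :: "nat \<Rightarrow> 'a topology \<Rightarrow> 'b topology \<Rightarrow> ('a \<Rightarrow> 'b) \<Rightarrow> bool" where
  "homology_surjective p X Y f \<longleftrightarrow>
     (\<forall>c. singular_relcycle p Y {} c \<longrightarrow>
          (\<exists>z. singular_relcycle p X {} z \<and> singular_relboundary p Y {} (c - chain_map p f z)))"

lemma homology_iso_imp:
  assumes "homology_iso X Y f"
  shows "continuous_map X Y f" "homology_injective p X Y f" "homology_surjective p X Y f"
proof -
  show f: "continuous_map X Y f" using assms by (simp add: homology_iso_def)
  let ?h = "hom_induced (int p) X {} Y {} f"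
  have "?h \<in> iso (homology_group (int p) X) (homology_group (int p) Y)"
    using assms by (simp add: homology_iso_def)
  then have hom: "?h \<in> hom (homology_group (int p) X) (homology_group (int p) Y)"
    and inj: "inj_on ?h (carrier (homology_group (int p) X))"
    and surj: "?h ` carrier (homology_group (int p) X) = carrier (homology_group (int p) Y)"
    by (auto simp: iso_def bij_betw_def)
  have h: "?h (homologous_rel_set p X {} c) = homologous_rel_set p Y {} (chain_map p f c)"
    if "singular_relcycle p X {} c" for c
    using hom_induced_chain_map[OF f _ that, of "{}"] by simp
  show "homology_injective p X Y f"
    unfolding homology_injective_def
  proof (intro allI impI)
    fix z assume z: "singular_relcycle p X {} z" and b: "singular_relboundary p Y {} (chain_map p f z)"
    have "?h (homologous_rel_set p X {} z) = ?h (homologous_rel_set p X {} 0)"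
      unfolding h[OF z] h[OF singular_relcycle_0] homologous_rel_set_eq using b by (simp add: homologous_rel_def)
    then have "homologous_rel_set p X {} z = homologous_rel_set p X {} 0"
      using z by (intro inj_onD[OF inj]) (auto simp: carrier_relative_homology_group)
    then show "singular_relboundary p X {} z"
      unfolding homologous_rel_set_eq by (simp add: homologous_rel_def)
  qed
  show "homology_surjective p X Y f"
    unfolding homology_surjective_def
  proof (intro allI impI)
    fix c assume "singular_relcycle p Y {} c"
    then have "homologous_rel_set p Y {} c \<in> ?h ` carrier (homology_group (int p) X)"
      unfolding surj by (auto simp: carrier_relative_homology_group)
    then obtain z where "singular_relcycle p X {} z"
      "homologous_rel_set p Y {} c = homologous_rel_set p Y {} (chain_map p f z)"
      using h by (auto simp: carrier_relative_homology_group)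
    then show "\<exists>z. singular_relcycle p X {} z \<and> singular_relboundary p Y {} (c - chain_map p f z)"
      by (auto simp: homologous_rel_set_eq homologous_rel_def)
  qed
qed

text \<open>\<open>SOME\<close> is applied to the predicate \<open>path_component_of X x\<close>,
  which is one and the same for all points of a path component; so the whole component receives a
  single base.\<close>

definition component_base :: "'a topology \<Rightarrow> 'a \<Rightarrow> 'a" where
  "component_base X x = (SOME z. path_component_of X x z)"

lemma component_base:
  assumes "x \<in> topspace X"
  shows "path_component_of X (component_base X x) x"
  using someI[of "path_component_of X x" x] path_component_of_refl[of X x] assms
  by (simp add: component_base_def path_component_of_sym)

lemma component_base_eq:
  assumes "path_component_of X x y"
  shows "component_base X x = component_base X y"
proof -
  have "path_component_of X x = path_component_of X y"
    using assms path_component_of_sym path_component_of_trans by fast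
  then show ?thesis by (simp add: component_base_def)
qed

text \<open>Joining the ends of a simplex to the base of its component turns it into a cycle, so that a
  homomorphism that is only defined on 1-cycles still yields a cochain.\<close>

definition tree_chain :: "'a topology \<Rightarrow> 'a \<Rightarrow> 'a chain" where
  "tree_chain X x = frag_of (simplex_of_path (link_path X (component_base X x) x))"

definition closed_up :: "'a topology \<Rightarrow> ((nat \<Rightarrow> real) \<Rightarrow> 'a) \<Rightarrow> 'a chain" where
  "closed_up X s = tree_chain X (path_of_simplex s 0) + frag_of s - tree_chain X (path_of_simplex s 1)"

text \<open>The two ends of a simplex lie in one path component, so both tree paths start at the
  same base and its contributions to the boundary cancel.\<close>

lemma closed_up_cycle:
  assumes s: "singular_simplex 1 X s"
  shows "singular_relcycle 1 X {} (closed_up X s)"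
proof -
  have p: "pathin X (path_of_simplex s)" using s by (rule pathin_path_of_simplex)
  have ends: "path_of_simplex s 0 \<in> topspace X" "path_of_simplex s 1 \<in> topspace X"
    using p path_start_in_topspace path_finish_in_topspace by auto
  have "path_component_of X (path_of_simplex s 0) (path_of_simplex s 1)"
    using p path_component_of_def by fast
  then have eq: "component_base X (path_of_simplex s 0) = component_base X (path_of_simplex s 1)"
    by (rule component_base_eq)
  have t: "singular_chain 1 X (tree_chain X x)"
    "chain_boundary 1 (tree_chain X x) = frag_of (vertex_simplex x) - frag_of (vertex_simplex (component_base X x))"
    if "x \<in> topspace X" for x
    using link_path[OF component_base[OF that]] singular_simplex_of_path
      chain_boundary_path[of "link_path X (component_base X x) x"]
    by (auto simp: tree_chain_def singular_chain_of simp flip: One_nat_def)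
  have "chain_boundary 1 (closed_up X s) = 0"
    using t(2)[OF ends(1)] t(2)[OF ends(2)] chain_boundary_simplex[of s] eq
    by (simp add: closed_up_def chain_boundary_add chain_boundary_diff flip: One_nat_def)
  moreover have "singular_chain 1 X (closed_up X s)"
    unfolding closed_up_def using t(1)[OF ends(1)] t(1)[OF ends(2)] s
    by (intro singular_chain_diff singular_chain_add) (auto simp: singular_chain_of)
  ultimately show ?thesis
    by (simp add: singular_cycle)
qed

text \<open>The tree chains depend on the vertices only and telescope along the edges 01, 12, 02.
  Thus closing up leaves the boundary of a 2-simplex unchanged, as an identity of chains and not
  just of homology classes.\<close>

lemma closed_up_boundary:
  "closed_up X (singular_face 2 2 w) + closed_up X (singular_face 2 0 w) =
     chain_boundary 2 (frag_of w) + closed_up X (singular_face 2 1 w)"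
  unfolding closed_up_def chain_boundary_2_of path_of_face_ends by (simp add: algebra_simps)

section \<open>Correction of a cocycle in a central extension\<close>

locale central_subgroup = group E + subgroup A E for E (structure) and A +
  assumes central: "a \<in> A \<Longrightarrow> x \<in> carrier E \<Longrightarrow> a \<otimes> x = x \<otimes> a"
begin

abbreviation "centre_group \<equiv> E\<lparr>carrier := A\<rparr>"

lemma comm_group_centre: "comm_group centre_group"
  using subgroup_is_group[OF group_axioms] central by (intro group.group_comm_groupI) auto

lemma inv_centre: "a \<in> A \<Longrightarrow> inv\<^bsub>centre_group\<^esub> a = inv a"
  by (rule m_inv_consistent[OF subgroup_axioms])

lemma shuffle:
  assumes "a \<in> A" "b \<in> A" "x \<in> carrier E" "y \<in> carrier E"
  shows "(a \<otimes> x) \<otimes> (b \<otimes> y) = (a \<otimes> b) \<otimes> (x \<otimes> y)"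
proof -
  have "(a \<otimes> x) \<otimes> (b \<otimes> y) = a \<otimes> (x \<otimes> b) \<otimes> y" using assms by (simp add: m_assoc)
  also have "x \<otimes> b = b \<otimes> x" using assms by (intro central[symmetric]) auto
  finally show ?thesis using assms by (simp add: m_assoc)
qed

lemma shuffle_inv:
  assumes "a \<in> A" "x \<in> carrier E"
  shows "inv (a \<otimes> x) = inv a \<otimes> inv x"
  using assms central[of "inv a" "inv x"] by (simp add: inv_mult_group)

lemma inv_closed_centre: "a \<in> A \<Longrightarrow> inv a \<in> A"
  by (rule m_inv_closed)

text \<open>The defect of \<open>\<Phi>\<close> is a 2-cocycle \<open>c\<close> with values in
  \<open>A\<close>, and the given \<open>\<Psi>\<close> exhibits its pull-back to \<open>X\<close>
  as the coboundary of a cochain \<open>b\<close>. A homomorphism \<beta> on the 1-cycles of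
  \<open>Y\<close> that restricts to \<open>c\<close> on boundaries and to \<open>b\<close> on the
  images of cycles is the required correction. The conclusion compares with \<open>\<Psi>\<close> on
  closed paths only, because such a \<beta> carries no information about other simplices.\<close>

lemma lift_cocycle:
  assumes f: "continuous_map X Y f"
    and inj1: "homology_injective 1 X Y f"
    and surj1: "homology_surjective 1 X Y f"
    and surj2: "homology_surjective 2 X Y f"
    and \<Phi>: "cocycle_mod Y E A \<Phi>" and \<Psi>: "cocycle X E \<Psi>"
    and \<Phi>\<Psi>: "\<And>s. singular_simplex 1 X s \<Longrightarrow> \<Phi> (simplex_map 1 f s) \<otimes> inv (\<Psi> s) \<in> A"
  obtains \<Phi>' where "cocycle Y E \<Phi>'" "\<And>s. singular_simplex 1 Y s \<Longrightarrow> \<Phi>' s \<otimes> inv (\<Phi> s) \<in> A"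
    "\<And>p. pathin X p \<Longrightarrow> p 0 = p 1 \<Longrightarrow> \<Phi>' (simplex_of_path (f \<circ> p)) = \<Psi> (simplex_of_path p)"
proof -
  interpret C: comm_group centre_group by (rule comm_group_centre)
  have Cg: "group centre_group" ..
  \<comment> \<open>\<open>cf\<close> is the defect of \<open>\<Phi>\<close> on a 2-simplex,
    \<open>bf\<close> the discrepancy between its pull-back and \<open>\<Psi>\<close>. Both take
    values in the Abelian group \<open>A\<close>, so they extend to homomorphisms \<open>c\<close>
    and \<open>b\<close> on chains.\<close>
  define cf where "cf w = \<Phi> (singular_face 2 2 w) \<otimes> \<Phi> (singular_face 2 0 w) \<otimes> inv \<Phi> (singular_face 2 1 w)" for w
  define bf where "bf s = \<Phi> (simplex_map 1 f s) \<otimes> inv (\<Psi> s)" for s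
  have \<Phi>c: "\<Phi> s \<in> carrier E" if "singular_simplex 1 Y s" for s
    using cocycle_mod_closed[OF \<Phi> that] .
  have \<Psi>c: "\<Psi> s \<in> carrier E" if "singular_simplex 1 X s" for s
    using cocycle_mod_closed[OF \<Psi> that] .
  have cfA: "cf w \<in> A" if "singular_simplex 2 Y w" for w
    using \<Phi> that by (simp add: cf_def cocycle_mod_def)
  obtain c where c: "c \<in> hom (chain_group 2 Y) centre_group"
    and cof: "\<And>w. singular_simplex 2 Y w \<Longrightarrow> c (frag_of w) = cf w"
    using chain_hom_exists[OF comm_group_centre, of 2 Y cf] cfA by auto
  obtain b where b: "b \<in> hom (chain_group 1 X) centre_group"
    and bof: "\<And>s. singular_simplex 1 X s \<Longrightarrow> b (frag_of s) = bf s"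
    using chain_hom_exists[OF comm_group_centre, of 1 X bf] \<Phi>\<Psi> by (auto simp: bf_def)
  have cA: "c v \<in> A" if "singular_chain 2 Y v" for v using chain_hom_closed[OF c that] by simp
  have bA: "b z \<in> A" if "singular_chain 1 X z" for z using chain_hom_closed[OF b that] by simp
  have cE: "c v \<in> carrier E" if "singular_chain 2 Y v" for v using cA[OF that] by simp
  have bE: "b z \<in> carrier E" if "singular_chain 1 X z" for z using bA[OF that] by simp

  \<comment> \<open>The pull-back of \<open>c\<close> is the coboundary of \<open>b\<close>: as
    \<open>\<Psi>\<close> has no defect, the defect of the pulled-back \<open>\<Phi>\<close> comes
    entirely from the central factors \<open>bf\<close>.\<close>
  have b_bnd: "b (chain_boundary 2 v) = c (chain_map 2 f v)" if v: "singular_chain 2 X v" for v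
  proof -
    have "(b \<circ> chain_boundary 2) v = (c \<circ> chain_map 2 f) v"
    proof (rule chain_hom_eqI[OF Cg _ _ _ v])
      show "b \<circ> chain_boundary 2 \<in> hom (chain_group 2 X) centre_group"
        using chain_boundary_2_hom b by (rule Group.hom_compose)
      show "c \<circ> chain_map 2 f \<in> hom (chain_group 2 X) centre_group"
        using chain_map_hom[OF f] c by (rule Group.hom_compose)
      fix w assume w: "singular_simplex 2 X w"
      let ?d = "\<lambda>k. singular_face 2 k w"
      have d: "singular_simplex 1 X (?d k)" if "k \<le> 2" for k using singular_simplex_face2[OF w that] .
      have fw: "singular_simplex 2 Y (simplex_map 2 f w)" using singular_simplex_simplex_map[OF w f] .
      have fd: "singular_face 2 k (simplex_map 2 f w) = simplex_map 1 f (?d k)" if "k \<le> 2" for k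
        using singular_face_simplex_map[of 2 k f w] that simplical_face_in_standard_simplex[of 2 k]
        by (auto simp: singular_face_def simplex_map_def fun_eq_iff restrict_def)
      have bfA: "bf (?d k) \<in> A" if "k \<le> 2" for k using \<Phi>\<Psi>[OF d[OF that]] by (simp add: bf_def)
      have \<Phi>f: "\<Phi> (simplex_map 1 f (?d k)) = bf (?d k) \<otimes> \<Psi> (?d k)" if "k \<le> 2" for k
        using that \<Psi>c[OF d] \<Phi>c[OF singular_simplex_simplex_map[OF d f]] by (simp add: bf_def m_assoc)
      have \<Psi>1: "\<Psi> (?d 2) \<otimes> \<Psi> (?d 0) \<otimes> inv \<Psi> (?d 1) = \<one>"
        using \<Psi> w by (simp add: cocycle_mod_def)
      have "c (chain_map 2 f (frag_of w)) =
          (bf (?d 2) \<otimes> \<Psi> (?d 2)) \<otimes> (bf (?d 0) \<otimes> \<Psi> (?d 0)) \<otimes> inv (bf (?d 1) \<otimes> \<Psi> (?d 1))"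
        using cof[OF fw] by (simp add: cf_def fd \<Phi>f flip: One_nat_def)
      also have "\<dots> = (bf (?d 2) \<otimes> bf (?d 0) \<otimes> inv bf (?d 1)) \<otimes> (\<Psi> (?d 2) \<otimes> \<Psi> (?d 0) \<otimes> inv \<Psi> (?d 1))"
        using bfA \<Psi>c d by (simp add: shuffle shuffle_inv)
      also have "\<dots> = bf (?d 2) \<otimes> bf (?d 0) \<otimes> inv bf (?d 1)"
        unfolding \<Psi>1 using bfA by simp
      also have "\<dots> = bf (?d 0) \<otimes> inv bf (?d 1) \<otimes> bf (?d 2)"
        using bfA[of 0] bfA[of 1] bfA[of 2] central[of "bf (?d 2)" "bf (?d 0) \<otimes> inv bf (?d 1)"]
        by (simp add: m_assoc)
      also have "\<dots> = b (chain_boundary 2 (frag_of w))"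
      proof -
        have "b (frag_of (?d 0) - frag_of (?d 1) + frag_of (?d 2)) =
            b (frag_of (?d 0) - frag_of (?d 1)) \<otimes> b (frag_of (?d 2))"
          using chain_hom_add[OF b, of "frag_of (?d 0) - frag_of (?d 1)" "frag_of (?d 2)"] d
          by (simp add: singular_chain_of singular_chain_diff)
        also have "b (frag_of (?d 0) - frag_of (?d 1)) = b (frag_of (?d 0)) \<otimes> inv b (frag_of (?d 1))"
          using chain_hom_diff[OF Cg b, of "frag_of (?d 0)" "frag_of (?d 1)"] d bA[of "frag_of (?d 1)"]
          by (simp add: singular_chain_of inv_centre)
        finally show ?thesis
          using d by (simp add: chain_boundary_2_of bof)
      qed
      finally show "(b \<circ> chain_boundary 2) (frag_of w) = (c \<circ> chain_map 2 f) (frag_of w)"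
        by simp
    qed
    then show ?thesis by simp
  qed

  have c_bnd: "c (chain_boundary 3 v) = \<one>" if v: "singular_chain 3 Y v" for v
  proof -
    have "(c \<circ> chain_boundary 3) v = (\<lambda>_. \<one>\<^bsub>centre_group\<^esub>) v"
    proof (rule chain_hom_eqI[OF Cg _ _ _ v])
      show "c \<circ> chain_boundary 3 \<in> hom (chain_group 3 Y) centre_group"
        using chain_boundary_3_hom c by (rule Group.hom_compose)
      show "(\<lambda>_. \<one>\<^bsub>centre_group\<^esub>) \<in> hom (chain_group 3 Y) centre_group"
        by (rule trivial_hom[OF Cg])
      fix t assume t: "singular_simplex 3 Y t"
      let ?d = "\<lambda>k. singular_face 3 k t" and ?e = "\<lambda>i j. singular_face 2 i (singular_face 3 j t)"
      have d: "singular_simplex 2 Y (?d k)" if "k \<le> 3" for k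
        using singular_simplex_singular_face[OF t _ that] by simp
      define g where "g i j = \<Phi> (?e i j)" for i j
      have g: "g i j \<in> carrier E" if "i \<le> 2" "j \<le> 3" for i j
        unfolding g_def by (intro \<Phi>c singular_simplex_face2 d that)
      \<comment> \<open>\<open>g i j\<close> is the label of edge \<open>i\<close> of face
        \<open>j\<close>. The twelve labels belong to six edges, each shared by two faces, in the
        order 01, 12, 02, 23, 13, 03.\<close>
      have id: "g 2 3 = g 2 2" "g 0 3 = g 2 0" "g 1 3 = g 2 1" "g 0 1 = g 0 0" "g 0 2 = g 1 0" "g 1 2 = g 1 1"
        using singular_face_face[of 2 3 t] singular_face_face[of 0 3 t] singular_face_face[of 1 3 t]
          singular_face_face[of 0 1 t] singular_face_face[of 0 2 t] singular_face_face[of 1 2 t]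
        by (simp_all add: g_def)
      have cd: "cf (?d k) \<otimes> g 1 k = g 2 k \<otimes> g 0 k" if "k \<le> 3" for k
        using g that by (simp add: cf_def m_assoc flip: g_def)
      have cA': "cf (?d k) \<in> A" if "k \<le> 3" for k using cfA[OF d[OF that]] .
      have cE': "cf (?d k) \<in> carrier E" if "k \<le> 3" for k using cA'[OF that] by simp
      note G = g[of 0 0] g[of 0 1] g[of 0 2] g[of 0 3] g[of 1 0] g[of 1 1] g[of 1 2] g[of 1 3]
         g[of 2 0] g[of 2 1] g[of 2 2] g[of 2 3] cE'[of 0] cE'[of 1] cE'[of 2] cE'[of 3]
      \<comment> \<open>The product of the labels of 01, 12, 23 is reduced to that of 03 in two
        ways: across faces 3 and 1, or across faces 0 and 2. In the second way the defect of face 0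
        has to pass the label of 01, and here centrality enters.\<close>
      have "(cf (?d 3) \<otimes> cf (?d 1)) \<otimes> g 1 1 = cf (?d 3) \<otimes> (g 2 1 \<otimes> g 0 1)"
        using G cd[of 1] by (simp add: m_assoc)
      also have "\<dots> = (cf (?d 3) \<otimes> g 1 3) \<otimes> g 0 1"
        using G id by (simp add: m_assoc)
      also have "\<dots> = g 2 3 \<otimes> (g 0 3 \<otimes> g 0 1)"
        using G cd[of 3] by (simp add: m_assoc)
      also have "g 0 3 \<otimes> g 0 1 = cf (?d 0) \<otimes> g 1 0"
        using id cd[of 0] by simp
      also have "g 2 3 \<otimes> (cf (?d 0) \<otimes> g 1 0) = (g 2 3 \<otimes> cf (?d 0)) \<otimes> g 1 0"
        using G by (simp add: m_assoc)
      also have "g 2 3 \<otimes> cf (?d 0) = cf (?d 0) \<otimes> g 2 3"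
        using G cA'[of 0] by (intro central[symmetric]) auto
      also have "(cf (?d 0) \<otimes> g 2 3) \<otimes> g 1 0 = cf (?d 0) \<otimes> (g 2 2 \<otimes> g 0 2)"
        using G id by (simp add: m_assoc)
      also have "\<dots> = (cf (?d 0) \<otimes> cf (?d 2)) \<otimes> g 1 1"
        using G id cd[of 2] by (simp add: m_assoc)
      finally have key: "cf (?d 3) \<otimes> cf (?d 1) = cf (?d 0) \<otimes> cf (?d 2)"
        using G by simp
      have fr: "singular_chain 2 Y (frag_of (?d k))" if "k \<le> 3" for k using d[OF that] by (simp add: singular_chain_of)
      have ad: "chain_boundary 3 (frag_of t) + (frag_of (?d 3) + frag_of (?d 1)) = frag_of (?d 0) + frag_of (?d 2)"
        by (simp add: chain_boundary_3_of)
      have ch: "singular_chain 2 Y (chain_boundary 3 (frag_of t))"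
        using chain_boundary_3_hom[of Y] t by (auto simp: hom_def singular_chain_of)
      have "c (chain_boundary 3 (frag_of t)) \<otimes> (cf (?d 3) \<otimes> cf (?d 1)) = cf (?d 0) \<otimes> cf (?d 2)"
      proof -
        have "c (chain_boundary 3 (frag_of t)) \<otimes> (c (frag_of (?d 3)) \<otimes> c (frag_of (?d 1))) =
            c (chain_boundary 3 (frag_of t) + (frag_of (?d 3) + frag_of (?d 1)))"
          using chain_hom_add[OF c ch singular_chain_add[OF fr[of 3] fr[of 1]]] chain_hom_add[OF c fr[of 3] fr[of 1]]
          by simp
        also have "\<dots> = c (frag_of (?d 0)) \<otimes> c (frag_of (?d 2))"
          unfolding ad using chain_hom_add[OF c fr[of 0] fr[of 2]] by simp
        finally show ?thesis
          using cof[OF d[of 0]] cof[OF d[of 1]] cof[OF d[of 2]] cof[OF d[of 3]] by simp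
      qed
      then have "c (chain_boundary 3 (frag_of t)) = \<one>"
        using key G cE[OF ch] by simp
      then show "(c \<circ> chain_boundary 3) (frag_of t) = \<one>\<^bsub>centre_group\<^esub>"
        by simp
    qed
    then show ?thesis by simp
  qed

  \<comment> \<open>As \<open>f\<close> is onto in degree 1, every 1-cycle of \<open>Y\<close> is of the form \<open>f z + \<partial>v\<close>, and the new cochain must take
    the value \<open>b z \<otimes> c v\<close> on it. Well-definedness uses the other two hypotheses on homology.\<close>
  have key: "b z \<otimes> c v = \<one>"
    if z: "singular_relcycle 1 X {} z" and v: "singular_chain 2 Y v"
      and zero: "chain_map 1 f z + chain_boundary 2 v = 0" for z v
  proof -
    have zc: "singular_chain 1 X z" "chain_boundary 1 z = 0" using z by (auto simp: singular_cycle)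
    have "chain_map 1 f z = chain_boundary 2 (- v)"
      using zero by (simp add: chain_boundary_minus eq_neg_iff_add_eq_0)
    then have "singular_relboundary 1 Y {} (chain_map 1 f z)"
      unfolding singular_boundary using v by (auto simp: singular_chain_minus numeral_2_eq_2 intro!: exI[of _ "- v"])
    then obtain u where u: "singular_chain 2 X u" "chain_boundary 2 u = z"
      using inj1 z unfolding homology_injective_def singular_boundary by (auto simp: numeral_2_eq_2)
    \<comment> \<open>As \<open>u\<close> has boundary \<open>z\<close>, the chain \<open>?y\<close>
      is a 2-cycle of \<open>Y\<close>. Surjectivity in degree 2 replaces it, up to a boundary, by
      the image of a cycle \<open>x\<close> of \<open>X\<close>; on that image \<open>c\<close>
      takes the value of \<open>b\<close> on the boundary of \<open>x\<close>, which is
      zero.\<close>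
    let ?y = "chain_map 2 f u + v"
    have fu: "singular_chain 2 Y (chain_map 2 f u)" using singular_chain_chain_map[OF u(1) f] .
    have y: "singular_chain 2 Y ?y" by (intro singular_chain_add fu v)
    have "chain_boundary 2 (chain_map 2 f u) = chain_map 1 f z"
      using chain_boundary_map[of 1 X u f] u by (simp add: numeral_2_eq_2)
    then have "chain_boundary 2 ?y = 0"
      using zero by (simp add: chain_boundary_add)
    then have "singular_relcycle 2 Y {} ?y" using y by (simp add: singular_cycle)
    then obtain x where x: "singular_relcycle 2 X {} x" "singular_relboundary 2 Y {} (?y - chain_map 2 f x)"
      using surj2 unfolding homology_surjective_def by blast
    have xc: "singular_chain 2 X x" "chain_boundary 2 x = 0" using x(1) by (auto simp: singular_cycle)
    obtain t where t: "singular_chain 3 Y t" "chain_boundary 3 t = ?y - chain_map 2 f x"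
      using x(2) unfolding singular_boundary by (auto simp: numeral_3_eq_3 numeral_2_eq_2)
    have fx: "singular_chain 2 Y (chain_map 2 f x)" using singular_chain_chain_map[OF xc(1) f] .
    have "c (chain_map 2 f x) = \<one>"
      using b_bnd[OF xc(1)] xc(2) chain_hom_zero[OF Cg b] by simp
    moreover have "c (?y - chain_map 2 f x) = \<one>"
      using c_bnd[OF t(1)] t(2) by simp
    moreover have "c ?y = c (?y - chain_map 2 f x) \<otimes> c (chain_map 2 f x)"
      using chain_hom_add[OF c, of "?y - chain_map 2 f x" "chain_map 2 f x"] y fx by (simp add: singular_chain_diff)
    ultimately have "c ?y = \<one>" by simp
    moreover have "c ?y = c (chain_map 2 f u) \<otimes> c v"
      using chain_hom_add[OF c fu v] by simp
    ultimately show ?thesis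
      using b_bnd[OF u(1)] u(2) by simp
  qed

  define rep where "rep \<zeta> z v \<longleftrightarrow> singular_relcycle 1 X {} z \<and> singular_chain 2 Y v \<and> \<zeta> = chain_map 1 f z + chain_boundary 2 v" for \<zeta> z v
  have rep_ex: "\<exists>z v. rep \<zeta> z v" if cyc: "singular_relcycle 1 Y {} \<zeta>" for \<zeta>
  proof -
    obtain z where "singular_relcycle 1 X {} z" "singular_relboundary 1 Y {} (\<zeta> - chain_map 1 f z)"
      using surj1 cyc unfolding homology_surjective_def by blast
    moreover then obtain v where "singular_chain 2 Y v" "chain_boundary 2 v = \<zeta> - chain_map 1 f z"
      unfolding singular_boundary by (auto simp: numeral_2_eq_2)
    ultimately have "rep \<zeta> z v" by (simp add: rep_def)
    then show ?thesis by blast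
  qed
  have repD: "singular_chain 1 X z" "singular_chain 2 Y v" if "rep \<zeta> z v" for \<zeta> z v
    using that by (auto simp: rep_def singular_cycle)
  have rep_diff: "rep (\<zeta> - \<zeta>') (z - z') (v - v')" if "rep \<zeta> z v" "rep \<zeta>' z' v'" for \<zeta> z v \<zeta>' z' v'
    using that by (auto simp: rep_def singular_chain_diff chain_map_diff chain_boundary_diff intro: singular_relcycle_diff)
  have rep_add: "rep (\<zeta> + \<zeta>') (z + z') (v + v')" if "rep \<zeta> z v" "rep \<zeta>' z' v'" for \<zeta> z v \<zeta>' z' v'
    using that by (auto simp: rep_def singular_chain_add chain_map_add chain_boundary_add intro: singular_relcycle_add)
  define \<beta> where "\<beta> \<zeta> = (SOME a. \<exists>z v. rep \<zeta> z v \<and> a = b z \<otimes> c v)" for \<zeta>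
  \<comment> \<open>Two representations of one cycle differ by a representation of 0, to which
    \<open>key\<close> applies.\<close>
  have uniq: "b z \<otimes> c v = b z' \<otimes> c v'" if r: "rep \<zeta> z v" "rep \<zeta> z' v'" for \<zeta> z v z' v'
  proof -
    note rr = repD[OF r(1)] repD[OF r(2)]
    have "rep 0 (z - z') (v - v')" using rep_diff[OF r] by simp
    then have "b (z - z') \<otimes> c (v - v') = \<one>" by (intro key) (auto simp: rep_def)
    moreover have "b z = b (z - z') \<otimes> b z'" "c v = c (v - v') \<otimes> c v'"
      using chain_hom_add[OF b, of "z - z'" z'] chain_hom_add[OF c, of "v - v'" v'] rr by (simp_all add: singular_chain_diff)
    ultimately show ?thesis
      using rr shuffle[of "b (z - z')" "c (v - v')" "b z'" "c v'"] bA cA bE cE by (simp add: singular_chain_diff)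
  qed
  have \<beta>: "\<beta> \<zeta> = b z \<otimes> c v" if r: "rep \<zeta> z v" for \<zeta> z v
  proof -
    have "\<exists>z v. rep \<zeta> z v \<and> \<beta> \<zeta> = b z \<otimes> c v"
      unfolding \<beta>_def by (rule someI_ex) (use r in blast)
    then obtain z' v' where "rep \<zeta> z' v'" "\<beta> \<zeta> = b z' \<otimes> c v'" by blast
    then show ?thesis using uniq[OF r] by simp
  qed
  have \<beta>A: "\<beta> \<zeta> \<in> A" if cyc: "singular_relcycle 1 Y {} \<zeta>" for \<zeta>
  proof -
    obtain z v where r: "rep \<zeta> z v" using rep_ex[OF cyc] by blast
    show ?thesis unfolding \<beta>[OF r] by (intro m_closed bA cA repD[OF r])
  qed
  have \<beta>_add: "\<beta> (\<zeta> + \<zeta>') = \<beta> \<zeta> \<otimes> \<beta> \<zeta>'" if cyc: "singular_relcycle 1 Y {} \<zeta>" "singular_relcycle 1 Y {} \<zeta>'" for \<zeta> \<zeta>'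
  proof -
    obtain z v z' v' where r: "rep \<zeta> z v" "rep \<zeta>' z' v'" using rep_ex cyc by meson
    note rr = repD[OF r(1)] repD[OF r(2)]
    have "\<beta> (\<zeta> + \<zeta>') = (b z \<otimes> b z') \<otimes> (c v \<otimes> c v')"
      using \<beta>[OF rep_add[OF r]] chain_hom_add[OF b rr(1) rr(3)] chain_hom_add[OF c rr(2) rr(4)] by simp
    also have "\<dots> = (b z \<otimes> c v) \<otimes> (b z' \<otimes> c v')"
      using shuffle[of "b z" "b z'" "c v" "c v'"] rr bA cA bE cE by simp
    finally show ?thesis using \<beta> r by simp
  qed
  have \<beta>_bnd: "\<beta> (chain_boundary 2 v) = c v" if "singular_chain 2 Y v" for v
    using \<beta>[of _ 0 v] that chain_hom_zero[OF Cg b] cE[OF that] by (simp add: rep_def)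
  have \<beta>_map: "\<beta> (chain_map 1 f z) = b z" if "singular_relcycle 1 X {} z" for z
    using \<beta>[of _ z 0] that chain_hom_zero[OF Cg c] bE[of z] by (simp add: rep_def singular_cycle)

  \<comment> \<open>Dividing by the value on the closed-up simplex removes the defect: by
    \<open>closed_up_boundary\<close>, the coboundary of this correction is
    \<open>c\<close>.\<close>
  define \<Phi>' where "\<Phi>' s = inv (\<beta> (closed_up Y s)) \<otimes> \<Phi> s" for s
  have \<beta>s: "\<beta> (closed_up Y s) \<in> A" if "singular_simplex 1 Y s" for s
    using \<beta>A closed_up_cycle that by blast
  show thesis
  proof
    show "cocycle Y E \<Phi>'"
      unfolding cocycle_iff
    proof (intro conjI allI impI)
      show "\<Phi>' s \<in> carrier E" if "singular_simplex 1 Y s" for s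
        using that \<beta>s \<Phi>c by (simp add: \<Phi>'_def)
      fix w assume w: "singular_simplex 2 Y w"
      let ?d = "\<lambda>k. singular_face 2 k w"
      define B where "B k = \<beta> (closed_up Y (?d k))" for k
      have d: "singular_simplex 1 Y (?d k)" if "k \<le> 2" for k using singular_simplex_face2[OF w that] .
      have BA: "B k \<in> A" if "k \<le> 2" for k using \<beta>s[OF d[OF that]] by (simp add: B_def)
      have wch: "singular_chain 2 Y (frag_of w)" using w by (simp add: singular_chain_of)
      have wcyc: "singular_relcycle 1 Y {} (chain_boundary 2 (frag_of w))"
        by (rule singular_cycle_boundary_2[OF wch])
      have dcyc: "singular_relcycle 1 Y {} (closed_up Y (?d k))" if "k \<le> 2" for k
        by (rule closed_up_cycle[OF d[OF that]])
      have "B 2 \<otimes> B 0 = \<beta> (closed_up Y (?d 2) + closed_up Y (?d 0))"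
        unfolding B_def using \<beta>_add[OF dcyc[of 2] dcyc[of 0]] by simp
      also have "\<dots> = c (frag_of w) \<otimes> B 1"
        unfolding closed_up_boundary B_def using \<beta>_add[OF wcyc dcyc[of 1]] \<beta>_bnd[OF wch] by simp
      finally have B: "B 2 \<otimes> B 0 = cf w \<otimes> B 1" using cof[OF w] by simp
      have cd: "\<Phi> (?d 2) \<otimes> \<Phi> (?d 0) = cf w \<otimes> \<Phi> (?d 1)"
        using \<Phi>c d by (simp add: cf_def m_assoc)
      have "\<Phi>' (?d 2) \<otimes> \<Phi>' (?d 0) = (inv B 2 \<otimes> inv B 0) \<otimes> (\<Phi> (?d 2) \<otimes> \<Phi> (?d 0))"
        using BA[of 2] BA[of 0] \<Phi>c d by (simp add: \<Phi>'_def shuffle flip: B_def)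
      also have "inv B 2 \<otimes> inv B 0 = inv (B 2 \<otimes> B 0)"
        using BA[of 2] BA[of 0] by (simp add: shuffle_inv)
      also have "inv (B 2 \<otimes> B 0) \<otimes> (\<Phi> (?d 2) \<otimes> \<Phi> (?d 0)) = (inv cf w \<otimes> inv B 1) \<otimes> (cf w \<otimes> \<Phi> (?d 1))"
        using BA[of 1] cfA[OF w] by (simp add: B cd shuffle_inv)
      also have "\<dots> = (inv B 1 \<otimes> inv cf w) \<otimes> (cf w \<otimes> \<Phi> (?d 1))"
        using BA[of 1] cfA[OF w] by (simp add: central)
      also have "\<dots> = inv B 1 \<otimes> \<Phi> (?d 1)"
        using BA[of 1] cfA[OF w] \<Phi>c d by (simp add: m_assoc inv_solve_left')
      finally show "\<Phi>' (?d 2) \<otimes> \<Phi>' (?d 0) = \<Phi>' (?d 1)"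
        by (simp add: \<Phi>'_def B_def)
    qed
    show "\<Phi>' s \<otimes> inv (\<Phi> s) \<in> A" if "singular_simplex 1 Y s" for s
      using that \<beta>s[OF that] \<Phi>c[OF that] by (simp add: \<Phi>'_def m_assoc)
    fix p assume p: "pathin X p" "p 0 = p 1"
    let ?s = "simplex_of_path p"
    have s: "singular_simplex 1 X ?s" using singular_simplex_of_path[OF p(1)] .
    have fs: "simplex_of_path (f \<circ> p) = simplex_map 1 f ?s" by (rule simplex_map_of_path[symmetric])
    have fsY: "singular_simplex 1 Y (simplex_map 1 f ?s)" using singular_simplex_simplex_map[OF s f] .
    have cyc: "singular_relcycle 1 X {} (frag_of ?s)"
      using s p(2) chain_boundary_path[of p] by (simp add: singular_cycle singular_chain_of)
    \<comment> \<open>For a loop the two tree chains cancel, so the correction is the value of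
      \<open>b\<close> on the loop, which is exactly its discrepancy with \<open>\<Psi>\<close>. For
      other simplices the tree chains of \<open>Y\<close> would intervene.\<close>
    have "path_of_simplex (simplex_map 1 f ?s) 0 = path_of_simplex (simplex_map 1 f ?s) 1"
      using p(2) by (simp add: path_of_simplex_map path_of_simplex_of_path flip: One_nat_def)
    then have "closed_up Y (simplex_map 1 f ?s) = chain_map 1 f (frag_of ?s)"
      by (simp add: closed_up_def)
    then have "\<beta> (closed_up Y (simplex_map 1 f ?s)) = bf ?s"
      using \<beta>_map[OF cyc] bof[OF s] by simp
    then have "\<Phi>' (simplex_map 1 f ?s) = inv (\<Phi> (simplex_map 1 f ?s) \<otimes> inv \<Psi> ?s) \<otimes> \<Phi> (simplex_map 1 f ?s)"
      by (simp add: \<Phi>'_def bf_def)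
    also have "\<dots> = \<Psi> ?s"
      using \<Phi>c[OF fsY] \<Psi>c[OF s] by (simp add: inv_mult_group m_assoc)
    finally show "\<Phi>' (simplex_of_path (f \<circ> p)) = \<Psi> ?s"
      by (simp add: fs)
  qed
qed

end

section \<open>The lower central series\<close>

context group
begin

lemma commutator_closed: "a \<in> carrier G \<Longrightarrow> b \<in> carrier G \<Longrightarrow> commutator G a b \<in> carrier G"
  by (simp add: commutator_def)

lemma conj_commutator:
  assumes "a \<in> carrier G" "b \<in> carrier G" "g \<in> carrier G"
  shows "g \<otimes> commutator G a b \<otimes> inv g = commutator G (g \<otimes> a \<otimes> inv g) (g \<otimes> b \<otimes> inv g)"
proof -
  have c: "inv g \<otimes> (g \<otimes> x) = x" if "x \<in> carrier G" for x
    using assms that by (simp flip: m_assoc)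
  show ?thesis
    using assms by (simp add: commutator_def inv_mult_group m_assoc c)
qed

text \<open>Conjugation takes commutators to commutators, and by induction it keeps their second
  entry in the preceding term; hence the generating set itself is closed under conjugation.\<close>

lemma lower_central_normal: "lower_central G k \<lhd> G"
proof (induction k rule: induct_nat_012)
  case (ge2 k)
  let ?S = "{commutator G a b | a b. a \<in> carrier G \<and> b \<in> lower_central G (Suc k)}"
  interpret N: normal "lower_central G (Suc k)" G by (rule ge2)
  have "generate G ?S \<lhd> G"
  proof (rule normal_generateI)
    show "?S \<subseteq> carrier G" using commutator_closed N.mem_carrier by auto
    fix h g assume "h \<in> ?S" and g: "g \<in> carrier G"
    then obtain a b where h: "h = commutator G a b" "a \<in> carrier G" "b \<in> lower_central G (Suc k)" by auto
    have "g \<otimes> b \<otimes> inv g \<in> lower_central G (Suc k)" using N.inv_op_closed2 g h by auto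
    moreover have "g \<otimes> h \<otimes> inv g = commutator G (g \<otimes> a \<otimes> inv g) (g \<otimes> b \<otimes> inv g)"
      using conj_commutator[of a b g] N.mem_carrier h g by auto
    ultimately show "g \<otimes> h \<otimes> inv g \<in> ?S" using g h by blast
  qed
  then show ?case by simp
qed (auto intro: normal_invI subgroup_self)

lemma lower_central_subgroup: "subgroup (lower_central G k) G"
  by (rule normal_imp_subgroup[OF lower_central_normal])

lemma commutator_in_lower_central:
  assumes "a \<in> carrier G" "b \<in> lower_central G k" "k \<ge> 1"
  shows "commutator G a b \<in> lower_central G (Suc k)"
proof -
  obtain j where "k = Suc j" using assms(3) by (cases k) auto
  with assms show ?thesis by (auto intro: generate.incl)
qed

text \<open>For \<open>b\<close> in a normal subgroup, the commutator of \<open>a\<close> and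
  \<open>b\<close> is a conjugate of \<open>b\<close> times the inverse of \<open>b\<close>.\<close>

lemma lower_central_Suc_subset:
  assumes "k \<ge> 1"
  shows "lower_central G (Suc k) \<subseteq> lower_central G k"
proof -
  obtain j where k: "k = Suc j" using assms by (cases k) auto
  interpret N: normal "lower_central G k" G by (rule lower_central_normal)
  have "{commutator G a b | a b. a \<in> carrier G \<and> b \<in> lower_central G k} \<subseteq> lower_central G k"
    unfolding commutator_def using N.inv_op_closed2 by auto
  then have "generate G {commutator G a b | a b. a \<in> carrier G \<and> b \<in> lower_central G k} \<subseteq> lower_central G k"
    by (rule generate_subgroup_incl[OF _ N.subgroup_axioms])
  then show ?thesis by (simp add: k)
qed

text \<open>The quotient is handed over as an abstract surjection with known kernel, so that later
  computations take place among group elements and not among cosets.\<close>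

lemma normal_quotient_exists:
  assumes "N \<lhd> G"
  obtains E :: "'a set monoid" and \<pi>
  where "group_hom G E \<pi>" "\<pi> ` carrier G = carrier E" "\<And>x. x \<in> carrier G \<Longrightarrow> \<pi> x = \<one>\<^bsub>E\<^esub> \<longleftrightarrow> x \<in> N"
proof
  interpret normal N G by fact
  show "group_hom G (G Mod N) (\<lambda>x. N #> x)"
    using r_coset_hom_Mod factorgroup_is_group group_axioms by (simp add: group_hom_def group_hom_axioms_def)
  show "(\<lambda>x. N #> x) ` carrier G = carrier (G Mod N)" by (simp add: carrier_FactGroup)
  show "N #> x = \<one>\<^bsub>G Mod N\<^esub> \<longleftrightarrow> x \<in> N" if "x \<in> carrier G" for x
  proof
    assume "N #> x = \<one>\<^bsub>G Mod N\<^esub>"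
    then show "x \<in> N" using coset_join1[OF _ that subgroup_axioms] by simp
  next
    assume "x \<in> N"
    then show "N #> x = \<one>\<^bsub>G Mod N\<^esub>" using coset_join2[OF that subgroup_axioms] by simp
  qed
qed

end

lemma (in group_hom) hom_commutator:
  "a \<in> carrier G \<Longrightarrow> b \<in> carrier G \<Longrightarrow> h (commutator G a b) = commutator H (h a) (h b)"
  by (simp add: commutator_def)

lemma (in group_hom) hom_lower_central: "x \<in> lower_central G k \<Longrightarrow> h x \<in> lower_central H k"
proof (induction k arbitrary: x rule: induct_nat_012)
  case (ge2 k)
  let ?S = "\<lambda>G. {commutator G a b | a b. a \<in> carrier G \<and> b \<in> lower_central G (Suc k)}"
  have sub: "subgroup (lower_central H (Suc (Suc k))) H" by (rule H.lower_central_subgroup)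
  have S: "?S G \<subseteq> carrier G"
    using G.commutator_closed subgroup.mem_carrier[OF G.lower_central_subgroup] by auto
  have "x \<in> generate G (?S G)" using ge2 by simp
  then show ?case
  proof (induction rule: generate.induct)
    case one then show ?case using subgroup.one_closed[OF sub] by simp
  next
    have gen: "h y \<in> lower_central H (Suc (Suc k))" if y: "y \<in> ?S G" for y
    proof -
      obtain a b where "y = commutator G a b" "a \<in> carrier G" "b \<in> lower_central G (Suc k)" using y by auto
      then show ?thesis
        using ge2.IH(2)[of b] hom_commutator[of a b] H.commutator_in_lower_central[of "h a" "h b" "Suc k"]
          subgroup.mem_carrier[OF G.lower_central_subgroup] by auto
    qed
    { case (incl y) then show ?case by (rule gen) }
    { case (inv y)
      then have "y \<in> carrier G" using S by blast
      then show ?case using subgroup.m_inv_closed[OF sub gen[OF inv]] by simp }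
  next
    case (eng y z)
    then have "y \<in> carrier G" "z \<in> carrier G" using G.generate_in_carrier[OF S] by auto
    then show ?case using eng subgroup.m_closed[OF sub] by simp
  qed
qed auto

text \<open>Both entries of a generating commutator lift, the first by surjectivity and the second
  by induction, and the image of a subgroup is a subgroup.\<close>

lemma (in group_hom) lower_central_image:
  assumes surj: "h ` carrier G = carrier H"
  shows "lower_central H k \<subseteq> h ` lower_central G k"
proof (induction k rule: induct_nat_012)
  case (ge2 k)
  let ?S = "\<lambda>G. {commutator G a b | a b. a \<in> carrier G \<and> b \<in> lower_central G (Suc k)}"
  have "?S H \<subseteq> h ` lower_central G (Suc (Suc k))"
  proof
    fix y assume "y \<in> ?S H"
    then obtain a b where y: "y = commutator H a b" "a \<in> carrier H" "b \<in> lower_central H (Suc k)" by auto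
    then obtain a' b' where ab: "a' \<in> carrier G" "a = h a'" "b' \<in> lower_central G (Suc k)" "b = h b'"
      using ge2(2) surj by blast
    then have "y = h (commutator G a' b')"
      using y hom_commutator subgroup.mem_carrier[OF G.lower_central_subgroup] by metis
    then show "y \<in> h ` lower_central G (Suc (Suc k))"
      using G.commutator_in_lower_central[of a' b' "Suc k"] ab by auto
  qed
  then have "generate H (?S H) \<subseteq> h ` lower_central G (Suc (Suc k))"
    by (rule H.generate_subgroup_incl[OF _ subgroup_img_is_subgroup[OF G.lower_central_subgroup]])
  then show ?case by simp
qed (use surj in auto)

lemma (in group_hom) eq_iff_diff_kernel:
  assumes ker: "\<And>x. x \<in> carrier G \<Longrightarrow> h x = \<one>\<^bsub>H\<^esub> \<longleftrightarrow> x \<in> N" and "x \<in> carrier G" "y \<in> carrier G"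
  shows "h x = h y \<longleftrightarrow> x \<otimes> inv y \<in> N"
  using ker[of "x \<otimes> inv y"] assms H.eq_iff_mult_inv[of "h x" "h y"] by simp

text \<open>Commutators with elements of term \<open>q\<close> are among the generators of term
  \<open>Suc q\<close>, which \<open>h\<close> sends to the neutral element.\<close>

lemma (in group_hom) central_subgroup_image:
  assumes surj: "h ` carrier G = carrier H" and q: "q \<ge> 1"
    and ker: "\<And>x. x \<in> carrier G \<Longrightarrow> h x = \<one>\<^bsub>H\<^esub> \<longleftrightarrow> x \<in> lower_central G (Suc q)"
  shows "central_subgroup H (h ` lower_central G q)"
proof -
  have sub: "subgroup (h ` lower_central G q) H"
    by (rule subgroup_img_is_subgroup[OF G.lower_central_subgroup])
  moreover have "a \<otimes>\<^bsub>H\<^esub> x = x \<otimes>\<^bsub>H\<^esub> a" if a: "a \<in> h ` lower_central G q" and x: "x \<in> carrier H" for a x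
  proof -
    obtain a' where a': "a' \<in> lower_central G q" "a = h a'" using a by auto
    obtain x' where x': "x' \<in> carrier G" "x = h x'" using x surj by auto
    have c: "a' \<in> carrier G" using a' subgroup.mem_carrier[OF G.lower_central_subgroup] by blast
    have "commutator H x a = \<one>\<^bsub>H\<^esub>"
      using G.commutator_in_lower_central[OF x'(1) a'(1) q] ker[OF G.commutator_closed[OF x'(1) c]]
        hom_commutator[OF x'(1) c] a' x' by simp
    moreover have "commutator H x a = (x \<otimes>\<^bsub>H\<^esub> a) \<otimes>\<^bsub>H\<^esub> inv\<^bsub>H\<^esub> (a \<otimes>\<^bsub>H\<^esub> x)"
      using c a' x' by (simp add: commutator_def H.inv_mult_group H.m_assoc)
    ultimately have "(x \<otimes>\<^bsub>H\<^esub> a) \<otimes>\<^bsub>H\<^esub> inv\<^bsub>H\<^esub> (a \<otimes>\<^bsub>H\<^esub> x) = \<one>\<^bsub>H\<^esub>"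
      by metis
    moreover have "a \<in> carrier H" using a'(2) c by simp
    ultimately show ?thesis
      using H.eq_iff_mult_inv[of "x \<otimes>\<^bsub>H\<^esub> a" "a \<otimes>\<^bsub>H\<^esub> x"] x by (metis H.m_closed)
  qed
  ultimately show ?thesis
    using H.group_axioms unfolding central_subgroup_def central_subgroup_axioms_def by blast
qed

section \<open>Generation of a group modulo its lower central series\<close>

lemma (in group) subgroup_normal_mult:
  assumes N: "N \<lhd> G" and K: "subgroup K G"
  shows "subgroup {n \<otimes> k | n k. n \<in> N \<and> k \<in> K} G"
proof -
  interpret N: normal N G by fact
  interpret K: subgroup K G by fact
  show ?thesis
  proof (rule subgroupI)
    show "{n \<otimes> k | n k. n \<in> N \<and> k \<in> K} \<noteq> {}" using N.one_closed K.one_closed by blast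
  next
    fix x assume "x \<in> {n \<otimes> k | n k. n \<in> N \<and> k \<in> K}"
    then obtain n k where x: "x = n \<otimes> k" "n \<in> N" "k \<in> K" by auto
    then have "inv x = (inv k \<otimes> inv n \<otimes> inv (inv k)) \<otimes> inv k"
      by (simp add: inv_mult_group m_assoc)
    moreover have "inv k \<otimes> inv n \<otimes> inv (inv k) \<in> N"
      using x by (intro N.inv_op_closed2) auto
    ultimately show "inv x \<in> {n \<otimes> k | n k. n \<in> N \<and> k \<in> K}" using x by blast
  next
    fix x y assume "x \<in> {n \<otimes> k | n k. n \<in> N \<and> k \<in> K}" "y \<in> {n \<otimes> k | n k. n \<in> N \<and> k \<in> K}"
    then obtain n k n' k' where x: "x = n \<otimes> k" "n \<in> N" "k \<in> K" and y: "y = n' \<otimes> k'" "n' \<in> N" "k' \<in> K" by auto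
    have c: "inv k \<otimes> (k \<otimes> z) = z" if "z \<in> carrier G" for z
      using x that by (simp flip: m_assoc)
    have "x \<otimes> y = (n \<otimes> (k \<otimes> n' \<otimes> inv k)) \<otimes> (k \<otimes> k')"
      using x y by (simp add: m_assoc c)
    moreover have "n \<otimes> (k \<otimes> n' \<otimes> inv k) \<in> N"
      using x y by (intro N.m_closed N.inv_op_closed2) auto
    ultimately show "x \<otimes> y \<in> {n \<otimes> k | n k. n \<in> N \<and> k \<in> K}" using x y by blast
  qed auto
qed

text \<open>Modulo the next term, every element is the product of an element of \<open>K\<close> and a central one, so
  all commutators are commutators of elements of \<open>K\<close>.\<close>

lemma (in group) generates_modulo_lower_central:
  assumes K: "subgroup K G"
    and gen: "\<And>y. y \<in> carrier G \<Longrightarrow> \<exists>n\<in>lower_central G 2. \<exists>k\<in>K. y = n \<otimes> k"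
    and q: "q \<ge> 1" and y: "y \<in> carrier G"
  shows "\<exists>n\<in>lower_central G q. \<exists>k\<in>K. y = n \<otimes> k"
  using q y
proof (induction q arbitrary: y rule: dec_induct)
  case base
  then show ?case
    using subgroup.one_closed[OF K] by (intro bexI[of _ y] bexI[of _ \<one>]) auto
next
  case (step q)
  interpret K: subgroup K G by fact
  let ?L = "{n \<otimes> k | n k. n \<in> lower_central G (Suc q) \<and> k \<in> K}"
  have L: "subgroup ?L G" by (rule subgroup_normal_mult[OF lower_central_normal K])
  obtain E :: "'a set monoid" and \<pi> where E: "group_hom G E \<pi>" "\<pi> ` carrier G = carrier E"
    and ker: "\<And>x. x \<in> carrier G \<Longrightarrow> \<pi> x = \<one>\<^bsub>E\<^esub> \<longleftrightarrow> x \<in> lower_central G (Suc q)"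
    using normal_quotient_exists[OF lower_central_normal[of "Suc q"]] by blast
  interpret \<pi>: group_hom G E \<pi> by fact
  interpret C: central_subgroup E "\<pi> ` lower_central G q"
    by (rule \<pi>.central_subgroup_image[OF E(2) step(1) ker])
  have com: "commutator G a b \<in> ?L" if ab: "a \<in> carrier G" "b \<in> carrier G" for a b
  proof -
    obtain n k where a: "n \<in> lower_central G q" "k \<in> K" "a = n \<otimes> k" using step.IH[OF ab(1)] by blast
    obtain n' k' where b: "n' \<in> lower_central G q" "k' \<in> K" "b = n' \<otimes> k'" using step.IH[OF ab(2)] by blast
    have c: "n \<in> carrier G" "n' \<in> carrier G" "k \<in> carrier G" "k' \<in> carrier G"
      using a b subgroup.mem_carrier[OF lower_central_subgroup] by auto
    have A: "\<pi> n \<in> \<pi> ` lower_central G q" "\<pi> n' \<in> \<pi> ` lower_central G q" using a b by auto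
    have cE: "\<pi> n \<in> carrier E" "\<pi> n' \<in> carrier E" "\<pi> k \<in> carrier E" "\<pi> k' \<in> carrier E" using c by auto
    have nn: "\<pi> n \<otimes>\<^bsub>E\<^esub> \<pi> n' \<otimes>\<^bsub>E\<^esub> inv\<^bsub>E\<^esub> \<pi> n \<otimes>\<^bsub>E\<^esub> inv\<^bsub>E\<^esub> \<pi> n' = \<one>\<^bsub>E\<^esub>"
      using C.central[OF A(1) cE(2)] cE by (simp add: \<pi>.H.m_assoc)
    have "\<pi> (commutator G a b) =
       (\<pi> n \<otimes>\<^bsub>E\<^esub> \<pi> k) \<otimes>\<^bsub>E\<^esub> (\<pi> n' \<otimes>\<^bsub>E\<^esub> \<pi> k') \<otimes>\<^bsub>E\<^esub> (inv\<^bsub>E\<^esub> \<pi> n \<otimes>\<^bsub>E\<^esub> inv\<^bsub>E\<^esub> \<pi> k) \<otimes>\<^bsub>E\<^esub> (inv\<^bsub>E\<^esub> \<pi> n' \<otimes>\<^bsub>E\<^esub> inv\<^bsub>E\<^esub> \<pi> k')"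
      using a b c ab A by (simp add: \<pi>.hom_commutator commutator_def C.shuffle_inv)
    also have "\<dots> = (\<pi> n \<otimes>\<^bsub>E\<^esub> \<pi> n' \<otimes>\<^bsub>E\<^esub> inv\<^bsub>E\<^esub> \<pi> n \<otimes>\<^bsub>E\<^esub> inv\<^bsub>E\<^esub> \<pi> n') \<otimes>\<^bsub>E\<^esub>
       (\<pi> k \<otimes>\<^bsub>E\<^esub> \<pi> k' \<otimes>\<^bsub>E\<^esub> inv\<^bsub>E\<^esub> \<pi> k \<otimes>\<^bsub>E\<^esub> inv\<^bsub>E\<^esub> \<pi> k')"
    proof -
      have iA: "inv\<^bsub>E\<^esub> \<pi> n \<in> \<pi> ` lower_central G q" "inv\<^bsub>E\<^esub> \<pi> n' \<in> \<pi> ` lower_central G q"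
        using A C.inv_closed_centre by auto
      note mA = subgroup.m_closed[OF C.subgroup_axioms]
      note mE = \<pi>.H.m_closed and iE = \<pi>.H.inv_closed
      show ?thesis
        by (simp only: C.shuffle[OF A cE(3,4)] C.shuffle[OF mA[OF A] iA(1) mE[OF cE(3,4)] iE[OF cE(3)]]
            C.shuffle[OF mA[OF mA[OF A] iA(1)] iA(2) mE[OF mE[OF cE(3,4)] iE[OF cE(3)]] iE[OF cE(4)]])
    qed
    also have "\<dots> = \<pi> (commutator G k k')"
      unfolding nn using c by (simp add: \<pi>.hom_commutator commutator_def)
    finally have "commutator G a b \<otimes> inv (commutator G k k') \<in> lower_central G (Suc q)"
      using \<pi>.eq_iff_diff_kernel[OF ker commutator_closed[OF ab] commutator_closed[OF c(3,4)]] by simp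
    moreover have "commutator G a b = (commutator G a b \<otimes> inv (commutator G k k')) \<otimes> commutator G k k'"
      using commutator_closed[OF ab] commutator_closed[OF c(3,4)] by (simp add: m_assoc)
    moreover have "commutator G k k' \<in> K" using a b by (simp add: commutator_def)
    ultimately show ?thesis by blast
  qed
  have "generate G {commutator G a b | a b. a \<in> carrier G \<and> b \<in> carrier G} \<subseteq> ?L"
    using com by (intro generate_subgroup_incl[OF _ L]) auto
  then have L2: "lower_central G 2 \<subseteq> ?L" by (simp add: numeral_2_eq_2)
  have "K \<subseteq> ?L"
  proof
    fix k assume k: "k \<in> K"
    then have "k = \<one> \<otimes> k" by simp
    then show "k \<in> ?L" using k subgroup.one_closed[OF lower_central_subgroup[of "Suc q"]] by blast
  qed
  then have KL: "K \<subseteq> ?L" .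
  \<comment> \<open>The hypothesis splits \<open>y\<close> into a factor from
    \<open>lower_central G 2\<close>, all of whose generators have just been placed in
    \<open>?L\<close>, and a factor from \<open>K\<close>.\<close>
  obtain n k where nk: "n \<in> lower_central G 2" "k \<in> K" "y = n \<otimes> k"
    using gen[OF step.prems] by auto
  have "y \<in> ?L"
    unfolding nk(3) by (rule subgroup.m_closed[OF L subsetD[OF L2 nk(1)] subsetD[OF KL nk(2)]])
  then show ?case by blast
qed

section \<open>Stallings' theorem\<close>

locale path_connected_map =
  fixes X :: "'a topology" and Y :: "'b topology" and f a
  assumes path_connected: "path_connected_space X"
    and continuous: "continuous_map X Y f"
    and base_in: "a \<in> topspace X"
begin

lemma component: "x \<in> topspace X \<Longrightarrow> path_component_of X a x"
  using path_connected base_in unfolding path_connected_space_def path_component_of_def by blast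

abbreviation "link_image x \<equiv> simplex_of_path (f \<circ> link_path X a x)"

lemma link_image: "x \<in> topspace X \<Longrightarrow> singular_simplex 1 Y (link_image x)"
  using link_path(1)[OF component] pathin_compose[OF _ continuous] singular_simplex_of_path by blast

text \<open>A cocycle on \<open>Y\<close> takes values on the image of \<open>s\<close> and on the
  image of the loop closing up \<open>s\<close>; the two differ by the values on the link paths.
  This is the gauge change that relates data on loops to data on all simplices.\<close>

lemma cocycle_link_image:
  assumes E: "group E" and \<Phi>: "cocycle Y E \<Phi>" and s: "singular_simplex 1 X s"
  defines "x \<equiv> path_of_simplex s 0" and "y \<equiv> path_of_simplex s 1"
  obtains p where "pathin X p" "p 0 = a" "p 1 = a" "simplex_loop X a s = path_class X p"
    "\<Phi> (simplex_of_path (f \<circ> p)) = \<Phi> (link_image x) \<otimes>\<^bsub>E\<^esub> \<Phi> (simplex_map 1 f s) \<otimes>\<^bsub>E\<^esub> inv\<^bsub>E\<^esub> \<Phi> (link_image y)"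
proof
  interpret group E by fact
  have sp: "pathin X (path_of_simplex s)" using s by (rule pathin_path_of_simplex)
  have xy: "x \<in> topspace X" "y \<in> topspace X"
    unfolding x_def y_def using path_start_in_topspace[OF sp] path_finish_in_topspace[OF sp] by auto
  note lx = link_path[OF component[OF xy(1)]] and ly = link_path[OF component[OF xy(2)]]
  let ?r = "rev_path (link_path X a y)"
  let ?p = "link_path X a x \<cdot>\<cdot> path_of_simplex s \<cdot>\<cdot> ?r"
  have sr: "pathin X (path_of_simplex s \<cdot>\<cdot> ?r)"
    using ly sp by (intro pathin_join_path pathin_rev_path) (auto simp: y_def)
  show "pathin X ?p" using lx sr by (intro pathin_join_path[OF lx(1) sr]) (simp add: x_def)
  show "?p 0 = a" "?p 1 = a" using lx ly by auto
  show "simplex_loop X a s = path_class X ?p"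
    using component[OF xy(1)] by (simp add: simplex_loop_def x_def y_def)
  let ?\<phi> = "\<lambda>p. \<Phi> (simplex_of_path (f \<circ> p))"
  have cl: "?\<phi> q \<in> carrier E" if "pathin X q" for q
    using that by (intro cocycle_mod_closed[OF \<Phi>] singular_simplex_of_path pathin_compose[OF _ continuous])
  have join: "?\<phi> (q \<cdot>\<cdot> q') = ?\<phi> q \<otimes>\<^bsub>E\<^esub> ?\<phi> q'" if "pathin X q" "pathin X q'" "q 1 = q' 0" for q q'
    unfolding compose_join_path using that
    by (intro cocycle_join[OF \<Phi>] pathin_compose[OF _ continuous]) auto
  have "?\<phi> (link_path X a y) \<otimes>\<^bsub>E\<^esub> ?\<phi> ?r = ?\<phi> (link_path X a y \<cdot>\<cdot> ?r)"
    using ly by (intro join[symmetric] pathin_rev_path) auto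
  also have "\<dots> = ?\<phi> (\<lambda>_. a)"
    using path_homotopic_compose[OF path_homotopic_rev_right[OF ly(1)] continuous] ly
    by (intro cocycle_homotopic[OF \<Phi>]) auto
  also have "\<dots> = \<one>\<^bsub>E\<^esub>"
    using cocycle_const[OF \<Phi>, of "f a"] base_in continuous by (simp add: o_def continuous_map_def Pi_iff)
  finally have "?\<phi> ?r = inv\<^bsub>E\<^esub> ?\<phi> (link_path X a y)"
    using cl[OF ly(1)] cl[OF pathin_rev_path[OF ly(1)]] by (metis inv_equality inv_inv inv_closed)
  moreover have "simplex_map 1 f s = simplex_of_path (f \<circ> path_of_simplex s)"
    using simplex_map_of_path[of f "path_of_simplex s"] simplex_of_path_of_simplex[OF s] by simp
  moreover have "?\<phi> ?p = ?\<phi> (link_path X a x) \<otimes>\<^bsub>E\<^esub> (?\<phi> (path_of_simplex s) \<otimes>\<^bsub>E\<^esub> ?\<phi> ?r)"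
    using join[OF lx(1) sr] join[OF sp pathin_rev_path[OF ly(1)]] lx ly by (simp add: x_def y_def)
  ultimately show "?\<phi> ?p = \<Phi> (link_image x) \<otimes>\<^bsub>E\<^esub> \<Phi> (simplex_map 1 f s) \<otimes>\<^bsub>E\<^esub> inv\<^bsub>E\<^esub> \<Phi> (link_image y)"
    using cl[OF lx(1)] cl[OF ly(1)] cl[OF sp] by (simp add: m_assoc)
qed

text \<open>The values are kept in \<open>pi1 X a\<close> itself and only the conditions are read
  modulo term \<open>q\<close>, so the type of \<open>\<Phi>\<close> does not vary with
  \<open>q\<close> and induction applies. The map sends \<open>Y\<close> back to the nilpotent
  quotient of \<open>X\<close> and is inverse to \<open>f\<close> on loops.\<close>

lemma stallings_cocycle:
  assumes inj1: "homology_injective 1 X Y f"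
    and surj1: "homology_surjective 1 X Y f"
    and surj2: "homology_surjective 2 X Y f"
    and q: "q \<ge> 1"
  shows "\<exists>\<Phi>. cocycle_mod Y (pi1 X a) (lower_central (pi1 X a) q) \<Phi> \<and>
     (\<forall>p. pathin X p \<longrightarrow> p 0 = a \<longrightarrow> p 1 = a \<longrightarrow>
        \<Phi> (simplex_of_path (f \<circ> p)) \<otimes>\<^bsub>pi1 X a\<^esub> inv\<^bsub>pi1 X a\<^esub> path_class X p \<in> lower_central (pi1 X a) q)"
  using q
proof (induction q rule: dec_induct)
  case base
  interpret G: group "pi1 X a" using base_in by (rule group_pi1)
  \<comment> \<open>Term 1 is the whole group, so any map into the group satisfies the
    conditions.\<close>
  show ?case
    by (intro exI[of _ "\<lambda>_. \<one>\<^bsub>pi1 X a\<^esub>"]) (simp_all add: cocycle_mod_def pi1_carrierI)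
next
  case (step q)
  let ?G = "pi1 X a"
  interpret G: group ?G using base_in by (rule group_pi1)
  let ?M = "lower_central ?G q" and ?N = "lower_central ?G (Suc q)"
  have NM: "?N \<subseteq> ?M" using G.lower_central_Suc_subset[OF step(1)] .
  obtain \<Phi> where \<Phi>: "cocycle_mod Y ?G ?M \<Phi>"
    and \<Phi>p: "\<And>p. pathin X p \<Longrightarrow> p 0 = a \<Longrightarrow> p 1 = a \<Longrightarrow> \<Phi> (simplex_of_path (f \<circ> p)) \<otimes>\<^bsub>?G\<^esub> inv\<^bsub>?G\<^esub> path_class X p \<in> ?M"
    using step.IH by blast
  \<comment> \<open>\<open>Q\<close> is the quotient by the current term and \<open>E\<close> the
    quotient by the next one; \<open>?A\<close> below is the central kernel of the passage from
    \<open>E\<close> to \<open>Q\<close>.\<close>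
  obtain Q :: "(real \<Rightarrow> 'a) set set monoid" and \<rho> where Q: "group_hom ?G Q \<rho>" "\<rho> ` carrier ?G = carrier Q"
    and kerQ: "\<And>x. x \<in> carrier ?G \<Longrightarrow> \<rho> x = \<one>\<^bsub>Q\<^esub> \<longleftrightarrow> x \<in> ?M"
    using G.normal_quotient_exists[OF G.lower_central_normal[of q]] by blast
  obtain E :: "(real \<Rightarrow> 'a) set set monoid" and \<pi> where E: "group_hom ?G E \<pi>" "\<pi> ` carrier ?G = carrier E"
    and ker: "\<And>x. x \<in> carrier ?G \<Longrightarrow> \<pi> x = \<one>\<^bsub>E\<^esub> \<longleftrightarrow> x \<in> ?N"
    using G.normal_quotient_exists[OF G.lower_central_normal[of "Suc q"]] by blast
  interpret \<rho>: group_hom ?G Q \<rho> by fact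
  interpret \<pi>: group_hom ?G E \<pi> by fact
  let ?A = "\<pi> ` ?M"
  interpret C: central_subgroup E ?A by (rule \<pi>.central_subgroup_image[OF E(2) step(1) ker])
  have Mc: "x \<in> carrier ?G" if "x \<in> ?M" for x using that subgroup.mem_carrier[OF G.lower_central_subgroup] by blast
  have in_A: "\<pi> x \<in> ?A" if "x \<in> carrier ?G" "\<rho> x = \<one>\<^bsub>Q\<^esub>" for x using that kerQ by auto
  have \<Phi>c: "\<Phi> s \<in> carrier ?G" if "singular_simplex 1 Y s" for s by (rule cocycle_mod_closed[OF \<Phi> that])
  have fc: "singular_simplex 1 X s \<Longrightarrow> singular_simplex 1 Y (simplex_map 1 f s)" for s
    using singular_simplex_simplex_map continuous by blast
  have P: "cocycle X ?G (simplex_loop X a)" by (rule cocycle_simplex_loop[OF base_in])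
  have Pc: "simplex_loop X a s \<in> carrier ?G" if "singular_simplex 1 X s" for s by (rule cocycle_mod_closed[OF P that])
  have d2: "singular_simplex 1 Z (singular_face 2 0 w)" "singular_simplex 1 Z (singular_face 2 1 w)" "singular_simplex 1 Z (singular_face 2 2 w)"
    if "singular_simplex 2 Z w" for Z :: "'b topology" and w
    using singular_simplex_face2[OF that] by auto
  have \<Phi>Q: "cocycle Y Q (\<rho> \<circ> \<Phi>)"
    using \<Phi> \<Phi>c d2 kerQ by (auto simp: cocycle_mod_def simp flip: \<rho>.hom_mult \<rho>.hom_inv)
  have \<Phi>E: "cocycle_mod Y E ?A (\<pi> \<circ> \<Phi>)"
    using \<Phi> \<Phi>c d2 by (auto simp: cocycle_mod_def simp flip: \<pi>.hom_mult \<pi>.hom_inv)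
  define h where "h x = \<Phi> (link_image x)" for x
  have hc: "h x \<in> carrier ?G" if "x \<in> topspace X" for x unfolding h_def using \<Phi>c link_image that by blast
  have ends: "path_of_simplex s 0 \<in> topspace X" "path_of_simplex s 1 \<in> topspace X" if "singular_simplex 1 X s" for s
    using pathin_path_of_simplex[OF that] path_start_in_topspace path_finish_in_topspace by auto
  \<comment> \<open>Modulo \<open>?M\<close>, the induction hypothesis turns the value of
    \<open>\<Phi>\<close> on the image of a loop into the class of the loop. Applied to the loop
    closing up \<open>s\<close>, it expresses the tautological cocycle through \<open>\<Phi>\<close>
    and \<open>h\<close>.\<close>
  have compare: "\<rho> (simplex_loop X a s) =
      \<rho> (h (path_of_simplex s 0)) \<otimes>\<^bsub>Q\<^esub> \<rho> (\<Phi> (simplex_map 1 f s)) \<otimes>\<^bsub>Q\<^esub> inv\<^bsub>Q\<^esub> \<rho> (h (path_of_simplex s 1))"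
    if s: "singular_simplex 1 X s" for s
  proof -
    obtain p where p: "pathin X p" "p 0 = a" "p 1 = a" "simplex_loop X a s = path_class X p"
      and eq: "(\<rho> \<circ> \<Phi>) (simplex_of_path (f \<circ> p)) = (\<rho> \<circ> \<Phi>) (link_image (path_of_simplex s 0)) \<otimes>\<^bsub>Q\<^esub>
         (\<rho> \<circ> \<Phi>) (simplex_map 1 f s) \<otimes>\<^bsub>Q\<^esub> inv\<^bsub>Q\<^esub> (\<rho> \<circ> \<Phi>) (link_image (path_of_simplex s 1))"
      using cocycle_link_image[OF \<rho>.H.is_group \<Phi>Q s] by metis
    have "\<rho> (\<Phi> (simplex_of_path (f \<circ> p))) = \<rho> (path_class X p)"
      using \<rho>.eq_iff_diff_kernel[OF kerQ \<Phi>c pi1_carrierI] p \<Phi>p singular_simplex_of_path[OF pathin_compose[OF p(1) continuous]]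
      by blast
    with eq p(4) show ?thesis by (simp add: h_def)
  qed
  \<comment> \<open>By induction \<open>\<Phi> \<circ> f\<close> agrees with the tautological cocycle on loops only; the change of gauge \<open>h\<close> makes
    the two agree on all simplices modulo \<open>?M\<close>.\<close>
  define \<Psi> where "\<Psi> s = inv\<^bsub>E\<^esub> \<pi> (h (path_of_simplex s 0)) \<otimes>\<^bsub>E\<^esub> \<pi> (simplex_loop X a s) \<otimes>\<^bsub>E\<^esub> \<pi> (h (path_of_simplex s 1))" for s
  have \<Psi>: "cocycle X E \<Psi>"
    unfolding \<pi>.H.cocycle_iff
  proof (intro conjI allI impI)
    show "\<Psi> s \<in> carrier E" if "singular_simplex 1 X s" for s
      unfolding \<Psi>_def using that ends[OF that] hc Pc by simp
    fix w assume w: "singular_simplex 2 X w"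
    let ?d = "\<lambda>k. singular_face 2 k w"
    have s: "singular_simplex 1 X (?d 0)" "singular_simplex 1 X (?d 1)" "singular_simplex 1 X (?d 2)"
      using singular_simplex_face2[OF w] by auto
    have eq: "\<pi> (simplex_loop X a (?d 2)) \<otimes>\<^bsub>E\<^esub> \<pi> (simplex_loop X a (?d 0)) = \<pi> (simplex_loop X a (?d 1))"
      using G.cocycle_eq[OF P w] Pc s by (simp flip: \<pi>.hom_mult)
    define u0 where "u0 = \<pi> (h (path_of_simplex (?d 1) 0))"
    define u1 where "u1 = \<pi> (h (path_of_simplex (?d 0) 0))"
    define u2 where "u2 = \<pi> (h (path_of_simplex (?d 1) 1))"
    have u: "u0 \<in> carrier E" "u1 \<in> carrier E" "u2 \<in> carrier E"
      unfolding u0_def u1_def u2_def using ends s hc by auto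
    define v0 where "v0 = \<pi> (simplex_loop X a (?d 0))"
    define v1 where "v1 = \<pi> (simplex_loop X a (?d 1))"
    define v2 where "v2 = \<pi> (simplex_loop X a (?d 2))"
    have v: "v0 \<in> carrier E" "v1 \<in> carrier E" "v2 \<in> carrier E" unfolding v0_def v1_def v2_def using s Pc by auto
    have c: "u1 \<otimes>\<^bsub>E\<^esub> (inv\<^bsub>E\<^esub> u1 \<otimes>\<^bsub>E\<^esub> z) = z" if "z \<in> carrier E" for z
      using u that by (simp flip: \<pi>.H.m_assoc)
    have "\<Psi> (?d 2) \<otimes>\<^bsub>E\<^esub> \<Psi> (?d 0) = (inv\<^bsub>E\<^esub> u0 \<otimes>\<^bsub>E\<^esub> v2 \<otimes>\<^bsub>E\<^esub> u1) \<otimes>\<^bsub>E\<^esub> (inv\<^bsub>E\<^esub> u1 \<otimes>\<^bsub>E\<^esub> v0 \<otimes>\<^bsub>E\<^esub> u2)"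
      unfolding \<Psi>_def u0_def u1_def u2_def v0_def v2_def path_of_face_ends ..
    also have "\<dots> = inv\<^bsub>E\<^esub> u0 \<otimes>\<^bsub>E\<^esub> (v2 \<otimes>\<^bsub>E\<^esub> v0) \<otimes>\<^bsub>E\<^esub> u2"
      using u v by (simp add: \<pi>.H.m_assoc c)
    also have "\<dots> = \<Psi> (?d 1)"
      using eq by (simp add: \<Psi>_def u0_def u2_def v0_def v2_def)
    finally show "\<Psi> (?d 2) \<otimes>\<^bsub>E\<^esub> \<Psi> (?d 0) = \<Psi> (?d 1)" .
  qed
  have \<Phi>\<Psi>: "(\<pi> \<circ> \<Phi>) (simplex_map 1 f s) \<otimes>\<^bsub>E\<^esub> inv\<^bsub>E\<^esub> \<Psi> s \<in> ?A" if s: "singular_simplex 1 X s" for s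
  proof -
    define x where "x = \<Phi> (simplex_map 1 f s)"
    define u where "u = h (path_of_simplex s 0)"
    define v where "v = h (path_of_simplex s 1)"
    define P where "P = simplex_loop X a s"
    have c: "x \<in> carrier ?G" "u \<in> carrier ?G" "v \<in> carrier ?G" "P \<in> carrier ?G"
      unfolding x_def u_def v_def P_def using s ends[OF s] hc \<Phi>c fc Pc by auto
    let ?y = "x \<otimes>\<^bsub>?G\<^esub> inv\<^bsub>?G\<^esub> (inv\<^bsub>?G\<^esub> u \<otimes>\<^bsub>?G\<^esub> P \<otimes>\<^bsub>?G\<^esub> v)"
    have i: "inv\<^bsub>Q\<^esub> \<rho> u \<otimes>\<^bsub>Q\<^esub> (\<rho> u \<otimes>\<^bsub>Q\<^esub> z) = z" if "z \<in> carrier Q" for z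
      using c that by (simp flip: \<rho>.H.m_assoc)
    have "\<rho> P = \<rho> u \<otimes>\<^bsub>Q\<^esub> \<rho> x \<otimes>\<^bsub>Q\<^esub> inv\<^bsub>Q\<^esub> \<rho> v"
      using compare[OF s] by (simp add: x_def u_def v_def P_def)
    then have "inv\<^bsub>Q\<^esub> \<rho> u \<otimes>\<^bsub>Q\<^esub> \<rho> P \<otimes>\<^bsub>Q\<^esub> \<rho> v = \<rho> x"
      using c by (simp add: \<rho>.H.m_assoc i)
    then have "\<rho> ?y = \<one>\<^bsub>Q\<^esub>" using c by simp
    then have "\<pi> ?y \<in> ?A" using c by (intro in_A) auto
    moreover have "\<pi> ?y = (\<pi> \<circ> \<Phi>) (simplex_map 1 f s) \<otimes>\<^bsub>E\<^esub> inv\<^bsub>E\<^esub> \<Psi> s"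
      using c by (simp add: \<Psi>_def x_def u_def v_def P_def)
    ultimately show ?thesis by simp
  qed
  obtain \<Phi>' where \<Phi>': "cocycle Y E \<Phi>'"
    and \<Phi>'p: "\<And>p. pathin X p \<Longrightarrow> p 0 = p 1 \<Longrightarrow> \<Phi>' (simplex_of_path (f \<circ> p)) = \<Psi> (simplex_of_path p)"
    using C.lift_cocycle[OF continuous inj1 surj1 surj2 \<Phi>E \<Psi> \<Phi>\<Psi>] by metis
  \<comment> \<open>The lifted cocycle lives in \<open>E\<close>; choosing preimages brings it back
    to \<open>?G\<close>, where the cocycle law then holds modulo \<open>?N\<close>.\<close>
  define \<Phi>n where "\<Phi>n s = (SOME x. x \<in> carrier ?G \<and> \<pi> x = \<Phi>' s)" for s
  have \<Phi>n: "\<Phi>n s \<in> carrier ?G" "\<pi> (\<Phi>n s) = \<Phi>' s" if "singular_simplex 1 Y s" for s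
  proof -
    have "\<exists>x. x \<in> carrier ?G \<and> \<pi> x = \<Phi>' s"
      using cocycle_mod_closed[OF \<Phi>' that] E(2) by (metis imageE)
    from someI_ex[OF this] show "\<Phi>n s \<in> carrier ?G" "\<pi> (\<Phi>n s) = \<Phi>' s" by (auto simp: \<Phi>n_def)
  qed
  have "cocycle_mod Y ?G ?N \<Phi>n"
    unfolding cocycle_mod_def
  proof (intro conjI allI impI)
    show "\<Phi>n s \<in> carrier ?G" if "singular_simplex 1 Y s" for s using \<Phi>n(1)[OF that] .
    fix w assume w: "singular_simplex 2 Y w"
    let ?t = "\<Phi>n (singular_face 2 2 w) \<otimes>\<^bsub>?G\<^esub> \<Phi>n (singular_face 2 0 w) \<otimes>\<^bsub>?G\<^esub> inv\<^bsub>?G\<^esub> \<Phi>n (singular_face 2 1 w)"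
    have t: "?t \<in> carrier ?G" using \<Phi>n(1) d2[OF w] by simp
    have "\<pi> ?t = \<one>\<^bsub>E\<^esub>"
      using \<Phi>' w \<Phi>n d2[OF w] by (simp add: cocycle_mod_def)
    with ker[OF t] show "?t \<in> ?N" by blast
  qed
  moreover have "\<Phi>n (simplex_of_path (f \<circ> p)) \<otimes>\<^bsub>?G\<^esub> inv\<^bsub>?G\<^esub> path_class X p \<in> ?N"
    if p: "pathin X p" "p 0 = a" "p 1 = a" for p
  proof -
    have s: "singular_simplex 1 X (simplex_of_path p)" by (rule singular_simplex_of_path[OF p(1)])
    have fs: "singular_simplex 1 Y (simplex_of_path (f \<circ> p))"
      by (rule singular_simplex_of_path[OF pathin_compose[OF p(1) continuous]])
    have pc: "path_class X p \<in> carrier ?G" using p by (rule pi1_carrierI)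
    \<comment> \<open>On a loop at \<open>a\<close> the gauge change conjugates by
      \<open>h a\<close>. The link from \<open>a\<close> to itself is constant, so
      \<open>h a\<close> is trivial modulo \<open>?M\<close>, hence central in \<open>E\<close>, and
      the conjugation has no effect.\<close>
    have ha: "\<pi> (h a) \<in> ?A"
    proof (rule in_A)
      show "h a \<in> carrier ?G" using hc base_in .
      have "link_path X a a = (\<lambda>_. a)" by (simp add: link_path_def)
      then show "\<rho> (h a) = \<one>\<^bsub>Q\<^esub>"
        using \<rho>.H.cocycle_const[OF \<Phi>Q, of "f a"] base_in continuous
        by (simp add: h_def o_def continuous_map_def Pi_iff)
    qed
    have "\<pi> (\<Phi>n (simplex_of_path (f \<circ> p))) = \<Psi> (simplex_of_path p)"
      using \<Phi>'p[of p] p \<Phi>n[OF fs] by simp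
    also have "\<dots> = inv\<^bsub>E\<^esub> \<pi> (h a) \<otimes>\<^bsub>E\<^esub> \<pi> (path_class X p) \<otimes>\<^bsub>E\<^esub> \<pi> (h a)"
      using p by (simp add: \<Psi>_def simplex_loop_of_loop path_of_simplex_of_path)
    also have "\<dots> = inv\<^bsub>E\<^esub> \<pi> (h a) \<otimes>\<^bsub>E\<^esub> (\<pi> (h a) \<otimes>\<^bsub>E\<^esub> \<pi> (path_class X p))"
      using C.central[OF ha \<pi>.hom_closed[OF pc]] hc[OF base_in] pc by (simp add: \<pi>.H.m_assoc)
    also have "\<dots> = \<pi> (path_class X p)"
      using hc[OF base_in] pc by (simp flip: \<pi>.H.m_assoc)
    finally show ?thesis
      using \<pi>.eq_iff_diff_kernel[OF ker \<Phi>n(1)[OF fs] pc] by simp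
  qed
  ultimately show ?case by blast
qed

text \<open>The map of \<open>stallings_cocycle\<close> becomes a homomorphism from
  \<open>pi1 Y (f a)\<close> to the quotient \<open>Q\<close> of \<open>pi1 X a\<close>, and its
  composite with \<open>pi1_map Y f\<close> is the projection. It respects lower central series, and
  term \<open>q\<close> of \<open>Q\<close> is trivial.\<close>

theorem stallings_injective:
  assumes "homology_injective 1 X Y f" "homology_surjective 1 X Y f" "homology_surjective 2 X Y f"
    and q: "q \<ge> 1" and u: "u \<in> carrier (pi1 X a)"
    and fu: "pi1_map Y f u \<in> lower_central (pi1 Y (f a)) q"
  shows "u \<in> lower_central (pi1 X a) q"
proof -
  let ?G = "pi1 X a" and ?H = "pi1 Y (f a)"
  let ?M = "lower_central ?G q"
  interpret G: group ?G using base_in by (rule group_pi1)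
  have "f a \<in> topspace Y" using base_in continuous by (simp add: continuous_map_def Pi_iff)
  then interpret H: group ?H by (rule group_pi1)
  obtain \<Phi> where \<Phi>: "cocycle_mod Y ?G ?M \<Phi>"
    and \<Phi>p: "\<And>p. pathin X p \<Longrightarrow> p 0 = a \<Longrightarrow> p 1 = a \<Longrightarrow> \<Phi> (simplex_of_path (f \<circ> p)) \<otimes>\<^bsub>?G\<^esub> inv\<^bsub>?G\<^esub> path_class X p \<in> ?M"
    using stallings_cocycle[OF assms(1-4)] by blast
  obtain Q :: "(real \<Rightarrow> 'a) set set monoid" and \<rho> where Q: "group_hom ?G Q \<rho>" "\<rho> ` carrier ?G = carrier Q"
    and ker: "\<And>x. x \<in> carrier ?G \<Longrightarrow> \<rho> x = \<one>\<^bsub>Q\<^esub> \<longleftrightarrow> x \<in> ?M"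
    using G.normal_quotient_exists[OF G.lower_central_normal[of q]] by blast
  interpret \<rho>: group_hom ?G Q \<rho> by fact
  have \<Phi>c: "\<Phi> s \<in> carrier ?G" if "singular_simplex 1 Y s" for s by (rule cocycle_mod_closed[OF \<Phi> that])
  have d2: "singular_simplex 1 Y (singular_face 2 0 w)" "singular_simplex 1 Y (singular_face 2 1 w)" "singular_simplex 1 Y (singular_face 2 2 w)"
    if "singular_simplex 2 Y w" for w
    using singular_simplex_face2[OF that] by auto
  have \<Phi>Q: "cocycle Y Q (\<rho> \<circ> \<Phi>)"
    using \<Phi> \<Phi>c d2 ker by (auto simp: cocycle_mod_def simp flip: \<rho>.hom_mult \<rho>.hom_inv)
  obtain \<phi> where \<phi>: "\<phi> \<in> hom ?H Q"
    "\<And>p. pathin Y p \<Longrightarrow> p 0 = f a \<Longrightarrow> p 1 = f a \<Longrightarrow> \<phi> (path_class Y p) = (\<rho> \<circ> \<Phi>) (simplex_of_path p)"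
    using \<rho>.H.cocycle_imp_hom[OF \<Phi>Q] by blast
  interpret \<phi>: group_hom ?H Q \<phi>
    using \<phi>(1) by (simp add: group_hom_def group_hom_axioms_def H.group_axioms \<rho>.H.group_axioms)
  obtain p where p: "pathin X p" "p 0 = a" "p 1 = a" "u = path_class X p" using u by (rule pi1_carrierE)
  have fp: "pathin Y (f \<circ> p)" using p(1) continuous by (rule pathin_compose)
  have "\<phi> (pi1_map Y f u) = \<rho> (\<Phi> (simplex_of_path (f \<circ> p)))"
    using \<phi>(2)[OF fp] p by (simp add: pi1_map_class[OF p(1) continuous])
  also have "\<dots> = \<rho> u"
    using \<rho>.eq_iff_diff_kernel[OF ker \<Phi>c[OF singular_simplex_of_path[OF fp]] u] \<Phi>p[OF p(1-3)] p(4) by simp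
  finally have "\<rho> u \<in> lower_central Q q"
    using \<phi>.hom_lower_central[OF fu] by simp
  \<comment> \<open>By surjectivity of \<open>\<rho>\<close>, term \<open>q\<close> of
    \<open>Q\<close> consists of images of elements of \<open>?M\<close>, which are all
    trivial.\<close>
  then obtain m where "m \<in> ?M" "\<rho> u = \<rho> m"
    using \<rho>.lower_central_image[OF Q(2)] by blast
  then show ?thesis
    using ker[of m] ker[OF u] subgroup.mem_carrier[OF G.lower_central_subgroup] by metis
qed

text \<open>Homology is needed for \<open>q = 2\<close> only; the higher terms follow by group
  theory. The quotient \<open>A\<close> by the subgroup \<open>?L\<close> generated by term 2 and
  the image is Abelian, so the tautological cocycle becomes a homomorphism on 1-chains. It kills
  boundaries and images of 1-cycles, hence every 1-cycle of \<open>Y\<close>, and so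
  \<open>?L\<close> is the whole group.\<close>

theorem pi1_generates_modulo_lower_central:
  assumes surj1: "homology_surjective 1 X Y f" and q: "q \<ge> 1" and y: "y \<in> carrier (pi1 Y (f a))"
  shows "\<exists>n\<in>lower_central (pi1 Y (f a)) q. \<exists>u\<in>carrier (pi1 X a). y = n \<otimes>\<^bsub>pi1 Y (f a)\<^esub> pi1_map Y f u"
proof -
  let ?G = "pi1 X a" and ?H = "pi1 Y (f a)"
  interpret G: group ?G using base_in by (rule group_pi1)
  have fa: "f a \<in> topspace Y" using base_in continuous by (simp add: continuous_map_def Pi_iff)
  interpret H: group ?H using fa by (rule group_pi1)
  interpret F: group_hom ?G ?H "pi1_map Y f"
    using pi1_map_hom[OF continuous] by (simp add: group_hom_def group_hom_axioms_def H.group_axioms G.group_axioms)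
  let ?K = "pi1_map Y f ` carrier ?G"
  have K: "subgroup ?K ?H" using F.subgroup_img_is_subgroup[OF G.subgroup_self] .
  let ?N = "lower_central ?H 2"
  let ?L = "{n \<otimes>\<^bsub>?H\<^esub> k | n k. n \<in> ?N \<and> k \<in> ?K}"
  have L: "subgroup ?L ?H" by (rule H.subgroup_normal_mult[OF H.lower_central_normal K])
  have NL: "?N \<subseteq> ?L"
  proof
    fix n assume n: "n \<in> ?N"
    then have "n = n \<otimes>\<^bsub>?H\<^esub> \<one>\<^bsub>?H\<^esub>" using subgroup.mem_carrier[OF H.lower_central_subgroup] by simp
    then show "n \<in> ?L" using n subgroup.one_closed[OF K] by blast
  qed
  have KL: "?K \<subseteq> ?L"
  proof
    fix k assume k: "k \<in> ?K"
    then have "k = \<one>\<^bsub>?H\<^esub> \<otimes>\<^bsub>?H\<^esub> k" using subgroup.mem_carrier[OF K] by simp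
    then show "k \<in> ?L" using k subgroup.one_closed[OF H.lower_central_subgroup[of 2]] by blast
  qed
  have com: "commutator ?H x y \<in> ?L" if "x \<in> carrier ?H" "y \<in> carrier ?H" for x y
    using NL H.commutator_in_lower_central[of x y 1] that by (auto simp: numeral_2_eq_2)
  have nL: "?L \<lhd> ?H"
  proof (rule H.normal_invI[OF L])
    fix x l assume x: "x \<in> carrier ?H" and l: "l \<in> ?L"
    have lc: "l \<in> carrier ?H" using l subgroup.mem_carrier[OF L] by blast
    have "x \<otimes>\<^bsub>?H\<^esub> l \<otimes>\<^bsub>?H\<^esub> inv\<^bsub>?H\<^esub> x = commutator ?H x l \<otimes>\<^bsub>?H\<^esub> l"
      using x lc by (simp add: commutator_def H.m_assoc)
    then show "x \<otimes>\<^bsub>?H\<^esub> l \<otimes>\<^bsub>?H\<^esub> inv\<^bsub>?H\<^esub> x \<in> ?L"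
      using subgroup.m_closed[OF L com[OF x lc] l] by simp
  qed
  define L where "L = ?L"
  have nL': "L \<lhd> ?H" using nL by (simp only: L_def)
  obtain A :: "(real \<Rightarrow> 'b) set set monoid" and \<pi> where A: "group_hom ?H A \<pi>" "\<pi> ` carrier ?H = carrier A"
    and ker': "\<And>x. x \<in> carrier ?H \<Longrightarrow> \<pi> x = \<one>\<^bsub>A\<^esub> \<longleftrightarrow> x \<in> L"
    using H.normal_quotient_exists[OF nL'] by blast
  note ker = ker'[unfolded L_def]
  interpret \<pi>: group_hom ?H A \<pi> by fact
  have "comm_group A"
  proof (rule \<pi>.H.group_comm_groupI)
    fix x y assume "x \<in> carrier A" "y \<in> carrier A"
    then have "x \<in> \<pi> ` carrier ?H" "y \<in> \<pi> ` carrier ?H" by (simp_all only: A(2))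
    then obtain x' y' where xy: "x' \<in> carrier ?H" "y' \<in> carrier ?H" "x = \<pi> x'" "y = \<pi> y'" by (elim imageE) simp
    have "commutator A x y = \<one>\<^bsub>A\<^esub>"
      using ker[OF H.commutator_closed[OF xy(1,2)]] com[OF xy(1,2)] \<pi>.hom_commutator xy by simp
    moreover have "commutator A x y = (x \<otimes>\<^bsub>A\<^esub> y) \<otimes>\<^bsub>A\<^esub> inv\<^bsub>A\<^esub> (y \<otimes>\<^bsub>A\<^esub> x)"
      using xy by (simp add: commutator_def \<pi>.H.inv_mult_group \<pi>.H.m_assoc)
    ultimately have "(x \<otimes>\<^bsub>A\<^esub> y) \<otimes>\<^bsub>A\<^esub> inv\<^bsub>A\<^esub> (y \<otimes>\<^bsub>A\<^esub> x) = \<one>\<^bsub>A\<^esub>"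
      by metis
    moreover have "x \<in> carrier A" "y \<in> carrier A" using xy by auto
    ultimately show "x \<otimes>\<^bsub>A\<^esub> y = y \<otimes>\<^bsub>A\<^esub> x"
      using \<pi>.H.eq_iff_mult_inv[of "x \<otimes>\<^bsub>A\<^esub> y" "y \<otimes>\<^bsub>A\<^esub> x"] by (metis \<pi>.H.m_closed)
  qed
  then interpret A: comm_group A .
  define P where "P s = \<pi> (simplex_loop Y (f a) s)" for s
  have cl: "simplex_loop Y (f a) s \<in> carrier ?H" if "singular_simplex 1 Y s" for s
    by (rule cocycle_mod_closed[OF cocycle_simplex_loop[OF fa] that])
  have P: "cocycle Y A P"
    unfolding \<pi>.H.cocycle_iff
  proof (intro conjI allI impI)
    show "P s \<in> carrier A" if "singular_simplex 1 Y s" for s using cl[OF that] by (simp add: P_def)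
    fix w assume w: "singular_simplex 2 Y w"
    show "P (singular_face 2 2 w) \<otimes>\<^bsub>A\<^esub> P (singular_face 2 0 w) = P (singular_face 2 1 w)"
      using H.cocycle_eq[OF cocycle_simplex_loop[OF fa] w] cl singular_simplex_face2[OF w]
      by (simp add: P_def flip: \<pi>.hom_mult)
  qed
  have Pc: "P s \<in> carrier A" if "singular_simplex 1 Y s" for s by (rule cocycle_mod_closed[OF P that])
  obtain b where b: "b \<in> hom (chain_group 1 Y) A" and bof: "\<And>s. singular_simplex 1 Y s \<Longrightarrow> b (frag_of s) = P s"
    using chain_hom_exists[OF A.comm_group_axioms, of 1 Y P] Pc by blast
  have b_bnd: "b (chain_boundary 2 v) = \<one>\<^bsub>A\<^esub>" if v: "singular_chain 2 Y v" for v
  proof -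
    have "(b \<circ> chain_boundary 2) v = (\<lambda>_. \<one>\<^bsub>A\<^esub>) v"
    proof (rule chain_hom_eqI[OF \<pi>.H.is_group Group.hom_compose[OF chain_boundary_2_hom b] trivial_hom[OF \<pi>.H.is_group] _ v])
      fix w assume w: "singular_simplex 2 Y w"
      let ?d = "\<lambda>k. singular_face 2 k w"
      have d: "singular_simplex 1 Y (?d 0)" "singular_simplex 1 Y (?d 1)" "singular_simplex 1 Y (?d 2)"
        using singular_simplex_face2[OF w] by auto
      have "b (frag_of (?d 0) - frag_of (?d 1) + frag_of (?d 2)) = b (frag_of (?d 0) - frag_of (?d 1)) \<otimes>\<^bsub>A\<^esub> b (frag_of (?d 2))"
        using d by (intro chain_hom_add[OF b] singular_chain_diff) (auto simp: singular_chain_of)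
      also have "b (frag_of (?d 0) - frag_of (?d 1)) = b (frag_of (?d 0)) \<otimes>\<^bsub>A\<^esub> inv\<^bsub>A\<^esub> b (frag_of (?d 1))"
        using d by (intro chain_hom_diff[OF \<pi>.H.is_group b]) (auto simp: singular_chain_of)
      finally have "b (chain_boundary 2 (frag_of w)) = P (?d 0) \<otimes>\<^bsub>A\<^esub> inv\<^bsub>A\<^esub> P (?d 1) \<otimes>\<^bsub>A\<^esub> P (?d 2)"
        using d by (simp add: chain_boundary_2_of bof)
      also have "\<dots> = P (?d 2) \<otimes>\<^bsub>A\<^esub> P (?d 0) \<otimes>\<^bsub>A\<^esub> inv\<^bsub>A\<^esub> P (?d 1)"
        using Pc d by (simp add: A.m_ac)
      also have "\<dots> = \<one>\<^bsub>A\<^esub>" using \<pi>.H.cocycle_eq[OF P w] Pc d by simp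
      finally show "(b \<circ> chain_boundary 2) (frag_of w) = \<one>\<^bsub>A\<^esub>" by simp
    qed
    then show ?thesis by simp
  qed
  \<comment> \<open>\<open>?e\<close> is the only point of the standard 0-simplex, so
    \<open>t ?e\<close> is the vertex that the 0-simplex \<open>t\<close> represents.\<close>
  let ?e = "\<lambda>j::nat. if j = 0 then 1 else 0 :: real"
  define k where "k t = P (link_image (t ?e))" for t
  have "t ?e \<in> topspace X" if "singular_simplex 0 X t" for t
    using that basis_in_standard_simplex[of 0 0] by (auto simp: singular_simplex_def continuous_map_def)
  then have "k t \<in> carrier A" if "singular_simplex 0 X t" for t
    unfolding k_def using Pc link_image that by blast
  then obtain \<kappa> where \<kappa>: "\<kappa> \<in> hom (chain_group 0 X) A" and \<kappa>of: "\<And>t. singular_simplex 0 X t \<Longrightarrow> \<kappa> (frag_of t) = k t"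
    using chain_hom_exists[OF A.comm_group_axioms, of 0 X k] by blast
  \<comment> \<open>On \<open>X\<close> the cochain \<open>b\<close> pulls back to the coboundary of
    the vertex function \<open>k\<close>: classes of loops coming from \<open>X\<close> die in
    \<open>A\<close>, so the value on a simplex depends only on its ends. Therefore it vanishes on
    cycles.\<close>
  have b_map: "b (chain_map 1 f z) = \<kappa> (chain_boundary 1 z)" if z: "singular_chain 1 X z" for z
  proof -
    have bh: "chain_boundary 1 \<in> hom (chain_group 1 X) (chain_group 0 X)" using chain_boundary_hom[of 0 X] by simp
    have "(b \<circ> chain_map 1 f) z = (\<kappa> \<circ> chain_boundary 1) z"
    proof (rule chain_hom_eqI[OF \<pi>.H.is_group Group.hom_compose[OF chain_map_hom[OF continuous] b] Group.hom_compose[OF bh \<kappa>] _ z])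
      fix s assume s: "singular_simplex 1 X s"
      let ?x = "path_of_simplex s 0" and ?y = "path_of_simplex s 1"
      have xy: "?x \<in> topspace X" "?y \<in> topspace X"
        using pathin_path_of_simplex[OF s] path_start_in_topspace path_finish_in_topspace by auto
      have fs: "singular_simplex 1 Y (simplex_map 1 f s)" using singular_simplex_simplex_map[OF s continuous] .
      obtain p where p: "pathin X p" "p 0 = a" "p 1 = a"
        and eq: "P (simplex_of_path (f \<circ> p)) = P (link_image ?x) \<otimes>\<^bsub>A\<^esub> P (simplex_map 1 f s) \<otimes>\<^bsub>A\<^esub> inv\<^bsub>A\<^esub> P (link_image ?y)"
        using cocycle_link_image[OF \<pi>.H.is_group P s] by metis
      have pc: "path_class X p \<in> carrier ?G" using p by (rule pi1_carrierI)
      have "simplex_loop Y (f a) (simplex_of_path (f \<circ> p)) = pi1_map Y f (path_class X p)"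
        using p simplex_loop_of_loop[OF pathin_compose[OF p(1) continuous]] by (simp add: pi1_map_class[OF p(1) continuous])
      then have "P (simplex_of_path (f \<circ> p)) = \<one>\<^bsub>A\<^esub>"
        unfolding P_def using ker[OF F.hom_closed[OF pc]] KL pc by auto
      then have one: "P (link_image ?x) \<otimes>\<^bsub>A\<^esub> P (simplex_map 1 f s) = P (link_image ?y)"
        using eq \<pi>.H.eq_iff_mult_inv Pc link_image[OF xy(1)] link_image[OF xy(2)] fs by simp
      have v: "singular_simplex 0 X (vertex_simplex x)" "k (vertex_simplex x) = P (link_image x)" if "x \<in> topspace X" for x
        using that basis_in_standard_simplex[of 0 0] by (auto simp: singular_simplex_def vertex_simplex_def k_def)
      have "\<kappa> (chain_boundary 1 (frag_of s)) = P (link_image ?y) \<otimes>\<^bsub>A\<^esub> inv\<^bsub>A\<^esub> P (link_image ?x)"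
        unfolding chain_boundary_simplex
        using chain_hom_diff[OF \<pi>.H.is_group \<kappa>, of "frag_of (vertex_simplex ?y)" "frag_of (vertex_simplex ?x)"] v xy
        by (simp add: singular_chain_of \<kappa>of)
      also have "\<dots> = P (simplex_map 1 f s)"
        unfolding one[symmetric] using Pc link_image[OF xy(1)] fs by (simp add: A.m_ac)
      finally show "(b \<circ> chain_map 1 f) (frag_of s) = (\<kappa> \<circ> chain_boundary 1) (frag_of s)"
        using bof[OF fs] by simp
    qed
    then show ?thesis by simp
  qed
  have "\<exists>n\<in>?N. \<exists>u\<in>?K. x = n \<otimes>\<^bsub>?H\<^esub> u" if x: "x \<in> carrier ?H" for x
  proof -
    obtain p where p: "pathin Y p" "p 0 = f a" "p 1 = f a" "x = path_class Y p" using x by (rule pi1_carrierE)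
    let ?s = "simplex_of_path p"
    have s: "singular_simplex 1 Y ?s" using singular_simplex_of_path[OF p(1)] .
    have "singular_relcycle 1 Y {} (frag_of ?s)"
      using s p chain_boundary_path[of p] by (simp add: singular_cycle singular_chain_of)
    then obtain z v where z: "singular_relcycle 1 X {} z" and v: "singular_chain 2 Y v" "chain_boundary 2 v = frag_of ?s - chain_map 1 f z"
      using surj1 unfolding homology_surjective_def singular_boundary by (auto simp: numeral_2_eq_2)
    have zc: "singular_chain 1 X z" "chain_boundary 1 z = 0" using z by (auto simp: singular_cycle)
    have "b (frag_of ?s - chain_map 1 f z) = b (frag_of ?s) \<otimes>\<^bsub>A\<^esub> inv\<^bsub>A\<^esub> b (chain_map 1 f z)"
      using s zc continuous by (intro chain_hom_diff[OF \<pi>.H.is_group b]) (auto simp: singular_chain_of intro: singular_chain_chain_map)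
    moreover have "b (chain_map 1 f z) = \<one>\<^bsub>A\<^esub>"
      using b_map[OF zc(1)] zc(2) chain_hom_zero[OF \<pi>.H.is_group \<kappa>] by simp
    moreover have "b (frag_of ?s - chain_map 1 f z) = \<one>\<^bsub>A\<^esub>"
      using b_bnd[OF v(1)] v(2) by simp
    ultimately have "P ?s = \<one>\<^bsub>A\<^esub>" using bof[OF s] Pc[OF s] by simp
    then have "x \<in> ?L"
      using ker[OF x] simplex_loop_of_loop[OF p(1-3)] p(4) by (simp add: P_def)
    then show ?thesis by blast
  qed
  from H.generates_modulo_lower_central[OF K this q y] show ?thesis by blast
qed

end

section \<open>Connected manifolds are path connected\<close>

text \<open>Reflecting the negative half by taking the absolute value of coordinate 0 makes the half
  space a retract of Euclidean space.\<close>

lemma locally_path_connected_half_space: "locally_path_connected_space (half_space d)"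
proof -
  let ?r = "\<lambda>x::nat\<Rightarrow>real. \<lambda>i. if i = 0 then \<bar>x 0\<bar> else x i"
  have coord: "continuous_map (Euclidean_space d) euclideanreal (\<lambda>x. x i)" for i
    unfolding Euclidean_space_def
    by (rule continuous_map_from_subtopology[OF continuous_map_product_projection]) simp
  have "continuous_map (Euclidean_space d) euclideanreal (\<lambda>x. ?r x i)" for i
    using coord[of i] continuous_map_real_abs[OF coord[of 0]] by (cases "i = 0") auto
  then have "continuous_map (Euclidean_space d) (powertop_real UNIV) ?r"
    by (simp add: continuous_map_componentwise_UNIV)
  then have "continuous_map (Euclidean_space d) (Euclidean_space d) ?r"
    by (auto simp: Euclidean_space_def continuous_map_in_subtopology)
  then have "continuous_map (Euclidean_space d) (half_space d) ?r"
    by (auto simp: half_space_def continuous_map_in_subtopology)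
  moreover have "continuous_map (half_space d) (Euclidean_space d) (\<lambda>x. x)"
    unfolding half_space_def by (simp add: continuous_map_from_subtopology)
  moreover have "?r x = x" if "x \<in> topspace (half_space d)" for x
    using that by (auto simp: half_space_def fun_eq_iff)
  ultimately have "retraction_map (Euclidean_space d) (half_space d) ?r"
    unfolding retraction_map_def retraction_maps_def by blast
  then show ?thesis
    using locally_path_connected_Euclidean_space locally_path_connected_space_retraction_map_image by blast
qed

text \<open>Every point has an open neighbourhood homeomorphic to an open subset of the half space,
  and small path connected neighbourhoods can be found inside it.\<close>

lemma manifold_locally_path_connected:
  assumes "manifold_with_boundary d X"
  shows "locally_path_connected_space X"
  unfolding locally_path_connected_space
proof (intro allI impI)
  fix V x assume V: "openin X V \<and> x \<in> V"
  then have "x \<in> topspace X" using openin_subset by blast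
  then obtain U T where U: "openin X U" "x \<in> U" and T: "openin (half_space d) T"
    and homeo: "subtopology X U homeomorphic_space subtopology (half_space d) T"
    using assms unfolding manifold_with_boundary_def locally_like_def by blast
  have "locally_path_connected_space (subtopology X U)"
    using homeomorphic_locally_path_connected_space[OF homeo]
      locally_path_connected_space_open_subset[OF locally_path_connected_half_space T] by simp
  moreover have "openin (subtopology X U) (U \<inter> V)"
    using V U by (simp add: openin_Int openin_open_subtopology)
  ultimately obtain W where W: "openin (subtopology X U) W" "path_connectedin (subtopology X U) W" "x \<in> W" "W \<subseteq> U \<inter> V"
    using V U unfolding locally_path_connected_space by blast
  then have "openin X W" "path_connectedin X W"
    using U openin_trans_full path_connectedin_subtopology by blast+
  with W show "\<exists>U. openin X U \<and> path_connectedin X U \<and> x \<in> U \<and> U \<subseteq> V" by blast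
qed

lemma surface_path_connected:
  assumes "surface g n S"
  shows "path_connected_space (space_of S)"
  using assms manifold_locally_path_connected path_connected_eq_connected_space
  unfolding surface_def compact_oriented_manifold_def by blast

section \<open>Homology isomorphisms and nilpotent quotients\<close>

lemma path_class_cong:
  assumes "pathin X p" "\<And>t. t \<in> {0..1} \<Longrightarrow> p t = r t"
  shows "path_class X p = path_class X r"
  using path_class_eq_iff[OF assms(1)] path_homotopic_eq[OF assms] by blast

lemma pi1_map_cong:
  assumes u: "u \<in> carrier (pi1 X a)" and f: "continuous_map X Y f" and k: "continuous_map X Y k"
    and eq: "\<And>x. x \<in> topspace X \<Longrightarrow> f x = k x"
  shows "pi1_map Y f u = pi1_map Y k u"
proof -
  obtain p where p: "pathin X p" "u = path_class X p" using u by (rule pi1_carrierE)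
  have "f (p t) = k (p t)" if "t \<in> {0..1}" for t
    using path_image_subset_topspace[OF p(1)] that by (intro eq) blast
  then have "path_class Y (f \<circ> p) = path_class Y (k \<circ> p)"
    by (intro path_class_cong pathin_compose[OF p(1) f]) simp
  then show ?thesis using p f k by (simp add: pi1_map_class)
qed

lemma homology_iso_compose:
  assumes "homology_iso X Y f" "homology_iso Y Z k"
  shows "homology_iso X Z (k \<circ> f)"
  using assms unfolding homology_iso_def
  by (auto simp: hom_induced_compose_empty intro: continuous_map_compose) (metis Group.iso_set_trans)

lemma rcoset_eq_iff:
  assumes "group G" "subgroup N G" "x \<in> carrier G" "y \<in> carrier G"
  shows "N #>\<^bsub>G\<^esub> x = N #>\<^bsub>G\<^esub> y \<longleftrightarrow> x \<otimes>\<^bsub>G\<^esub> inv\<^bsub>G\<^esub> y \<in> N"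
  using assms subgroup.rcos_module[OF assms(2,1,4,3)] group.repr_independence[OF assms(1) _ assms(4,2), of x]
    group.rcos_self[OF assms(1,3,2)] by metis

locale homology_iso_map = path_connected_map X Y f a
  for X :: "'a topology" and Y :: "'b topology" and f a +
  assumes homology_iso: "homology_iso X Y f"
begin

lemma group_source: "group (pi1 X a)"
  using base_in by (rule group_pi1)

lemma group_target: "group (pi1 Y (f a))"
  using base_in continuous by (intro group_pi1) (auto simp: continuous_map_def Pi_iff)

lemma group_hom_pi1_map: "group_hom (pi1 X a) (pi1 Y (f a)) (pi1_map Y f)"
  using pi1_map_hom[OF continuous] group_source group_target by (simp add: group_hom_def group_hom_axioms_def)

lemma pi1_map_lower_central_iff:
  assumes "q \<ge> 1" "u \<in> carrier (pi1 X a)"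
  shows "pi1_map Y f u \<in> lower_central (pi1 Y (f a)) q \<longleftrightarrow> u \<in> lower_central (pi1 X a) q"
  using stallings_injective[OF homology_iso_imp(2,3,3)[OF homology_iso] assms]
    group_hom.hom_lower_central[OF group_hom_pi1_map] by blast

text \<open>The image of term \<open>q\<close> lies in term \<open>q\<close>, so the set product in
  \<open>nilquot_map\<close> does not spread over several cosets.\<close>

lemma nilquot_map_coset:
  assumes x: "x \<in> carrier (pi1 X a)"
  shows "nilquot_map (pi1 Y (f a)) q (pi1_map Y f) (lower_central (pi1 X a) q #>\<^bsub>pi1 X a\<^esub> x)
     = lower_central (pi1 Y (f a)) q #>\<^bsub>pi1 Y (f a)\<^esub> pi1_map Y f x"
proof -
  let ?G = "pi1 X a" and ?H = "pi1 Y (f a)" and ?f = "pi1_map Y f"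
  interpret F: group_hom ?G ?H ?f by (rule group_hom_pi1_map)
  let ?M = "lower_central ?G q" and ?N = "lower_central ?H q"
  interpret N: subgroup ?N ?H by (rule F.H.lower_central_subgroup)
  interpret M: subgroup ?M ?G by (rule F.G.lower_central_subgroup)
  have fx: "?f x \<in> carrier ?H" using x by simp
  show ?thesis
  proof
    show "nilquot_map ?H q ?f (?M #>\<^bsub>?G\<^esub> x) \<subseteq> ?N #>\<^bsub>?H\<^esub> ?f x"
    proof
      fix y assume "y \<in> nilquot_map ?H q ?f (?M #>\<^bsub>?G\<^esub> x)"
      then obtain n m where y: "n \<in> ?N" "m \<in> ?M" "y = n \<otimes>\<^bsub>?H\<^esub> ?f (m \<otimes>\<^bsub>?G\<^esub> x)"
        by (auto simp: nilquot_map_def set_mult_def r_coset_def)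
      have "?f m \<in> ?N" using F.hom_lower_central y(2) .
      moreover have "y = (n \<otimes>\<^bsub>?H\<^esub> ?f m) \<otimes>\<^bsub>?H\<^esub> ?f x"
        using y x by (simp add: F.H.m_assoc)
      ultimately show "y \<in> ?N #>\<^bsub>?H\<^esub> ?f x" using y(1) N.m_closed by (auto simp: r_coset_def)
    qed
    show "?N #>\<^bsub>?H\<^esub> ?f x \<subseteq> nilquot_map ?H q ?f (?M #>\<^bsub>?G\<^esub> x)"
    proof
      fix y assume "y \<in> ?N #>\<^bsub>?H\<^esub> ?f x"
      then obtain n where n: "n \<in> ?N" "y = n \<otimes>\<^bsub>?H\<^esub> ?f x" by (auto simp: r_coset_def)
      moreover have "x \<in> ?M #>\<^bsub>?G\<^esub> x" using x M.subgroup_axioms by (rule F.G.rcos_self)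
      ultimately show "y \<in> nilquot_map ?H q ?f (?M #>\<^bsub>?G\<^esub> x)"
        unfolding nilquot_map_def set_mult_def by blast
    qed
  qed
qed

text \<open>\<open>inv_into\<close> is meaningful only at values that are attained, and determined
  only if the map is injective: generation modulo term \<open>q\<close> supplies the preimage
  \<open>x\<close>, and the injectivity theorem makes its coset unique. The last relation
  characterizes that coset without reference to \<open>inv_into\<close>.\<close>

lemma inv_into_nilquot_map:
  assumes q: "q \<ge> 1" and c: "c \<in> carrier (pi1 Y (f a))"
  obtains x where "x \<in> carrier (pi1 X a)"
    "inv_into (carrier (pi1 X a Mod lower_central (pi1 X a) q)) (nilquot_map (pi1 Y (f a)) q (pi1_map Y f))
       (lower_central (pi1 Y (f a)) q #>\<^bsub>pi1 Y (f a)\<^esub> c) = lower_central (pi1 X a) q #>\<^bsub>pi1 X a\<^esub> x"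
    "pi1_map Y f x \<otimes>\<^bsub>pi1 Y (f a)\<^esub> inv\<^bsub>pi1 Y (f a)\<^esub> c \<in> lower_central (pi1 Y (f a)) q"
proof -
  let ?G = "pi1 X a" and ?H = "pi1 Y (f a)" and ?f = "pi1_map Y f"
  interpret F: group_hom ?G ?H ?f by (rule group_hom_pi1_map)
  let ?M = "lower_central ?G q" and ?N = "lower_central ?H q"
  have N: "subgroup ?N ?H" by (rule F.H.lower_central_subgroup)
  have M: "subgroup ?M ?G" by (rule F.G.lower_central_subgroup)
  obtain n x where nx: "n \<in> ?N" "x \<in> carrier ?G" "c = n \<otimes>\<^bsub>?H\<^esub> ?f x"
    using pi1_generates_modulo_lower_central[OF homology_iso_imp(3)[OF homology_iso] q c] by blast
  have n: "n \<in> carrier ?H" using nx(1) subgroup.mem_carrier[OF N] by blast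
  have "?f x \<otimes>\<^bsub>?H\<^esub> inv\<^bsub>?H\<^esub> c = inv\<^bsub>?H\<^esub> n"
    using nx n by (simp add: F.H.inv_mult_group flip: F.H.m_assoc)
  then have fx: "?f x \<otimes>\<^bsub>?H\<^esub> inv\<^bsub>?H\<^esub> c \<in> ?N" using subgroup.m_inv_closed[OF N nx(1)] by simp
  have inj: "inj_on (nilquot_map ?H q ?f) (carrier (?G Mod ?M))"
  proof (rule inj_onI)
    fix A B assume "A \<in> carrier (?G Mod ?M)" "B \<in> carrier (?G Mod ?M)"
      and eq: "nilquot_map ?H q ?f A = nilquot_map ?H q ?f B"
    then obtain y z where y: "y \<in> carrier ?G" "A = ?M #>\<^bsub>?G\<^esub> y" and z: "z \<in> carrier ?G" "B = ?M #>\<^bsub>?G\<^esub> z"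
      by (auto simp: carrier_FactGroup)
    have "?N #>\<^bsub>?H\<^esub> ?f y = ?N #>\<^bsub>?H\<^esub> ?f z"
      using eq nilquot_map_coset y z by simp
    then have "?f (y \<otimes>\<^bsub>?G\<^esub> inv\<^bsub>?G\<^esub> z) \<in> ?N"
      using rcoset_eq_iff[OF F.H.group_axioms N] y z by simp
    then have "y \<otimes>\<^bsub>?G\<^esub> inv\<^bsub>?G\<^esub> z \<in> ?M"
      using pi1_map_lower_central_iff[OF q, of "y \<otimes>\<^bsub>?G\<^esub> inv\<^bsub>?G\<^esub> z"] y z by simp
    then show "A = B" using rcoset_eq_iff[OF F.G.group_axioms M] y z by simp
  qed
  have "nilquot_map ?H q ?f (?M #>\<^bsub>?G\<^esub> x) = ?N #>\<^bsub>?H\<^esub> c"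
    using nilquot_map_coset[OF nx(2)] rcoset_eq_iff[OF F.H.group_axioms N] fx nx(2) c by simp
  then have "inv_into (carrier (?G Mod ?M)) (nilquot_map ?H q ?f) (?N #>\<^bsub>?H\<^esub> c) = ?M #>\<^bsub>?G\<^esub> x"
    using nx(2) by (intro inv_into_f_eq[OF inj]) (auto simp: carrier_FactGroup)
  with nx(2) fx that show thesis by blast
qed

end

section \<open>Milnor invariants of homology cylinders\<close>

lemma glue_point_eq:
  assumes "(x, y) \<in> E"
  shows "glue_point E (Inl x) = glue_point E (Inr y)"
proof -
  let ?r = "\<lambda>u v. \<exists>(x, y)\<in>E. u = Inl x \<and> v = Inr y"
  have "?r (Inl x) (Inr y)" using assms by blast
  then have "equivclp ?r (Inl x) (Inr y)" by (rule r_into_equivclp)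
  then have "equivclp ?r (Inl x) w \<longleftrightarrow> equivclp ?r (Inr y) w" for w
    by (meson equivclp_sym equivclp_trans)
  then show ?thesis by (simp add: glue_point_def)
qed

text \<open>The common shape of all entries: out along the plus copy of \<open>p\<close>, back along
  the minus copy. A tail gives a longitude, a handle loop gives a difference loop.\<close>

definition double_path :: "('s, 'a) cylinder \<Rightarrow> (real \<Rightarrow> 's) \<Rightarrow> real \<Rightarrow> 'a" where
  "double_path C p = (mark_plus C \<circ> p) \<cdot>\<cdot> (mark_minus C \<circ> rev_path p)"

definition milnor_entry ::
  "'s oriented_space \<Rightarrow> 's surface_system \<Rightarrow> nat \<Rightarrow> ('s, 'a) cylinder \<Rightarrow> (real \<Rightarrow> 's) \<Rightarrow> (real \<Rightarrow> 's) set set" where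
  "milnor_entry S P q C p =
     inv_into (carrier (surface_group S P Mod lower_central (surface_group S P) q))
       (nilquot_map (cylinder_group P C) q (pi1_map (space_of (body C)) (mark_plus C)))
       (lower_central (cylinder_group P C) q #>\<^bsub>cylinder_group P C\<^esub> path_class (space_of (body C)) (double_path C p))"

text \<open>Handle loops return to the base point, which lies on the boundary; so both kinds of entries
  arise from paths ending on the boundary, where the two markings agree.\<close>

definition boundary_path :: "'s oriented_space \<Rightarrow> 's surface_system \<Rightarrow> (real \<Rightarrow> 's) \<Rightarrow> bool" where
  "boundary_path S P p \<longleftrightarrow> pathin (space_of S) p \<and> p 0 = base P \<and> p 1 \<in> mfd_boundary 2 (space_of S)"

locale marked_surface =
  fixes S :: "'s oriented_space" and P :: "'s surface_system" and g n q :: nat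
  assumes n: "n \<ge> 1" and surface: "surface g n S" and system: "standard_system g n S P" and q: "q \<ge> 1"
begin

abbreviation "X \<equiv> space_of S"

lemma component_subset_boundary:
  assumes "i \<in> {1..n}"
  shows "bcomp P i \<subseteq> mfd_boundary 2 X" "bcomp P i \<subseteq> topspace X"
proof -
  have "bcomp P i \<in> connected_components_of (boundary_space 2 X)"
    using system assms unfolding standard_system_def bij_betw_def by blast
  then have "bcomp P i \<subseteq> topspace (boundary_space 2 X)"
    by (rule connected_components_of_subset)
  then show "bcomp P i \<subseteq> mfd_boundary 2 X" "bcomp P i \<subseteq> topspace X" by auto
qed

lemma base_boundary: "base P \<in> mfd_boundary 2 X" "base P \<in> topspace X"
  using component_subset_boundary[of n] n system unfolding standard_system_def by auto

lemma tail_boundary_path: "i \<in> {1..<n} \<Longrightarrow> boundary_path S P (tail P i)"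
proof -
  assume i: "i \<in> {1..<n}"
  then have b: "boundary_param X (bcomp P i) (bpath P i)" and t: "pathin X (tail P i)" "tail P i 0 = base P" "tail P i 1 = bpath P i 0"
    using system unfolding standard_system_def by auto
  have "bpath P i 0 \<in> bcomp P i"
    using b unfolding boundary_param_def path_track_def by (metis atLeastAtMost_iff imageI order_refl zero_le_one)
  then show ?thesis
    using t component_subset_boundary(1)[of i] i by (auto simp: boundary_path_def)
qed

text \<open>A representative of the class \<open>u\<close>, so that handle classes can be treated in
  the same way as the tails, which are given as paths.\<close>

definition handle_loop :: "(real \<Rightarrow> 's) set \<Rightarrow> real \<Rightarrow> 's" where
  "handle_loop u = (SOME p. pathin X p \<and> p 0 = base P \<and> p 1 = base P \<and> u = path_class X p)"

lemma handle_loop: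
  assumes "u \<in> carrier (surface_group S P)"
  shows "pathin X (handle_loop u)" "handle_loop u 0 = base P" "handle_loop u 1 = base P" "u = path_class X (handle_loop u)"
proof -
  have "\<exists>p. pathin X p \<and> p 0 = base P \<and> p 1 = base P \<and> u = path_class X p"
    using assms by (auto elim: pi1_carrierE)
  from someI_ex[OF this] show "pathin X (handle_loop u)" "handle_loop u 0 = base P" "handle_loop u 1 = base P" "u = path_class X (handle_loop u)"
    unfolding handle_loop_def by auto
qed

lemma handle_loop_boundary_path:
  "u \<in> carrier (surface_group S P) \<Longrightarrow> boundary_path S P (handle_loop u)"
  using handle_loop base_boundary by (simp add: boundary_path_def)

lemma mer_lon_carrier:
  assumes "j \<in> {1..g}"
  shows "mer P j \<in> carrier (surface_group S P)" "lon P j \<in> carrier (surface_group S P)"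
proof -
  have "j \<in> set [1..<Suc g]" using assms by (simp del: upt_Suc)
  then have "mer P j \<in> set (map (mer P) [1..<Suc g])" "lon P j \<in> set (map (lon P) [1..<Suc g])"
    by (simp_all del: upt_Suc)
  then show "mer P j \<in> carrier (surface_group S P)" "lon P j \<in> carrier (surface_group S P)"
    using system unfolding standard_system_def free_generators_def set_append by blast+
qed

definition milnor_paths :: "(real \<Rightarrow> 's) list" where
  "milnor_paths = map (tail P) [1..<n] @ map (handle_loop \<circ> mer P) [1..<Suc g] @ map (handle_loop \<circ> lon P) [1..<Suc g]"

lemma milnor_paths_boundary_path: "p \<in> set milnor_paths \<Longrightarrow> boundary_path S P p"
  using tail_boundary_path handle_loop_boundary_path mer_lon_carrier
  by (auto simp: milnor_paths_def)

text \<open>The tails contribute \<open>n - 1\<close> paths and the handles \<open>2 * g\<close>;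
  \<open>n \<ge> 1\<close> keeps the subtraction of natural numbers from truncating.\<close>

lemma length_milnor_paths: "length milnor_paths = 2 * g + n - 1"
  using n by (simp add: milnor_paths_def del: upt_Suc)

section \<open>The invariant of a single homology cylinder\<close>

context
  fixes C :: "('s, 'a) cylinder"
  assumes C: "homology_cylinder S C"
begin

lemma markings:
  "homology_iso X (space_of (body C)) (mark_plus C)" "homology_iso X (space_of (body C)) (mark_minus C)"
  "continuous_map X (space_of (body C)) (mark_plus C)" "continuous_map X (space_of (body C)) (mark_minus C)"
  "\<And>x. x \<in> mfd_boundary 2 X \<Longrightarrow> mark_plus C x = mark_minus C x"
  using C unfolding homology_cylinder_def homology_iso_def by auto

lemma marking_homology_iso_map: "homology_iso_map X (space_of (body C)) (mark_plus C) (base P)"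
  using markings base_boundary surface_path_connected[OF surface]
  by (simp add: homology_iso_map_def homology_iso_map_axioms_def path_connected_map_def)

lemma pathin_double_path:
  assumes "boundary_path S P p"
  shows "pathin (space_of (body C)) (double_path C p)"
  unfolding double_path_def using assms markings
  by (intro pathin_join_path pathin_compose pathin_rev_path) (auto simp: boundary_path_def)

lemma double_path_ends:
  "boundary_path S P p \<Longrightarrow> double_path C p 0 = mark_plus C (base P)"
  "boundary_path S P p \<Longrightarrow> double_path C p 1 = mark_plus C (base P)"
  using markings(5)[OF base_boundary(1)] by (auto simp: boundary_path_def double_path_def)

lemma double_path_carrier:
  "boundary_path S P p \<Longrightarrow> path_class (space_of (body C)) (double_path C p) \<in> carrier (cylinder_group P C)"
  using pathin_double_path double_path_ends by (intro pi1_carrierI)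

text \<open>The inverse of \<open>u\<close> is the class of the reversed loop, and the two markings
  agree at the base point, so the product of the two images is the class of the joined path.\<close>

lemma difference_loop_eq:
  assumes u: "u \<in> carrier (surface_group S P)"
  shows "difference_loop S P C u = path_class (space_of (body C)) (double_path C (handle_loop u))"
proof -
  note p = handle_loop[OF u]
  have inv: "inv\<^bsub>surface_group S P\<^esub> u = path_class X (rev_path (handle_loop u))"
    using pi1_inv[OF p(1-3)] p(4) by simp
  have "pi1_map (space_of (body C)) (mark_plus C) u = path_class (space_of (body C)) (mark_plus C \<circ> handle_loop u)"
    using pi1_map_class[OF p(1) markings(3)] p(4) by simp
  then show ?thesis
    unfolding difference_loop_def inv double_path_def
    using p markings(5)[OF base_boundary(1)] pathin_compose[OF p(1) markings(3)]
      pathin_compose[OF pathin_rev_path[OF p(1)] markings(4)]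
    by (simp add: pi1_map_class[OF pathin_rev_path[OF p(1)] markings(4)] pi1_mult)
qed

lemma milnor_mu_eq: "milnor_mu g n S P q C = map (milnor_entry S P q C) milnor_paths"
proof -
  have "map (\<lambda>j. difference_loop S P C (mer P j)) [1..<Suc g] =
      map (\<lambda>j. path_class (space_of (body C)) (double_path C (handle_loop (mer P j)))) [1..<Suc g]"
    "map (\<lambda>j. difference_loop S P C (lon P j)) [1..<Suc g] =
      map (\<lambda>j. path_class (space_of (body C)) (double_path C (handle_loop (lon P j)))) [1..<Suc g]"
    using mer_lon_carrier by (auto intro!: difference_loop_eq)
  moreover have "longitude P C = (\<lambda>i. path_class (space_of (body C)) (double_path C (tail P i)))"
    by (simp add: longitude_def double_path_def fun_eq_iff)
  ultimately show ?thesis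
    unfolding milnor_mu_def milnor_paths_def by (simp add: milnor_entry_def o_def del: upt_Suc)
qed

text \<open>The representative \<open>x\<close> comes with a relation in the group of the cylinder;
  unlike the inverse map in the definition, such a relation can be pushed forward into a
  cobordism.\<close>

lemma milnor_entry_obtain:
  assumes "boundary_path S P p"
  obtains x where "x \<in> carrier (surface_group S P)"
    "milnor_entry S P q C p = lower_central (surface_group S P) q #>\<^bsub>surface_group S P\<^esub> x"
    "pi1_map (space_of (body C)) (mark_plus C) x \<otimes>\<^bsub>cylinder_group P C\<^esub>
       inv\<^bsub>cylinder_group P C\<^esub> path_class (space_of (body C)) (double_path C p) \<in> lower_central (cylinder_group P C) q"
  using homology_iso_map.inv_into_nilquot_map[OF marking_homology_iso_map q double_path_carrier[OF assms]]
  unfolding milnor_entry_def by blast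

lemma milnor_mu_in_target: "milnor_mu g n S P q C \<in> milnor_target g n S P q"
proof -
  have "milnor_entry S P q C p \<in> carrier (surface_group S P Mod lower_central (surface_group S P) q)"
    if "p \<in> set milnor_paths" for p
    by (rule milnor_entry_obtain[OF milnor_paths_boundary_path[OF that]]) (auto simp: carrier_FactGroup)
  then show ?thesis
    by (auto simp: milnor_target_def milnor_mu_eq length_milnor_paths)
qed

end

text \<open>After inclusion into \<open>W\<close> the two doubles of \<open>p\<close> coincide as
  paths. The representatives \<open>x\<close> and \<open>y\<close> of the two entries therefore map
  to the same element \<open>e\<close> modulo term \<open>q\<close>, and the injectivity theorem,
  applied to the map \<open>f\<close> from the surface to \<open>W\<close>, identifies their
  cosets.\<close>

lemma milnor_mu_cobordant:
  fixes C :: "('s, 'a) cylinder" and D :: "('s, 'b) cylinder"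
  assumes C: "homology_cylinder S C" and D: "homology_cylinder S D"
    and cob: "homology_cobordant TYPE('w) S C D"
  shows "milnor_mu g n S P q C = milnor_mu g n S P q D"
proof -
  let ?E = "marking_identification S C D" and ?a = "base P"
  obtain W :: "'w oriented_space" and h
    where kC: "homology_iso (space_of (body C)) (space_of W) (h \<circ> glue_left ?E)"
      and kD: "homology_iso (space_of (body D)) (space_of W) (h \<circ> glue_right ?E)"
    using cob unfolding homology_cobordant_def Let_def by blast
  define k l where "k = h \<circ> glue_left ?E" and "l = h \<circ> glue_right ?E"
  note k = homology_iso_imp(1)[OF kC, folded k_def] and l = homology_iso_imp(1)[OF kD, folded l_def]
  note mC = markings[OF C] and mD = markings[OF D]
  have plus: "k (mark_plus C x) = l (mark_plus D x)" and minus: "k (mark_minus C x) = l (mark_minus D x)"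
    if "x \<in> topspace X" for x
    using that glue_point_eq[of "mark_plus C x" "mark_plus D x" ?E] glue_point_eq[of "mark_minus C x" "mark_minus D x" ?E]
    by (auto simp: k_def l_def marking_identification_def)
  define f where "f = k \<circ> mark_plus C"
  have f: "homology_iso X (space_of W) f"
    unfolding f_def k_def by (rule homology_iso_compose[OF mC(1) kC])
  interpret F: homology_iso_map X "space_of W" f ?a
    using f homology_iso_imp(1)[OF f] base_boundary surface_path_connected[OF surface]
    by (simp add: homology_iso_map_def homology_iso_map_axioms_def path_connected_map_def)
  let ?G = "surface_group S P" and ?H = "pi1 (space_of W) (f ?a)"
  have fa: "f ?a = k (mark_plus C ?a)" "f ?a = l (mark_plus D ?a)"
    using plus[OF base_boundary(2)] by (auto simp: f_def)
  interpret F: group_hom ?G ?H "pi1_map (space_of W) f" by (rule F.group_hom_pi1_map)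
  interpret K: group_hom "cylinder_group P C" ?H "pi1_map (space_of W) k"
    unfolding fa(1) using pi1_map_hom[OF k] F.H.group_axioms homology_iso_map.group_target[OF marking_homology_iso_map[OF C]]
    by (simp add: group_hom_def group_hom_axioms_def fa(1))
  interpret L: group_hom "cylinder_group P D" ?H "pi1_map (space_of W) l"
    unfolding fa(2) using pi1_map_hom[OF l] F.H.group_axioms homology_iso_map.group_target[OF marking_homology_iso_map[OF D]]
    by (simp add: group_hom_def group_hom_axioms_def fa(2))
  let ?N = "lower_central ?H q" and ?M = "lower_central ?G q"
  have "milnor_entry S P q C p = milnor_entry S P q D p" if p: "boundary_path S P p" for p
  proof -
    obtain x where x: "x \<in> carrier ?G" "milnor_entry S P q C p = ?M #>\<^bsub>?G\<^esub> x"
      and xC: "pi1_map (space_of (body C)) (mark_plus C) x \<otimes>\<^bsub>cylinder_group P C\<^esub>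
       inv\<^bsub>cylinder_group P C\<^esub> path_class (space_of (body C)) (double_path C p) \<in> lower_central (cylinder_group P C) q"
      by (rule milnor_entry_obtain[OF C p])
    obtain y where y: "y \<in> carrier ?G" "milnor_entry S P q D p = ?M #>\<^bsub>?G\<^esub> y"
      and yD: "pi1_map (space_of (body D)) (mark_plus D) y \<otimes>\<^bsub>cylinder_group P D\<^esub>
       inv\<^bsub>cylinder_group P D\<^esub> path_class (space_of (body D)) (double_path D p) \<in> lower_central (cylinder_group P D) q"
      by (rule milnor_entry_obtain[OF D p])
    define e where "e = pi1_map (space_of W) k (path_class (space_of (body C)) (double_path C p))"
    \<comment> \<open>The gluing identifies the markings point by point, so the two paths agree on
      the unit interval; no homotopy has to be constructed.\<close>
    have "path_class (space_of W) (k \<circ> double_path C p) = path_class (space_of W) (l \<circ> double_path D p)"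
    proof (rule path_class_cong)
      show "pathin (space_of W) (k \<circ> double_path C p)" by (rule pathin_compose[OF pathin_double_path[OF C p] k])
      have "p s \<in> topspace X" if "s \<in> {0..1}" for s
        using p path_image_subset_topspace that by (fastforce simp: boundary_path_def)
      then show "(k \<circ> double_path C p) t = (l \<circ> double_path D p) t" if "t \<in> {0..1}" for t
        using that plus minus by (auto simp: double_path_def join_path_def rev_path_def)
    qed
    then have e': "e = pi1_map (space_of W) l (path_class (space_of (body D)) (double_path D p))"
      using pi1_map_class[OF pathin_double_path[OF C p] k] pi1_map_class[OF pathin_double_path[OF D p] l]
      by (simp add: e_def)
    have eH: "e \<in> carrier ?H" unfolding e_def by (rule K.hom_closed[OF double_path_carrier[OF C p]])
    have "pi1_map (space_of W) k (pi1_map (space_of (body C)) (mark_plus C) x) = pi1_map (space_of W) f x"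
      unfolding f_def by (rule pi1_map_compose[OF mC(3) k x(1)])
    then have fx: "pi1_map (space_of W) f x \<otimes>\<^bsub>?H\<^esub> inv\<^bsub>?H\<^esub> e \<in> ?N"
      using K.hom_lower_central[OF xC] double_path_carrier[OF C p] x(1)
        hom_in_carrier[OF pi1_map_hom[OF mC(3)] x(1)] by (simp add: e_def)
    have "pi1_map (space_of W) l (pi1_map (space_of (body D)) (mark_plus D) y) = pi1_map (space_of W) (l \<circ> mark_plus D) y"
      by (rule pi1_map_compose[OF mD(3) l y(1)])
    \<comment> \<open>\<open>f\<close> was defined through \<open>C\<close>; the corresponding map
      through \<open>D\<close> is known to agree with it on the points of the surface, which is all
      that its effect on loops depends on.\<close>
    also have "\<dots> = pi1_map (space_of W) f y"
      using plus by (intro pi1_map_cong[OF y(1)] F.continuous continuous_map_compose[OF mD(3) l]) (auto simp: f_def)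
    finally have fy: "pi1_map (space_of W) f y \<otimes>\<^bsub>?H\<^esub> inv\<^bsub>?H\<^esub> e \<in> ?N"
      using L.hom_lower_central[OF yD] double_path_carrier[OF D p] y(1)
        hom_in_carrier[OF pi1_map_hom[OF mD(3)] y(1)] by (simp add: e')
    have N: "subgroup ?N ?H" by (rule F.H.lower_central_subgroup)
    let ?x = "pi1_map (space_of W) f x" and ?y = "pi1_map (space_of W) f y"
    have xy: "?x \<in> carrier ?H" "?y \<in> carrier ?H" using x y by auto
    have c: "inv\<^bsub>?H\<^esub> e \<otimes>\<^bsub>?H\<^esub> (e \<otimes>\<^bsub>?H\<^esub> z) = z" if "z \<in> carrier ?H" for z
      using eH that by (simp flip: F.H.m_assoc)
    \<comment> \<open>Dividing one relation by the other cancels \<open>e\<close>.\<close>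
    have "(?x \<otimes>\<^bsub>?H\<^esub> inv\<^bsub>?H\<^esub> e) \<otimes>\<^bsub>?H\<^esub> inv\<^bsub>?H\<^esub> (?y \<otimes>\<^bsub>?H\<^esub> inv\<^bsub>?H\<^esub> e) \<in> ?N"
      by (intro subgroup.m_closed[OF N] subgroup.m_inv_closed[OF N] fx fy)
    also have "(?x \<otimes>\<^bsub>?H\<^esub> inv\<^bsub>?H\<^esub> e) \<otimes>\<^bsub>?H\<^esub> inv\<^bsub>?H\<^esub> (?y \<otimes>\<^bsub>?H\<^esub> inv\<^bsub>?H\<^esub> e) = pi1_map (space_of W) f (x \<otimes>\<^bsub>?G\<^esub> inv\<^bsub>?G\<^esub> y)"
      using x y xy eH by (simp add: F.H.inv_mult_group F.H.m_assoc c)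
    finally have "x \<otimes>\<^bsub>?G\<^esub> inv\<^bsub>?G\<^esub> y \<in> ?M"
      using F.pi1_map_lower_central_iff[OF q, of "x \<otimes>\<^bsub>?G\<^esub> inv\<^bsub>?G\<^esub> y"] x(1) y(1) by blast
    then show ?thesis
      using rcoset_eq_iff[OF F.G.group_axioms F.G.lower_central_subgroup x(1) y(1)] x y by simp
  qed
  then show ?thesis
    unfolding milnor_mu_eq[OF C] milnor_mu_eq[OF D] using milnor_paths_boundary_path by simp
qed

text \<open>Classes are formed with the generated equivalence relation, so the equality is carried
  along a chain of cobordisms, each of which may be read in either direction.\<close>

lemma milnor_mu_cobordism_rel:
  assumes "(C, D) \<in> cobordism_rel TYPE('w) S"
  shows "milnor_mu g n S P q C = milnor_mu g n S P q D"
proof -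
  let ?r = "\<lambda>C D. C \<in> cylinders S \<and> D \<in> cylinders S \<and> homology_cobordant TYPE('w) S C D"
  have "(symclp ?r)\<^sup>*\<^sup>* C D" using assms by (simp add: cobordism_rel_def equivclp_def)
  then show ?thesis
  proof (induction rule: rtranclp_induct)
    case (step D D')
    then have "milnor_mu g n S P q D = milnor_mu g n S P q D'"
      using milnor_mu_cobordant by (fastforce simp: symclp_def cylinders_def)
    with step show ?case by simp
  qed simp
qed

end

section \<open>The induced map on homology cobordism classes\<close>

lemma cobordism_rel_refl: "C \<in> cylinders S \<Longrightarrow> (C, C) \<in> cobordism_rel T S"
  by (simp add: cobordism_rel_def)

theorem theorem3p1:
  fixes S :: "'s oriented_space" and P :: "'s surface_system" and g n q :: nat
  assumes "n \<ge> 1" and "surface g n S" and "standard_system g n S P" and "q \<ge> 1"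
  shows "(\<forall>(C :: ('s, 'a) cylinder) (D :: ('s, 'b) cylinder).
            homology_cylinder S C \<longrightarrow> homology_cylinder S D \<longrightarrow>
            homology_cobordant TYPE('w) S C D \<longrightarrow>
            milnor_mu g n S P q C = milnor_mu g n S P q D) \<and>
         (\<exists>!f. f \<in> (cobordism_classes TYPE('w) S :: ('s, 'a) cylinder set set)
                    \<rightarrow>\<^sub>E milnor_target g n S P q \<and>
               (\<forall>C\<in>cylinders S. f (cobordism_rel TYPE('w) S `` {C}) = milnor_mu g n S P q C))"
proof (intro conjI allI impI)
  interpret marked_surface S P g n q
    by (rule marked_surface.intro) (fact assms)+
  show "milnor_mu g n S P q C = milnor_mu g n S P q D"
    if "homology_cylinder S C" "homology_cylinder S D" "homology_cobordant TYPE('w) S C D"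
    for C :: "('s, 'a) cylinder" and D :: "('s, 'b) cylinder"
    using that by (rule milnor_mu_cobordant)
  let ?R = "cobordism_rel TYPE('w) S :: (('s, 'a) cylinder \<times> ('s, 'a) cylinder) set"
  let ?K = "cobordism_classes TYPE('w) S :: ('s, 'a) cylinder set set"
  let ?mu = "milnor_mu g n S P q :: ('s, 'a) cylinder \<Rightarrow> _"
  \<comment> \<open>The value is read off at an arbitrary member of the class, and
    \<open>restrict\<close> gives the default value off the set of classes that membership in
    \<open>\<rightarrow>\<^sub>E\<close> requires.\<close>
  let ?f = "restrict (\<lambda>A. ?mu (SOME C. C \<in> A)) ?K"
  have val: "?f (?R `` {C}) = ?mu C" if C: "C \<in> cylinders S" for C
  proof -
    have "C \<in> ?R `` {C}" using cobordism_rel_refl[OF C] by blast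
    then have "(SOME D. D \<in> ?R `` {C}) \<in> ?R `` {C}" by (rule someI)
    then have "?mu (SOME D. D \<in> ?R `` {C}) = ?mu C"
      using milnor_mu_cobordism_rel[where 'w = 'w] by (metis Image_singleton_iff)
    moreover have "?R `` {C} \<in> ?K" using C by (auto simp: cobordism_classes_def quotient_def)
    ultimately show ?thesis by simp
  qed
  show "\<exists>!f. f \<in> ?K \<rightarrow>\<^sub>E milnor_target g n S P q \<and> (\<forall>C\<in>cylinders S. f (?R `` {C}) = ?mu C)"
  proof (rule ex1I)
    have "?f A \<in> milnor_target g n S P q" if "A \<in> ?K" for A
    proof -
      obtain C where "C \<in> cylinders S" "A = ?R `` {C}"
        using \<open>A \<in> ?K\<close> by (auto simp: cobordism_classes_def quotient_def)
      then show ?thesis using val milnor_mu_in_target by (simp add: cylinders_def)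
    qed
    then show "?f \<in> ?K \<rightarrow>\<^sub>E milnor_target g n S P q \<and> (\<forall>C\<in>cylinders S. ?f (?R `` {C}) = ?mu C)"
      using val by (auto simp: PiE_def Pi_def)
  next
    fix f assume f: "f \<in> ?K \<rightarrow>\<^sub>E milnor_target g n S P q \<and> (\<forall>C\<in>cylinders S. f (?R `` {C}) = ?mu C)"
    show "f = ?f"
    proof
      fix A show "f A = ?f A"
      proof (cases "A \<in> ?K")
        case True
        then obtain C where "C \<in> cylinders S" "A = ?R `` {C}"
          by (auto simp: cobordism_classes_def quotient_def)
        then show ?thesis using val f by simp
      next
        \<comment> \<open>Off the set of classes, extensionality forces both functions to the same
          default value, which is what makes uniqueness hold for functions on the whole
          type.\<close>
        case False
        then show ?thesis using f by (auto simp: PiE_def extensional_def)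
      qed
    qed
  qed
qed

end
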